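(* Let $X_1,X_2,\dots$ be independent identically distributed random variables and $S_n=X_1+\dots+X_n$. Let $\{\tau_n\}_{n\ge1}$ be a nonnegative sequence and let $\{a_n\}_{n\ge1}$ be a non-decreasing strictly positive sequence with $a_n\to\infty$. Suppose there exist finite real constants $\theta\ge1$, $C>0$ and $N\ge2$ such that for all $n\ge N$, $$\frac{a_n^{3\theta}}{n^{\theta-1}}\sum_{k=n}^\infty \frac{k^\theta\tau_k}{a_k^{3\theta}}\le C\sum_{k=1}^{n-1}k\tau_k.$$ If $\theta>1$, assume additionally that $$\liminf_{n\to\infty}\inf_{k\ge n}\frac{a_k^3}{k a_n^3}\sum_{j=1}^{n-1} j\tau_j>0.$$ Consider the conditions: (i) there is a sequence $\{\mu_n\}$ with $\mu_n$ a median of $S_n$ for every $n$, such that for every $\varepsilon>0$, $\sum_{n\in M_\varepsilon}\tau_n<\infty$, where $M_\varepsilon=\{n\in\mathbb Z^+: |\mu_n|>\varepsilon a_n\}$; (ii) $\sum_{n=1}^\infty n\tau_n P(|X_1|\ge \varepsilon a_n)<\infty$ for all $\varepsilon>0$; (iii) $\sum_{n=1}^\infty \tau_n e^{-\varepsilon^2a_n^2/(nT_{\varepsilon,n})}<\infty$ for all $\varepsilon>0$, where $T_{\varepsilon,n}=E[X_1^2 1_{\{|X_1|<\varepsilon a_n\}}]$ and $e^{-t/0}=0$ for $t>0$. If (i), (ii) and (iii) all hold, then $$\sum_{n=1}^\infty \tau_nP(|S_n|\ge\varepsilon a_n)<\infty\quad\text{for all }\varepsilon>0. \qquad ( * )$$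 Conversely, if $\{\tau_n\}$ satisfies Condition A and $( * )$ holds, then (i), (ii) and (iii) all hold.
   Context: "Positive" means nonnegative; "increasing" means non-decreasing. A nonnegative sequence $\{\tau_n\}_{n\ge1}$ satisfies Condition A if for every nonnegative non-increasing sequence $\{c_n\}$ with $\sum_n \tau_n\min(nc_n,1)<\infty$ we also have $\sum_n\tau_n nc_n<\infty$. *)

theory Defs
  imports "HOL-Probability.Probability"
begin

definition is_median :: "'a measure \<Rightarrow> ('a \<Rightarrow> real) \<Rightarrow> real \<Rightarrow> bool" where
  "is_median M Y m \<longleftrightarrow>
     measure M {x \<in> space M. Y x \<ge> m} \<ge> 1/2 \<and> measure M {x \<in> space M. Y x \<le> m} \<ge> 1/2"

text \<open>exp(-t/s) with the convention exp(-t/0) = 0 (used for t > 0, s \<ge> 0).\<close>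
definition exp_neg_div :: "real \<Rightarrow> real \<Rightarrow> real" where
  "exp_neg_div t s = (if s = 0 then 0 else exp (- t / s))"

text \<open>Condition A for a nonnegative sequence tau indexed by n \<ge> 1
  (all series start at n = 1, written via the shift n \<mapsto> Suc n).\<close>
definition condition_A :: "(nat \<Rightarrow> real) \<Rightarrow> bool" where
  "condition_A \<tau> \<longleftrightarrow>
    (\<forall>c :: nat \<Rightarrow> real.
       (\<forall>n\<ge>1. c n \<ge> 0) \<and> (\<forall>n\<ge>1. c (Suc n) \<le> c n) \<and>
       summable (\<lambda>n. \<tau> (Suc n) * min (real (Suc n) * c (Suc n)) 1)
       \<longrightarrow> summable (\<lambda>n. \<tau> (Suc n) * (real (Suc n) * c (Suc n))))"

end

(* Symmetrize: Y_i = X_i - X_(n+i) for i = 1..n, and truncate at a multiple of a_n. Let V and A be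
   n times the truncated second and absolute third moment of Y_1, and let x be a multiple of a_n.

   A Chernoff bound gives P(|sum Y_i| >= x) <= n P(|Y_1| >= x / (8 theta)) + 2 exp(-x^2 / (4 V))
   + const (A / x^3)^theta. Conversely, the Paley-Zygmund inequality for exp(h sum Y_i) with
   h = 16 x / V gives P(|sum Y_i| >= x) >= exp(-1024 x^2 / V) / 8 unless A / x^3 is so large that
   (A / x^3)^theta already dominates the Gaussian term. The series of tau_n (A / a_n^3)^theta is
   finite by summation by parts: this is where the two hypotheses on tau and a enter, together with
   condition (ii). Under Condition A, condition (ii) itself follows from Levy's inequality for the
   maximum of the |Y_i|. Medians are used to pass between X and Y. *)
theory Submission
  imports Defs
begin

subsection \<open>The weights\<close>

text \<open>Symmetric summands are needed in the lower bound: their truncations have vanishing first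
  and third moments, and flipping signs outside a symmetric set preserves the joint law, so
  truncation costs a factor 2 instead of an error term. The price is the way back to X_1. A fixed
  median m of X_1 is eventually below any multiple of a_n, so (ii) transfers back directly. In (iii)
  it leaves a term n m^2 / a_n^2, and when X_1 is constant the law of X_1 - X_2 retains nothing of
  m, so the series of tail probabilities of S_n has to be used a second time. A cut-off second
  moment behaves badly under these transfers, because its integrand is not monotone in |y|.
  Condition (iii) is therefore carried through the proof with E min(Y^2 / a_n^2, 1), which differs
  from it only by constants and by tail probabilities. Levy's inequality cannot give more than the
  series of tau_n min(n P(|Y_1| >= t), 1), since the probability of a maximum is at most 1. Removing
  this minimum is what Condition A does.\<close>

lemma powr_diff_le:
  fixes x y \<theta> :: real
  assumes "0 \<le> y" "y \<le> x" "\<theta> \<ge> 1"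
  shows "x powr \<theta> - y powr \<theta> \<le> \<theta> * x powr (\<theta> - 1) * (x - y)"
\<comment> \<open>The mean value theorem needs a derivative at both end points, which the rules for
  \<open>powr\<close> do not give at 0; so \<open>y = 0\<close> is handled directly.\<close>
proof (cases "y = x \<or> y = 0")
  case True
  then show ?thesis
  proof
    assume "y = 0"
    then have "x powr \<theta> = x powr (\<theta> - 1) * x"
      using assms by (cases "x = 0") (auto simp: powr_diff)
    moreover have "1 * (x powr (\<theta> - 1) * x) \<le> \<theta> * (x powr (\<theta> - 1) * x)"
      using assms by (intro mult_right_mono) auto
    ultimately show ?thesis using \<open>y = 0\<close> assms by (simp add: mult.assoc)
  qed simp
next
  case False
  then have y: "0 < y" "y < x" using assms by auto
  have "\<exists>z. y < z \<and> z < x \<and> x powr \<theta> - y powr \<theta> = (x - y) * (\<theta> * z powr (\<theta> - 1))"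
    using y by (intro MVT2) (auto intro!: derivative_eq_intros simp: powr_diff)
  then obtain z where z: "y < z" "z < x" "x powr \<theta> - y powr \<theta> = (x - y) * (\<theta> * z powr (\<theta> - 1))"
    by blast
  have "z powr (\<theta> - 1) \<le> x powr (\<theta> - 1)" using z y assms by (intro powr_mono2) auto
  then have "(x - y) * (\<theta> * z powr (\<theta> - 1)) \<le> (x - y) * (\<theta> * x powr (\<theta> - 1))"
    using y assms by (intro mult_left_mono) auto
  then show ?thesis using z by (simp add: algebra_simps)
qed

text \<open>The deterministic hypotheses, kept apart from probability. \<open>key\<close> asserts
  summability separately because the formal sum of a divergent series is an unspecified real,
  whereas in the informal statement an infinite left side violates the bound.\<close>

locale weighted_scale =
  fixes \<tau> a :: "nat \<Rightarrow> real" and \<theta> C N :: real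
  assumes tau_nonneg: "\<And>n. n \<ge> 1 \<Longrightarrow> \<tau> n \<ge> 0"
    and a_pos: "\<And>n. n \<ge> 1 \<Longrightarrow> a n > 0"
    and a_mono: "\<And>n. n \<ge> 1 \<Longrightarrow> a n \<le> a (Suc n)"
    and a_lim: "filterlim a at_top sequentially"
    and theta: "\<theta> \<ge> 1" and Cpos: "C > 0" and N: "N \<ge> 2"
    and key: "\<And>n::nat. real n \<ge> N \<Longrightarrow>
       summable (\<lambda>j. real (n + j) powr \<theta> * \<tau> (n + j) / a (n + j) powr (3 * \<theta>)) \<and>
       a n powr (3 * \<theta>) / real n powr (\<theta> - 1) *
         (\<Sum>j. real (n + j) powr \<theta> * \<tau> (n + j) / a (n + j) powr (3 * \<theta>))
       \<le> C * (\<Sum>k=1..n-1. real k * \<tau> k)"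
    and extra: "\<theta> > 1 \<Longrightarrow>
       Liminf sequentially (\<lambda>n. INF k\<in>{n..}.
          ereal (a k ^ 3 / (real k * a n ^ 3) * (\<Sum>j=1..n-1. real j * \<tau> j))) > 0"
begin

text \<open>The shift keeps index 0 out, since nothing is known about \<open>\<tau> 0\<close> and
  \<open>a 0\<close>.\<close>

definition tau_summable :: "(nat \<Rightarrow> real) \<Rightarrow> bool" where
  "tau_summable f \<longleftrightarrow> summable (\<lambda>n. \<tau> (Suc n) * f (Suc n))"

lemma tau_summable_mono:
  assumes "tau_summable g" "\<And>n. n \<ge> 1 \<Longrightarrow> 0 \<le> f n" "\<forall>\<^sub>F n in sequentially. f n \<le> g n"
  shows "tau_summable f"
  unfolding tau_summable_def
proof (rule summable_comparison_test_ev)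
  have "\<forall>\<^sub>F n in sequentially. f (Suc n) \<le> g (Suc n)"
    using assms(3) eventually_sequentially_Suc[of "\<lambda>n. f n \<le> g n"] by simp
  then show "\<forall>\<^sub>F n in sequentially. norm (\<tau> (Suc n) * f (Suc n)) \<le> \<tau> (Suc n) * g (Suc n)"
    by eventually_elim (use assms(2) tau_nonneg in \<open>auto simp: abs_mult intro!: mult_left_mono\<close>)
qed (use assms(1) in \<open>simp add: tau_summable_def\<close>)

lemma tau_summable_add: "tau_summable f \<Longrightarrow> tau_summable g \<Longrightarrow> tau_summable (\<lambda>n. f n + g n)"
  unfolding tau_summable_def by (simp add: distrib_left summable_add)

lemma tau_summable_cmult: "tau_summable f \<Longrightarrow> tau_summable (\<lambda>n. c * f n)"
  unfolding tau_summable_def using summable_mult[of _ c] by (simp add: mult.left_commute)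

definition w :: "nat \<Rightarrow> real" where
  "w n = real n powr \<theta> * \<tau> n / a n powr (3 * \<theta>)"

definition B :: "nat \<Rightarrow> real" where
  "B n = (\<Sum>k=1..n-1. real k * \<tau> k)"

lemma w_nonneg: "0 \<le> w n"
  \<comment> \<open>\<open>0 powr \<theta> = 0\<close> gives \<open>w 0 = 0\<close> whatever
    \<open>\<tau> 0\<close> is.\<close>
  using tau_nonneg[of n] by (cases "n = 0") (auto simp: w_def intro!: divide_nonneg_nonneg mult_nonneg_nonneg)

lemma B_nonneg: "0 \<le> B n"
  unfolding B_def by (intro sum_nonneg mult_nonneg_nonneg) (auto simp: tau_nonneg)

lemma w_summable: "summable w"
proof -
  define m where "m = nat \<lceil>N\<rceil>"
  have "real m \<ge> N" unfolding m_def by linarith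
  from key[OF this] have "summable (\<lambda>j. w (j + m))" by (simp add: add.commute w_def)
  then show ?thesis by (subst (asm) summable_iff_shift)
qed

text \<open>Majorant for the case of an almost surely constant \<open>X 1\<close>, where an
  exponential in \<open>- a n\<close> is compared with a power of \<open>a n\<close>.\<close>

lemma tau_summable_w: "tau_summable (\<lambda>n. real n powr \<theta> / a n powr (3 * \<theta>))"
  using w_summable summable_Suc_iff[of w]
  unfolding tau_summable_def by (simp add: mult_ac w_def)

lemma w_tail_le:
  assumes "real n \<ge> N"
  shows "(\<Sum>j. w (n + j)) \<le> C * real n powr (\<theta> - 1) * B n / a n powr (3 * \<theta>)"
proof -
  have n: "n \<ge> 1" using assms N by (cases n) auto
  then have "a n powr (3*\<theta>) > 0" "real n powr (\<theta> - 1) > 0" using a_pos[of n] by auto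
  then show ?thesis using key[OF assms, folded w_def B_def] by (simp add: field_simps)
qed

text \<open>Any real strictly between 0 and the liminf serves as \<open>c\<close>. With denominators
  cleared, the bound lets \<open>a n ^ 3\<close> be traded for
  \<open>B n * a k ^ 3 / (c * k)\<close> under a sum over \<open>n \<le> k\<close>.\<close>

lemma extra_bound:
  assumes "\<theta> > 1"
  obtains c n0 where "c > 0" "n0 \<ge> 1"
    "\<And>n k. n0 \<le> n \<Longrightarrow> n \<le> k \<Longrightarrow> c * real k * a n ^ 3 \<le> B n * a k ^ 3"
proof -
  obtain c where c: "0 < ereal c"
     "ereal c < Liminf sequentially (\<lambda>n. INF k\<in>{n..}. ereal (a k ^ 3 / (real k * a n ^ 3) * B n))"
    using ereal_dense2[OF extra[OF assms, folded B_def]] by auto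
  from less_LiminfD[OF c(2)] obtain n1 where n1:
    "\<And>n. n \<ge> n1 \<Longrightarrow> ereal c < (INF k\<in>{n..}. ereal (a k ^ 3 / (real k * a n ^ 3) * B n))"
    by (auto simp: eventually_sequentially)
  show ?thesis
  proof (rule that[of c "max 1 n1"])
    fix n k assume nk: "max 1 n1 \<le> n" "n \<le> k"
    have "ereal c < ereal (a k ^ 3 / (real k * a n ^ 3) * B n)"
      by (rule less_le_trans[OF n1 INF_lower]) (use nk in auto)
    moreover have "real k * a n ^ 3 > 0" using a_pos[of n] nk by auto
    ultimately show "c * real k * a n ^ 3 \<le> B n * a k ^ 3" by (simp add: field_simps)
  qed (use c in auto)
qed

text \<open>Two summations by parts. One moves the weights \<open>w\<close> to their tails
  \<open>R\<close>, which \<open>key\<close> bounds through \<open>B\<close>, and differentiates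
  \<open>G powr \<theta>\<close>; what remains is \<open>p j * B j\<close> times a power
  \<open>\<theta> - 1\<close> of \<open>j * G j / a j ^ 3\<close>. That power is bounded by
  \<open>extra\<close>, and the other summation by parts turns the sum of \<open>p j * B j\<close>
  into the series assumed to converge.\<close>

lemma tau_summable_third_moment:
  fixes F G :: "nat \<Rightarrow> real"
  assumes F_nonneg: "\<And>n. 0 \<le> F n" and F_mono: "\<And>n. F (Suc n) \<le> F n"
    and F_sum: "tau_summable (\<lambda>n. real n * F n)"
    and G_def: "\<And>n. G n = (\<Sum>j=1..n. a j ^ 3 * (F (j - 1) - F j))"
  shows "tau_summable (\<lambda>n. (real n * G n / a n ^ 3) powr \<theta>)"
proof -
  \<comment> \<open>In the application \<open>F\<close> is a tail probability along
    \<open>a\<close>, \<open>p j\<close> is the mass of a shell between consecutive levels, and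
    \<open>G\<close> majorizes a truncated third moment.\<close>
  define p where "p j = F (j - 1) - F j" for j
  have p0: "p j \<ge> 0" for j unfolding p_def using F_mono[of "j - 1"] by (cases j) auto
  have G_Suc: "G (Suc n) = G n + a (Suc n) ^ 3 * p (Suc n)" for n
    by (simp add: G_def p_def)
  have G_mono: "G n \<le> G (Suc n)" for n
    using p0[of "Suc n"] a_pos[of "Suc n"] by (simp add: G_Suc)
  have G0: "G 0 = 0" by (simp add: G_def)
  have Gnn: "0 \<le> G n" for n
    by (induction n) (use G0 G_mono order_trans in auto)
  have G_mono': "m \<le> n \<Longrightarrow> G m \<le> G n" for m n using lift_Suc_mono_le[of G] G_mono by auto
  define S where "S = (\<Sum>n. \<tau> (Suc n) * (real (Suc n) * F (Suc n)))"
  \<comment> \<open>The right side has only \<open>m - 1\<close> terms because \<open>B m\<close>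
    stops at \<open>k = m - 1\<close>.\<close>
  have pB: "(\<Sum>j=1..m. p j * B j) + F m * B m = (\<Sum>n<m - 1. \<tau> (Suc n) * (real (Suc n) * F (Suc n)))" for m
  proof (induction m)
    case (Suc m)
    show ?case
    proof (cases m)
      case (Suc k)
      with Suc.IH show ?thesis by (simp add: p_def B_def algebra_simps)
    qed (simp add: p_def B_def)
  qed (auto simp: B_def)
  have pB_le: "(\<Sum>j=1..m. p j * B j) \<le> S" for m
  proof -
    have "(\<Sum>n<m - 1. \<tau> (Suc n) * (real (Suc n) * F (Suc n))) \<le> S"
      unfolding S_def using F_sum tau_nonneg F_nonneg
      by (intro sum_le_suminf) (auto simp: tau_summable_def)
    moreover have "0 \<le> F m * B m" using F_nonneg B_nonneg by auto
    ultimately show ?thesis using pB[of m] by linarith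
  qed
  have "\<exists>K n0. n0 \<ge> 1 \<and> (\<forall>k\<ge>n0. (real k * G k / a k ^ 3) powr (\<theta> - 1) \<le> K)"
  proof (cases "\<theta> > 1")
    case False
    then have "\<theta> - 1 = 0" using theta by simp
    \<comment> \<open>Only an inequality: \<open>x powr 0\<close> is 1 for nonzero \<open>x\<close>,
      but \<open>0 powr 0 = 0\<close>.\<close>
    then have "(real k * G k / a k ^ 3) powr (\<theta> - 1) \<le> 1" for k
      by (simp only: powr_zero_eq_one) simp
    then show ?thesis by blast
  next
    case True
    then obtain c n0 where c: "c > 0" "n0 \<ge> 1"
      "\<And>n k. n0 \<le> n \<Longrightarrow> n \<le> k \<Longrightarrow> c * real k * a n ^ 3 \<le> B n * a k ^ 3"
      using extra_bound by metis
    \<comment> \<open>The bound \<open>c(3)\<close> starts at \<open>n0\<close>, so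
      \<open>G k\<close> is split there. The first term comes from \<open>G n0\<close>, using
      \<open>c(3)\<close> at \<open>n0\<close> to control \<open>k / a k ^ 3\<close>; the second
      comes from the shells beyond \<open>n0\<close>.\<close>
    define K where "K = G n0 * B n0 / (c * a n0 ^ 3) + S / c"
    have "real k * G k / a k ^ 3 \<le> K" if k: "k \<ge> n0" for k
    proof -
      have ak: "a k > 0" "a n0 > 0" "k > 0" using a_pos c k by auto
      have split: "G k = G n0 + (\<Sum>j\<in>{Suc n0..k}. a j ^ 3 * p j)"
        using k by (induction k rule: dec_induct) (auto simp: G_Suc)
      have "(\<Sum>j\<in>{Suc n0..k}. a j ^ 3 * p j) \<le> (\<Sum>j\<in>{Suc n0..k}. (p j * B j) * (a k ^ 3 / (c * real k)))"
      proof (intro sum_mono)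
        fix j assume "j \<in> {Suc n0..k}"
        then have "c * real k * a j ^ 3 \<le> B j * a k ^ 3" using c(3)[of j k] by auto
        then have "a j ^ 3 \<le> B j * (a k ^ 3 / (c * real k))" using c ak by (simp add: field_simps)
        then show "a j ^ 3 * p j \<le> (p j * B j) * (a k ^ 3 / (c * real k))"
          using mult_left_mono[of "a j ^ 3" "B j * (a k ^ 3 / (c * real k))" "p j"] p0[of j]
          by (simp only: mult_ac)
      qed
      also have "\<dots> = (\<Sum>j\<in>{Suc n0..k}. p j * B j) * (a k ^ 3 / (c * real k))"
        by (rule sum_distrib_right [symmetric])
      also have "\<dots> \<le> S * (a k ^ 3 / (c * real k))"
      proof (intro mult_right_mono)
        have "(\<Sum>j\<in>{Suc n0..k}. p j * B j) \<le> (\<Sum>j=1..k. p j * B j)"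
          by (intro sum_mono2) (use p0 B_nonneg in auto)
        then show "(\<Sum>j\<in>{Suc n0..k}. p j * B j) \<le> S" using pB_le[of k] by linarith
      qed (use c ak in auto)
      finally have "G k \<le> G n0 + S * (a k ^ 3 / (c * real k))" using split by simp
      then have "real k * G k / a k ^ 3 \<le> real k * (G n0 + S * (a k ^ 3 / (c * real k))) / a k ^ 3"
        using ak by (intro divide_right_mono mult_left_mono) auto
      also have "\<dots> = G n0 * (real k / a k ^ 3) + S / c" using ak c by (simp add: field_simps)
      also have "real k / a k ^ 3 \<le> B n0 / (c * a n0 ^ 3)"
        using c(3)[of n0 k] k ak c by (simp add: field_simps)
      finally show ?thesis using Gnn[of n0] unfolding K_def by (simp add: mult_left_mono)
    qed
    then have "(real k * G k / a k ^ 3) powr (\<theta> - 1) \<le> K powr (\<theta> - 1)" if "k \<ge> n0" for k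
      using that True Gnn a_pos[of k] c by (intro powr_mono2) (auto intro!: divide_nonneg_pos)
    then show ?thesis using c by blast
  qed
  then obtain K n0 where K: "n0 \<ge> 1" "\<And>k. k \<ge> n0 \<Longrightarrow> (real k * G k / a k ^ 3) powr (\<theta> - 1) \<le> K"
    by blast
  \<comment> \<open>Beyond \<open>n1\<close> both the bound \<open>K\<close> and the tail estimate
    from \<open>key\<close> apply; the finitely many earlier terms go into \<open>Z\<close>.\<close>
  define n1 where "n1 = max n0 (nat \<lceil>N\<rceil>)"
  have n1: "n1 \<ge> n0" "n1 \<ge> 1" "real n \<ge> N" if "n \<ge> n1" for n using that K unfolding n1_def by linarith+
  define R where "R n = (\<Sum>j. w (n + j))" for n
  have R_Suc: "R n = w n + R (Suc n)" for n
    unfolding R_def using w_summable suminf_split_head[of "\<lambda>j. w (n + j)"] summable_iff_shift[of w n]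
    by (simp add: add.commute)
  have Rnn: "0 \<le> R n" for n
    unfolding R_def using w_summable summable_iff_shift[of w n] w_nonneg
    by (intro suminf_nonneg) (auto simp: add.commute)
  define g where "g n = G n powr \<theta> - G (n - 1) powr \<theta>" for n
  have g0: "g n \<ge> 0" for n unfolding g_def using Gnn theta G_mono'[of "n-1" n] by (auto intro!: powr_mono2)
  have abel: "(\<Sum>n=1..m. w n * G n powr \<theta>) + R (Suc m) * G m powr \<theta> = (\<Sum>n=1..m. R n * g n)" for m
  proof (induction m)
    case (Suc m)
    then show ?case using R_Suc[of "Suc m"] by (simp add: g_def algebra_simps)
  qed (use G0 in auto)
  have gR: "R j * g j \<le> \<theta> * C * K * (p j * B j)" if j: "j \<ge> n1" for j
  proof -
    have j1: "j \<ge> 1" "real j \<ge> N" "j \<ge> n0" using n1[of j] j by auto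
    have aj: "a j > 0" using a_pos j1 by auto
    have g: "g j \<le> \<theta> * G j powr (\<theta> - 1) * (a j ^ 3 * p j)"
      unfolding g_def using powr_diff_le[of "G (j-1)" "G j" \<theta>] Gnn G_mono'[of "j-1" j] theta
        G_Suc[of "j - 1"] j1 by simp
    have "R j * g j \<le> (C * real j powr (\<theta> - 1) * B j / a j powr (3 * \<theta>)) * (\<theta> * G j powr (\<theta> - 1) * (a j ^ 3 * p j))"
      using w_tail_le[OF j1(2)] g g0 Rnn B_nonneg[of j] Cpos unfolding R_def
      by (intro mult_mono) (auto simp: w_nonneg intro!: divide_nonneg_nonneg mult_nonneg_nonneg)
    also have "\<dots> = \<theta> * C * (real j powr (\<theta> - 1) * G j powr (\<theta> - 1) * a j ^ 3 / a j powr (3 * \<theta>)) * (p j * B j)"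
      by (simp add: mult_ac)
    also have "real j powr (\<theta> - 1) * G j powr (\<theta> - 1) * a j ^ 3 / a j powr (3 * \<theta>) = (real j * G j / a j ^ 3) powr (\<theta> - 1)"
    proof -
      have "(a j ^ 3) powr (\<theta> - 1) = a j powr (3 * \<theta>) / a j ^ 3"
        using aj by (simp add: powr_diff powr_powr flip: powr_numeral)
      then show ?thesis using aj Gnn by (simp add: powr_divide powr_mult)
    qed
    also have "\<theta> * C * (real j * G j / a j ^ 3) powr (\<theta> - 1) * (p j * B j) \<le> \<theta> * C * K * (p j * B j)"
      using K(2)[of j] j1 theta Cpos p0 B_nonneg by (intro mult_right_mono mult_left_mono) auto
    finally show ?thesis .
  qed
  have K0: "K \<ge> 0" using K(2)[of n0] powr_ge_zero order_trans by blast
  define Z where "Z = (\<Sum>n=1..n1. R n * g n) + \<theta> * C * K * S"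
  have bound: "(\<Sum>n=1..m. w n * G n powr \<theta>) \<le> Z" for m
  proof -
    have "(\<Sum>n=1..m. w n * G n powr \<theta>) \<le> (\<Sum>n=1..m. R n * g n)"
      using abel[of m] mult_nonneg_nonneg[OF Rnn[of "Suc m"] powr_ge_zero[of "G m" \<theta>]] by linarith
    also have "\<dots> \<le> (\<Sum>n=1..m. (if n \<le> n1 then R n * g n else 0) + \<theta> * C * K * (p n * B n))"
    proof (intro sum_mono)
      fix n assume "n \<in> {1..m}"
      have "0 \<le> \<theta> * C * K * (p n * B n)" using theta Cpos K0 p0 B_nonneg by auto
      then show "R n * g n \<le> (if n \<le> n1 then R n * g n else 0) + \<theta> * C * K * (p n * B n)"
        using gR[of n] by auto
    qed
    also have "\<dots> = (\<Sum>n=1..m. (if n \<le> n1 then R n * g n else 0)) + \<theta> * C * K * (\<Sum>n=1..m. p n * B n)"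
      by (simp add: sum.distrib sum_distrib_left)
    also have "(\<Sum>n=1..m. (if n \<le> n1 then R n * g n else 0)) = (\<Sum>n\<in>{1..m} \<inter> {..n1}. R n * g n)"
      by (subst sum.inter_restrict) (auto intro!: sum.cong)
    also have "\<dots> \<le> (\<Sum>n=1..n1. R n * g n)"
      by (intro sum_mono2) (use Rnn g0 in auto)
    also have "\<theta> * C * K * (\<Sum>n=1..m. p n * B n) \<le> \<theta> * C * K * S"
      using pB_le[of m] theta Cpos K0 by (intro mult_left_mono) auto
    finally show ?thesis unfolding Z_def by simp
  qed
  have "summable (\<lambda>n. w (Suc n) * G (Suc n) powr \<theta>)"
  proof (rule summableI_nonneg_bounded)
    fix m
    show "(\<Sum>n<m. w (Suc n) * G (Suc n) powr \<theta>) \<le> Z"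
      using bound[of m] by (simp only: One_nat_def sum.shift_bounds_cl_Suc_ivl atLeast0AtMost lessThan_Suc_atMost sum.atLeast1_atMost_eq)
  qed (use w_nonneg in auto)
  moreover have "w (Suc n) * G (Suc n) powr \<theta> = \<tau> (Suc n) * (real (Suc n) * G (Suc n) / a (Suc n) ^ 3) powr \<theta>" for n
  proof -
    have "(a (Suc n) ^ 3) powr \<theta> = a (Suc n) powr (3 * \<theta>)"
      using a_pos[of "Suc n"] by (simp add: powr_powr flip: powr_numeral)
    then show ?thesis using a_pos[of "Suc n"] Gnn by (simp add: powr_divide powr_mult w_def)
  qed
  ultimately show ?thesis unfolding tau_summable_def by simp
qed

end

subsection \<open>Truncated moments\<close>

definition tail_prob :: "real measure \<Rightarrow> real \<Rightarrow> real" where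
  "tail_prob D t = measure D {y. t \<le> \<bar>y\<bar>}"

text \<open>The strict inequality makes the region that is kept the exact complement of the event
  counted by \<open>tail_prob\<close> at the same level.\<close>

definition trunc :: "real \<Rightarrow> real \<Rightarrow> real" where
  "trunc b y = (if \<bar>y\<bar> < b then y else 0)"

definition trunc_moment :: "nat \<Rightarrow> real measure \<Rightarrow> real \<Rightarrow> real" where
  "trunc_moment k D b = (\<integral>y. \<bar>trunc b y\<bar> ^ k \<partial>D)"

lemma trunc_measurable [measurable]: "trunc b \<in> borel_measurable borel"
  unfolding trunc_def[abs_def] by measurable

lemma abs_trunc_le: "0 < b \<Longrightarrow> \<bar>trunc b y\<bar> \<le> b"
  by (auto simp: trunc_def)

lemma exp_neg_div_nonneg: "0 \<le> exp_neg_div t s"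
  by (simp add: exp_neg_div_def)

lemma trunc_moment_nonneg: "0 \<le> trunc_moment k D b"
  unfolding trunc_moment_def by (rule Bochner_Integration.integral_nonneg) simp

text \<open>Large values are capped rather than cut off. The integrand is then nondecreasing in |y|,
  as the median inequality requires, and subadditive up to a factor 2.\<close>

definition quad :: "real measure \<Rightarrow> real \<Rightarrow> real" where
  "quad D t = (\<integral>y. min ((y / t)\<^sup>2) 1 \<partial>D)"

lemma quad_nonneg: "0 \<le> quad D t"
  unfolding quad_def by (rule Bochner_Integration.integral_nonneg) simp

locale real_law = prob_space D for D :: "real measure" +
  assumes sets_law [measurable_cong, simp]: "sets D = sets borel"
begin

lemma space_law [simp]: "space D = UNIV"
  using sets_eq_imp_space_eq[OF sets_law] by simp

lemma prob_UNIV [simp]: "prob UNIV = 1"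
  using prob_space by simp

lemma law_measurable: "f \<in> borel_measurable borel \<Longrightarrow> f \<in> borel_measurable D" for f :: "real \<Rightarrow> real"
  by (simp add: measurable_cong_sets[OF sets_law refl])

lemma integrable_law:
  fixes f :: "real \<Rightarrow> real"
  assumes "f \<in> borel_measurable borel" "\<And>y. \<bar>f y\<bar> \<le> b"
  shows "integrable D f"
  by (rule integrable_const_bound[where B = b]) (use assms(2) law_measurable[OF assms(1)] in auto)

lemma quad_integrable: "integrable D (\<lambda>y. min ((y / t)\<^sup>2) 1)"
  by (rule integrable_law[where b = 1]) auto

lemma trunc_pow_integrable: "0 < b \<Longrightarrow> integrable D (\<lambda>y. \<bar>trunc b y\<bar> ^ k)"
  by (rule integrable_law[where b = "b ^ k"]) (auto simp: power_abs intro!: power_mono abs_trunc_le)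

lemma trunc_integrable: "0 < b \<Longrightarrow> integrable D (trunc b)"
  by (rule integrable_law[OF _ abs_trunc_le]) auto

lemma exp_trunc_integrable: "0 < b \<Longrightarrow> integrable D (\<lambda>y. exp (h * trunc b y))"
proof (rule integrable_law[where b = "exp (\<bar>h\<bar> * b)"])
  fix y assume "0 < b"
  then show "\<bar>exp (h * trunc b y)\<bar> \<le> exp (\<bar>h\<bar> * b)"
    using mult_left_mono[OF abs_trunc_le[of b y], of "\<bar>h\<bar>"] abs_ge_self[of "h * trunc b y"]
    by (simp add: abs_mult)
qed measurable

lemma tail_prob_alt: "tail_prob D t = (\<integral>y. indicator {y. t \<le> \<bar>y\<bar>} y \<partial>D)"
  unfolding tail_prob_def by simp

lemma tail_sets [measurable, simp]: "{y::real. t \<le> \<bar>y\<bar>} \<in> sets borel"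
  by measurable

lemma tail_integrable: "integrable D (\<lambda>y. indicator {y. t \<le> \<bar>y\<bar>} y :: real)"
  by (rule integrable_law[where b = 1]) auto

lemma tail_prob_bounds: "0 \<le> tail_prob D t" "tail_prob D t \<le> 1"
  by (auto simp: tail_prob_def)

lemma tail_prob_antimono: "s \<le> t \<Longrightarrow> tail_prob D t \<le> tail_prob D s"
  unfolding tail_prob_def by (rule finite_measure_mono) auto

text \<open>Where the left integrand is nonzero, \<open>(y / t)\<^sup>2\<close> is at most 1 or at
  most \<open>(b / t)\<^sup>2\<close>. Together with the next lemma this makes the two second-moment
  functionals interchangeable for any ratio \<open>b / t\<close>, up to a constant and a tail
  probability.\<close>

lemma trunc_moment_le_quad:
  assumes "0 < t" "0 < b"
  shows "trunc_moment 2 D b / t\<^sup>2 \<le> max 1 ((b / t)\<^sup>2) * quad D t"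
proof -
  have "trunc_moment 2 D b / t\<^sup>2 = (\<integral>y. \<bar>trunc b y\<bar>\<^sup>2 / t\<^sup>2 \<partial>D)"
    by (simp add: trunc_moment_def)
  also have "\<dots> \<le> (\<integral>y. max 1 ((b / t)\<^sup>2) * min ((y / t)\<^sup>2) 1 \<partial>D)"
  proof (rule integral_mono)
    show "integrable D (\<lambda>y. \<bar>trunc b y\<bar>\<^sup>2 / t\<^sup>2)"
      using trunc_pow_integrable[OF assms(2), of 2] by simp
    fix y
    show "\<bar>trunc b y\<bar>\<^sup>2 / t\<^sup>2 \<le> max 1 ((b / t)\<^sup>2) * min ((y / t)\<^sup>2) 1"
    proof (cases "\<bar>y\<bar> < b")
      case True
      show ?thesis
      proof (cases "(y / t)\<^sup>2 \<le> 1")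
        case le: True
        then have "1 * (y / t)\<^sup>2 \<le> max 1 ((b / t)\<^sup>2) * (y / t)\<^sup>2" by (intro mult_right_mono) auto
        then show ?thesis using True le by (simp add: trunc_def power_divide min_def)
      next
        case gt: False
        have "\<bar>y\<bar>\<^sup>2 \<le> b\<^sup>2" using True by (intro power_mono) auto
        then have "(y / t)\<^sup>2 \<le> (b / t)\<^sup>2" by (simp add: power_divide divide_right_mono)
        then show ?thesis using True gt by (simp add: trunc_def power_divide min_def)
      qed
    qed (simp add: trunc_def)
  qed (use quad_integrable in simp)
  also have "\<dots> = max 1 ((b / t)\<^sup>2) * quad D t" by (simp add: quad_def)
  finally show ?thesis .
qed

lemma quad_le_trunc_moment:
  assumes "0 < t" "0 < b"
  shows "quad D t \<le> trunc_moment 2 D b / t\<^sup>2 + tail_prob D b"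
proof -
  have "quad D t \<le> (\<integral>y. \<bar>trunc b y\<bar>\<^sup>2 / t\<^sup>2 + indicator {y. b \<le> \<bar>y\<bar>} y \<partial>D)"
    unfolding quad_def
  proof (rule integral_mono[OF quad_integrable])
    show "integrable D (\<lambda>y. \<bar>trunc b y\<bar>\<^sup>2 / t\<^sup>2 + indicator {y. b \<le> \<bar>y\<bar>} y)"
      using trunc_pow_integrable[OF assms(2), of 2] tail_integrable[of b] by simp
    fix y show "min ((y / t)\<^sup>2) 1 \<le> \<bar>trunc b y\<bar>\<^sup>2 / t\<^sup>2 + indicator {y. b \<le> \<bar>y\<bar>} y"
      by (auto simp: trunc_def power_divide indicator_def)
  qed
  also have "\<dots> = trunc_moment 2 D b / t\<^sup>2 + tail_prob D b"
    using trunc_pow_integrable[OF assms(2), of 2] tail_integrable[of b]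
    by (simp add: trunc_moment_def tail_prob_alt)
  finally show ?thesis .
qed

text \<open>For a law not concentrated at 0 this gives a lower bound of order
  \<open>1 / t\<^sup>2\<close>, enough to absorb the contribution of a fixed median.\<close>

lemma quad_ge_tail_prob:
  assumes "0 < s" "s \<le> t"
  shows "(s / t)\<^sup>2 * tail_prob D s \<le> quad D t"
proof -
  have "(s / t)\<^sup>2 * tail_prob D s = (\<integral>y. (s / t)\<^sup>2 * indicator {y. s \<le> \<bar>y\<bar>} y \<partial>D)"
    by (simp add: tail_prob_alt)
  also have "\<dots> \<le> quad D t"
    unfolding quad_def
  proof (rule integral_mono[OF _ quad_integrable])
    fix y
    have "(s / t)\<^sup>2 \<le> 1\<^sup>2" using assms by (intro power_mono) auto
    moreover have "(s / t)\<^sup>2 \<le> (y / t)\<^sup>2" if "s \<le> \<bar>y\<bar>"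
    proof -
      have "s\<^sup>2 \<le> \<bar>y\<bar>\<^sup>2" using that assms by (intro power_mono) auto
      then show ?thesis by (simp add: power_divide divide_right_mono)
    qed
    ultimately show "(s / t)\<^sup>2 * indicator {y. s \<le> \<bar>y\<bar>} y \<le> min ((y / t)\<^sup>2) 1"
      by (auto simp: indicator_def)
  qed (use tail_integrable in auto)
  finally show ?thesis .
qed

text \<open>On the shell between the two levels the cube is at most \<open>t ^ 3\<close>. Iterating
  along \<open>a\<close>, with the next lemma as base case, bounds the truncated third moment by the
  sum \<open>G\<close> of \<open>tau_summable_third_moment\<close>.\<close>

lemma trunc_moment_3_diff:
  assumes "0 < s" "s \<le> t"
  shows "trunc_moment 3 D t \<le> trunc_moment 3 D s + t ^ 3 * (tail_prob D s - tail_prob D t)"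
proof -
  have "trunc_moment 3 D t \<le> (\<integral>y. \<bar>trunc s y\<bar> ^ 3 + t ^ 3 * (indicator {y. s \<le> \<bar>y\<bar>} y - indicator {y. t \<le> \<bar>y\<bar>} y) \<partial>D)"
    unfolding trunc_moment_def
  proof (rule integral_mono)
    show "integrable D (\<lambda>y. \<bar>trunc s y\<bar> ^ 3 + t ^ 3 * (indicator {y. s \<le> \<bar>y\<bar>} y - indicator {y. t \<le> \<bar>y\<bar>} y))"
      using assms trunc_pow_integrable[of s 3] tail_integrable by auto
    fix y show "\<bar>trunc t y\<bar> ^ 3 \<le> \<bar>trunc s y\<bar> ^ 3 + t ^ 3 * (indicator {y. s \<le> \<bar>y\<bar>} y - indicator {y. t \<le> \<bar>y\<bar>} y)"
      using assms power_mono[of "\<bar>y\<bar>" t 3] by (auto simp: trunc_def indicator_def)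
  qed (use assms trunc_pow_integrable[of t 3] in auto)
  also have "\<dots> = trunc_moment 3 D s + t ^ 3 * (tail_prob D s - tail_prob D t)"
    using assms trunc_pow_integrable[of s 3] tail_integrable by (simp add: tail_prob_alt trunc_moment_def)
  finally show ?thesis .
qed

lemma trunc_moment_3_le:
  assumes "0 < t"
  shows "trunc_moment 3 D t \<le> t ^ 3 * (1 - tail_prob D t)"
proof -
  have "trunc_moment 3 D t \<le> (\<integral>y. t ^ 3 * (1 - indicator {y. t \<le> \<bar>y\<bar>} y) \<partial>D)"
    unfolding trunc_moment_def
  proof (rule integral_mono)
    show "integrable D (\<lambda>y. t ^ 3 * (1 - indicator {y. t \<le> \<bar>y\<bar>} y))"
      by (intro integrable_mult_right Bochner_Integration.integrable_diff tail_integrable) simp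
    fix y show "\<bar>trunc t y\<bar> ^ 3 \<le> t ^ 3 * (1 - indicator {y. t \<le> \<bar>y\<bar>} y)"
      using assms power_mono[of "\<bar>y\<bar>" t 3] by (auto simp: trunc_def indicator_def)
  qed (use assms trunc_pow_integrable[of t 3] in auto)
  also have "\<dots> = t ^ 3 * (1 - tail_prob D t)"
    using tail_integrable prob_space by (simp add: tail_prob_alt)
  finally show ?thesis .
qed

lemma trunc_moment_mono:
  assumes "0 < s" "s \<le> t"
  shows "trunc_moment k D s \<le> trunc_moment k D t"
  unfolding trunc_moment_def
proof (rule integral_mono)
  fix y show "\<bar>trunc s y\<bar> ^ k \<le> \<bar>trunc t y\<bar> ^ k"
    using assms by (intro power_mono) (auto simp: trunc_def)
qed (use assms trunc_pow_integrable in auto)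

end

subsection \<open>Sums of symmetric variables\<close>

lemma exp_le_third_order:
  fixes u :: real
  shows "exp u \<le> 1 + u + u\<^sup>2 / 2 + \<bar>u\<bar> ^ 3 * exp \<bar>u\<bar> / 6"
proof -
  obtain t where t: "\<bar>t\<bar> \<le> \<bar>u\<bar>" "exp u = (\<Sum>m<3. u ^ m / fact m) + exp t / fact 3 * u ^ 3"
    using Maclaurin_exp_le[of u 3] by blast
  have "exp t * u ^ 3 \<le> \<bar>exp t * u ^ 3\<bar>" by simp
  also have "\<dots> = exp t * \<bar>u\<bar> ^ 3" by (simp add: abs_mult power_abs)
  also have "\<dots> \<le> exp \<bar>u\<bar> * \<bar>u\<bar> ^ 3" using t by (intro mult_right_mono) auto
  finally show ?thesis using t(2) by (simp add: numeral_3_eq_3 fact_reduce power2_eq_square mult_ac)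
qed

lemma exp_le_quadratic:
  fixes u :: real
  assumes "\<bar>u\<bar> \<le> 1"
  shows "exp u \<le> 1 + u + u\<^sup>2"
proof -
  have "exp \<bar>u\<bar> \<le> 3" using assms by (intro order_trans[OF _ exp_le]) simp
  then have "\<bar>u\<bar> ^ 3 * exp \<bar>u\<bar> \<le> \<bar>u\<bar> ^ 2 * 1 * 3"
    using assms by (intro mult_mono) (auto simp: power3_eq_cube power2_eq_square mult_left_le)
  then show ?thesis using exp_le_third_order[of u] by simp
qed

text \<open>Stopping at an odd order leaves a remainder of order 4, which is nonnegative for either
  sign of \<open>u\<close>; the cubic term later integrates to zero by symmetry.\<close>

lemma exp_ge_third_order:
  fixes u :: real
  shows "1 + u + u\<^sup>2 / 2 + u ^ 3 / 6 \<le> exp u"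
proof -
  obtain t where t: "exp u = (\<Sum>m<4. u ^ m / fact m) + exp t / fact 4 * u ^ 4"
    using Maclaurin_exp_le[of u 4] by blast
  have "{..<4::nat} = {0,1,2,3}" by auto
  moreover have "0 \<le> exp t / fact 4 * u ^ 4" by simp
  ultimately show ?thesis using t by (simp add: fact_reduce numeral_3_eq_3)
qed

text \<open>The usual Cauchy-Schwarz step is replaced by a pointwise completed square, which leaves
  only expectations of bounded multiples of \<open>Z\<^sup>2\<close> and of an indicator.\<close>

lemma (in prob_space) paley_zygmund:
  fixes Z :: "'a \<Rightarrow> real"
  assumes Z: "integrable M Z" "integrable M (\<lambda>x. (Z x)\<^sup>2)" "\<And>x. 0 \<le> Z x" "expectation Z > 0"
  shows "(expectation Z)\<^sup>2 / (4 * expectation (\<lambda>x. (Z x)\<^sup>2)) \<le> prob {x \<in> space M. expectation Z / 2 \<le> Z x}"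
proof -
  define E V where "E = expectation Z" and "V = expectation (\<lambda>x. (Z x)\<^sup>2)"
  define A where "A = {x \<in> space M. E / 2 \<le> Z x}"
  have [measurable]: "A \<in> events" "Z \<in> borel_measurable M" unfolding A_def using Z by measurable
  have E: "E > 0" using Z by (simp add: E_def)
  have "V = expectation (\<lambda>x. (Z x - E)\<^sup>2) + E\<^sup>2"
    using variance_eq[OF Z(1,2)] by (simp add: V_def E_def)
  moreover have "0 \<le> expectation (\<lambda>x. (Z x - E)\<^sup>2)" by (rule Bochner_Integration.integral_nonneg) simp
  ultimately have V: "V > 0" using E by (simp add: add_nonneg_pos)
  \<comment> \<open>With this weight the quadratic term contributes \<open>E / 4\<close> and the
    indicator term \<open>prob A * V / E\<close>.\<close>
  define l where "l = E / (4 * V)"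
  have l: "l > 0" using E V by (simp add: l_def)
  have pt: "Z x \<le> E / 2 + l * (Z x)\<^sup>2 + indicator A x / (4 * l)" if "x \<in> space M" for x
  proof (cases "x \<in> A")
    case True
    have "0 \<le> (2 * l * Z x - 1)\<^sup>2" by simp
    then have "4 * l * Z x \<le> 4 * l * (l * (Z x)\<^sup>2) + 1"
      by (simp add: power2_eq_square algebra_simps)
    moreover have "0 < E * (l * 2)" using E l by simp
    ultimately show ?thesis using l True by (simp add: field_simps)
  next
    case False
    then have "Z x < E / 2" using that by (auto simp: A_def)
    moreover have "0 \<le> l * (Z x)\<^sup>2" using l by simp
    ultimately show ?thesis using False by simp
  qed
  have "E \<le> expectation (\<lambda>x. E / 2 + l * (Z x)\<^sup>2 + indicator A x / (4 * l))"
    unfolding E_def using Z(1) pt[unfolded E_def]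
    by (intro integral_mono) (auto intro!: Bochner_Integration.integrable_add Z(2) integrable_real_indicator
        simp: emeasure_eq_measure)
  also have "\<dots> = E / 2 + l * V + prob A / (4 * l)"
    using Z by (subst Bochner_Integration.integral_add)+
      (auto simp: V_def prob_space emeasure_eq_measure intro!: integrable_real_indicator)
  finally have "E / 2 \<le> E / 4 + prob A * V / E"
    using V E by (simp add: l_def field_simps)
  then have "E\<^sup>2 / (4 * V) \<le> prob A" using E V by (simp add: field_simps power2_eq_square)
  then show ?thesis unfolding A_def E_def V_def .
qed

text \<open>As \<open>S\<close> is invariant under negation, the map sends \<open>S\<close> and its
  complement to themselves: it is the identity on the first and the law-preserving reflection on the
  second.\<close>

lemma distr_symmetric_flip:
  fixes D :: "real measure"
  assumes D: "sets D = sets borel" "distr D borel uminus = D" and S: "S \<in> sets borel"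
    and sym: "\<And>y. - y \<in> S \<longleftrightarrow> y \<in> S"
  shows "distr D borel (\<lambda>y. if y \<in> S then y else - y) = D"
proof (rule measure_eqI)
  note [measurable] = S D(1)
  have sp: "space D = UNIV" using sets_eq_imp_space_eq[OF D(1)] by simp
  have mb: "f \<in> measurable D borel" if "f \<in> borel_measurable borel" for f :: "real \<Rightarrow> real"
    using that measurable_cong_sets[OF D(1) refl] by blast
  show "sets (distr D borel (\<lambda>y. if y \<in> S then y else - y)) = sets D" using D by simp
  fix A assume "A \<in> sets (distr D borel (\<lambda>y. if y \<in> S then y else - y))"
  then have A[measurable]: "A \<in> sets borel" by simp
  have "emeasure (distr D borel (\<lambda>y. if y \<in> S then y else - y)) A = emeasure D {y. (if y \<in> S then y else - y) \<in> A}"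
    by (subst emeasure_distr) (auto intro!: mb arg_cong[where f="emeasure D"] simp: sp)
  also have "{y. (if y \<in> S then y else - y) \<in> A} = (A \<inter> S) \<union> (uminus -` (A - S) \<inter> space D)"
    using sym by (auto simp: sp)
  also have "emeasure D \<dots> = emeasure D (A \<inter> S) + emeasure D (uminus -` (A - S) \<inter> space D)"
  proof (rule plus_emeasure [symmetric])
    show "uminus -` (A - S) \<inter> space D \<in> sets D" by (rule measurable_sets[OF mb]) (use S A in auto)
  qed (use S A D sym in auto)
  also have "emeasure D (uminus -` (A - S) \<inter> space D) = emeasure (distr D borel uminus) (A - S)"
    by (subst emeasure_distr) (auto intro!: mb)
  also have "\<dots> = emeasure D (A - S)" using D by simp
  also have "emeasure D (A \<inter> S) + emeasure D (A - S) = emeasure D ((A \<inter> S) \<union> (A - S))"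
    by (rule plus_emeasure) (use S A D in auto)
  finally show "emeasure (distr D borel (\<lambda>y. if y \<in> S then y else - y)) A = emeasure D A"
    by (simp add: Int_Diff_Un)
qed

section \<open>Independent symmetric variables: sign flips and the maximum\<close>

locale iid_symmetric = prob_space M for M :: "'a measure" +
  fixes Y :: "nat \<Rightarrow> 'a \<Rightarrow> real" and I :: "nat set" and D :: "real measure"
  assumes finite_I: "finite I" and I_nonempty: "I \<noteq> {}"
    and indep: "indep_vars (\<lambda>_. borel) Y I"
    and law: "\<And>i. i \<in> I \<Longrightarrow> distr M borel (Y i) = D"
    and symmetric: "distr D borel uminus = D"
begin

lemma rv_Y [measurable]: "i \<in> I \<Longrightarrow> random_variable borel (Y i)"
  using indep by (auto simp: indep_vars_def)

sublocale D: real_law D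
proof (intro real_law.intro real_law_axioms.intro)
  obtain i where i: "i \<in> I" using I_nonempty by auto
  show "prob_space D" using law[OF i] prob_space_distr[OF rv_Y[OF i]] by simp
  show "sets D = sets borel" using law[OF i] by (metis sets_distr)
qed

lemma prob_Y: "i \<in> I \<Longrightarrow> S \<in> sets borel \<Longrightarrow> prob {\<omega> \<in> space M. Y i \<omega> \<in> S} = D.prob S"
  using measure_distr[OF rv_Y, of i S] law[of i] by (simp add: vimage_def Int_def conj_commute)

text \<open>The joint law is the product of the marginals, so it is determined by the laws of the
  coordinates. The maps may depend on \<open>i\<close>: truncation uses one flip for all
  coordinates, Levy's inequality flips all but one.\<close>

lemma joint_law_invariant:
  assumes psi: "\<And>i. i \<in> I \<Longrightarrow> \<psi> i \<in> borel_measurable borel" "\<And>i. i \<in> I \<Longrightarrow> distr D borel (\<psi> i) = D"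
    and Q: "{f \<in> space (PiM I (\<lambda>_. borel)). Q f} \<in> sets (PiM I (\<lambda>_. borel))"
  shows "prob {\<omega> \<in> space M. Q (\<lambda>i\<in>I. \<psi> i (Y i \<omega>))} = prob {\<omega> \<in> space M. Q (\<lambda>i\<in>I. Y i \<omega>)}"
proof -
  let ?P = "PiM I (\<lambda>_. borel :: real measure)"
  have law': "distr M borel (\<lambda>x. \<psi> i (Y i x)) = D" if "i \<in> I" for i
    using distr_distr[OF psi(1)[OF that] rv_Y[OF that]] law[OF that] psi(2)[OF that]
    by (simp add: comp_def)
  have ind: "indep_vars (\<lambda>_. borel) (\<lambda>i x. \<psi> i (Y i x)) I"
    by (rule indep_vars_compose2[OF indep psi(1)])
  have rv: "random_variable borel (\<lambda>x. \<psi> i (Y i x))" if "i \<in> I" for i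
    using that by (intro measurable_compose[OF rv_Y psi(1)])
  have "distr M ?P (\<lambda>x. \<lambda>i\<in>I. \<psi> i (Y i x)) = PiM I (\<lambda>i. distr M borel (\<lambda>x. \<psi> i (Y i x)))"
    using ind by (subst (asm) indep_vars_iff_distr_eq_PiM'[OF I_nonempty rv]) auto
  also have "\<dots> = PiM I (\<lambda>i. distr M borel (Y i))"
    by (intro PiM_cong) (auto simp: law law')
  also have "\<dots> = distr M ?P (\<lambda>x. \<lambda>i\<in>I. Y i x)"
    using indep by (subst (asm) indep_vars_iff_distr_eq_PiM'[OF I_nonempty]) auto
  finally have eq: "distr M ?P (\<lambda>x. \<lambda>i\<in>I. \<psi> i (Y i x)) = distr M ?P (\<lambda>x. \<lambda>i\<in>I. Y i x)" .
  let ?B = "{f \<in> space ?P. Q f}"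
  have m1: "(\<lambda>x. \<lambda>i\<in>I. \<psi> i (Y i x)) \<in> measurable M ?P"
    using psi(1) by (intro measurable_restrict) (auto intro: measurable_compose[OF rv_Y])
  have m2: "(\<lambda>x. \<lambda>i\<in>I. Y i x) \<in> measurable M ?P" by (intro measurable_restrict) auto
  have "prob {\<omega> \<in> space M. Q (\<lambda>i\<in>I. \<psi> i (Y i \<omega>))} = measure (distr M ?P (\<lambda>x. \<lambda>i\<in>I. \<psi> i (Y i x))) ?B"
    by (subst measure_distr[OF m1 Q]) (auto intro!: arg_cong[where f=prob] simp: space_PiM)
  also have "\<dots> = measure (distr M ?P (\<lambda>x. \<lambda>i\<in>I. Y i x)) ?B" by (simp add: eq)
  also have "\<dots> = prob {\<omega> \<in> space M. Q (\<lambda>i\<in>I. Y i \<omega>)}"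
    by (subst measure_distr[OF m2 Q]) (auto intro!: arg_cong[where f=prob] simp: space_PiM)
  finally show ?thesis .
qed

text \<open>Flipping the signs of the summands outside \<open>S\<close> does not change the joint law, and the
  truncated sum is the average of the original and the flipped sum.\<close>

lemma prob_truncated_sum_le:
  assumes S: "S \<in> sets borel" and sym: "\<And>y. - y \<in> S \<longleftrightarrow> y \<in> S"
  shows "prob {\<omega> \<in> space M. x \<le> \<bar>\<Sum>i\<in>I. if Y i \<omega> \<in> S then Y i \<omega> else 0\<bar>}
    \<le> 2 * prob {\<omega> \<in> space M. x \<le> \<bar>\<Sum>i\<in>I. Y i \<omega>\<bar>}"
proof -
  note S[measurable]
  define \<psi> :: "real \<Rightarrow> real" where "\<psi> y = (if y \<in> S then y else - y)" for y
  have [measurable]: "\<psi> \<in> borel_measurable borel" unfolding \<psi>_def by measurable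
  let ?Q = "\<lambda>f. x \<le> \<bar>\<Sum>i\<in>I. f i\<bar>"
  have m: "{f \<in> space (PiM I (\<lambda>_. borel)). ?Q f} \<in> sets (PiM I (\<lambda>_. borel))" by measurable
  have eq: "prob {\<omega> \<in> space M. x \<le> \<bar>\<Sum>i\<in>I. \<psi> (Y i \<omega>)\<bar>} = prob {\<omega> \<in> space M. x \<le> \<bar>\<Sum>i\<in>I. Y i \<omega>\<bar>}"
    using joint_law_invariant[of "\<lambda>_. \<psi>", OF _ _ m] distr_symmetric_flip[OF D.sets_law symmetric S sym]
    by (simp add: \<psi>_def[abs_def] cong: sum.cong)
  have "prob {\<omega> \<in> space M. x \<le> \<bar>\<Sum>i\<in>I. if Y i \<omega> \<in> S then Y i \<omega> else 0\<bar>}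
    \<le> prob ({\<omega> \<in> space M. x \<le> \<bar>\<Sum>i\<in>I. Y i \<omega>\<bar>} \<union> {\<omega> \<in> space M. x \<le> \<bar>\<Sum>i\<in>I. \<psi> (Y i \<omega>)\<bar>})"
  proof (rule finite_measure_mono)
    show "{\<omega> \<in> space M. x \<le> \<bar>\<Sum>i\<in>I. if Y i \<omega> \<in> S then Y i \<omega> else 0\<bar>}
      \<subseteq> {\<omega> \<in> space M. x \<le> \<bar>\<Sum>i\<in>I. Y i \<omega>\<bar>} \<union> {\<omega> \<in> space M. x \<le> \<bar>\<Sum>i\<in>I. \<psi> (Y i \<omega>)\<bar>}"
    proof
      fix \<omega> assume *: "\<omega> \<in> {\<omega> \<in> space M. x \<le> \<bar>\<Sum>i\<in>I. if Y i \<omega> \<in> S then Y i \<omega> else 0\<bar>}"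
      have "2 * (\<Sum>i\<in>I. if Y i \<omega> \<in> S then Y i \<omega> else 0) = (\<Sum>i\<in>I. Y i \<omega>) + (\<Sum>i\<in>I. \<psi> (Y i \<omega>))"
        unfolding sum_distrib_left sum.distrib[symmetric] by (intro sum.cong) (auto simp: \<psi>_def)
      with * show "\<omega> \<in> {\<omega> \<in> space M. x \<le> \<bar>\<Sum>i\<in>I. Y i \<omega>\<bar>} \<union> {\<omega> \<in> space M. x \<le> \<bar>\<Sum>i\<in>I. \<psi> (Y i \<omega>)\<bar>}"
        by auto
    qed
  qed measurable
  also have "\<dots> \<le> prob {\<omega> \<in> space M. x \<le> \<bar>\<Sum>i\<in>I. Y i \<omega>\<bar>} + prob {\<omega> \<in> space M. x \<le> \<bar>\<Sum>i\<in>I. \<psi> (Y i \<omega>)\<bar>}"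
    by (rule measure_Un_le) measurable
  finally show ?thesis using eq by simp
qed

text \<open>Decompose by the first index \<open>i\<close> with \<open>t \<le> |Y i|\<close> and
  reflect all other summands. The original and the reflected sum add up to \<open>2 * Y i\<close>,
  so one of them reaches \<open>t\<close> in absolute value. The event \<open>first i\<close> sees
  absolute values only and hence survives the reflection.\<close>

lemma levy_max_inequality:
  "prob {\<omega> \<in> space M. \<exists>i\<in>I. t \<le> \<bar>Y i \<omega>\<bar>} \<le> 2 * prob {\<omega> \<in> space M. t \<le> \<bar>\<Sum>i\<in>I. Y i \<omega>\<bar>}"
proof -
  let ?P = "PiM I (\<lambda>_. borel :: real measure)"
  define first where "first i f \<longleftrightarrow> t \<le> \<bar>f i\<bar> \<and> (\<forall>j\<in>I. j < i \<longrightarrow> \<bar>f j\<bar> < t)" for i and f :: "nat \<Rightarrow> real"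
  have first_m[measurable]: "Measurable.pred ?P (first i)" if "i \<in> I" for i
    unfolding first_def using that finite_I by measurable
  have first_m'[measurable]: "Measurable.pred M (\<lambda>\<omega>. first i (\<lambda>i. Y i \<omega>))" if "i \<in> I" for i
    unfolding first_def using that finite_I by measurable
  let ?A = "\<lambda>i. {\<omega> \<in> space M. first i (\<lambda>i. Y i \<omega>)}"
  let ?B = "\<lambda>i. {\<omega> \<in> space M. first i (\<lambda>i. Y i \<omega>) \<and> t \<le> \<bar>\<Sum>i\<in>I. Y i \<omega>\<bar>}"
  have cong: "first i f = first i g" if "i \<in> I" "\<And>j. j \<in> I \<Longrightarrow> \<bar>f j\<bar> = \<bar>g j\<bar>" for i f g
    using that by (auto simp: first_def)
  have AB: "prob (?A i) \<le> 2 * prob (?B i)" if i: "i \<in> I" for i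
  proof -
    define \<psi> :: "nat \<Rightarrow> real \<Rightarrow> real" where "\<psi> j y = (if j = i then y else - y)" for j y
    let ?C = "{\<omega> \<in> space M. first i (\<lambda>i. Y i \<omega>) \<and> t \<le> \<bar>\<Sum>j\<in>I. \<psi> j (Y j \<omega>)\<bar>}"
    let ?Q = "\<lambda>f. first i f \<and> t \<le> \<bar>\<Sum>i\<in>I. f i\<bar>"
    have m: "{f \<in> space ?P. ?Q f} \<in> sets ?P" using i by measurable
    have psi_m[measurable]: "\<psi> j \<in> borel_measurable borel" for j
      unfolding \<psi>_def by measurable
    have psi_law: "distr D borel (\<psi> j) = D" for j
      using symmetric distr_id2[of borel D] by (cases "j = i") (simp_all add: \<psi>_def[abs_def])
    have "prob {\<omega> \<in> space M. ?Q (\<lambda>i\<in>I. \<psi> i (Y i \<omega>))} = prob {\<omega> \<in> space M. ?Q (\<lambda>i\<in>I. Y i \<omega>)}"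
      by (rule joint_law_invariant[OF psi_m psi_law m])
    moreover have "first i (\<lambda>i\<in>I. \<psi> i (Y i \<omega>)) = first i (\<lambda>i. Y i \<omega>)"
       "first i (\<lambda>i\<in>I. Y i \<omega>) = first i (\<lambda>i. Y i \<omega>)" for \<omega>
      by (intro cong i, simp add: \<psi>_def)+
    ultimately have eq: "prob ?C = prob (?B i)"
      by (simp cong: sum.cong)
    have "prob (?A i) \<le> prob (?B i \<union> ?C)"
    proof (rule finite_measure_mono)
      show "?A i \<subseteq> ?B i \<union> ?C"
      proof
        fix \<omega> assume *: "\<omega> \<in> ?A i"
        have "2 * Y i \<omega> = (\<Sum>j\<in>I. if j = i then 2 * Y i \<omega> else 0)" using i finite_I by simp
        also have "\<dots> = (\<Sum>j\<in>I. Y j \<omega>) + (\<Sum>j\<in>I. \<psi> j (Y j \<omega>))"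
          unfolding sum.distrib[symmetric] by (intro sum.cong) (auto simp: \<psi>_def)
        finally show "\<omega> \<in> ?B i \<union> ?C" using * by (auto simp: first_def)
      qed
    qed (use i in measurable)
    also have "\<dots> \<le> prob (?B i) + prob ?C"
      by (rule measure_Un_le) (use i in measurable)
    finally show ?thesis using eq by simp
  qed
  have un: "{\<omega> \<in> space M. \<exists>i\<in>I. t \<le> \<bar>Y i \<omega>\<bar>} = (\<Union>i\<in>I. ?A i)"
  proof (intro equalityI subsetI)
    fix \<omega> assume *: "\<omega> \<in> {\<omega> \<in> space M. \<exists>i\<in>I. t \<le> \<bar>Y i \<omega>\<bar>}"
    define i where "i = (LEAST i. i \<in> I \<and> t \<le> \<bar>Y i \<omega>\<bar>)"
    have "i \<in> I \<and> t \<le> \<bar>Y i \<omega>\<bar>" unfolding i_def by (rule LeastI_ex) (use * in auto)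
    moreover have "\<not> t \<le> \<bar>Y j \<omega>\<bar>" if "j \<in> I" "j < i" for j
      using that not_less_Least[of j] unfolding i_def by blast
    ultimately show "\<omega> \<in> (\<Union>i\<in>I. ?A i)" using * by (auto simp: first_def not_le)
  qed (auto simp: first_def)
  have disj: "first i f \<Longrightarrow> first j f \<Longrightarrow> i \<in> I \<Longrightarrow> j \<in> I \<Longrightarrow> i = j" for i j f
    unfolding first_def by (cases i j rule: linorder_cases) force+
  have "prob {\<omega> \<in> space M. \<exists>i\<in>I. t \<le> \<bar>Y i \<omega>\<bar>} = (\<Sum>i\<in>I. prob (?A i))"
    unfolding un using disj
    by (intro finite_measure_finite_Union finite_I) (auto simp: disjoint_family_on_def)
  also have "\<dots> \<le> (\<Sum>i\<in>I. 2 * prob (?B i))" by (intro sum_mono AB)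
  also have "\<dots> = 2 * (\<Sum>i\<in>I. prob (?B i))" by (simp add: sum_distrib_left)
  also have "(\<Sum>i\<in>I. prob (?B i)) = prob (\<Union>i\<in>I. ?B i)"
    using disj by (intro finite_measure_finite_Union[symmetric] finite_I) (auto simp: disjoint_family_on_def)
  also have "\<dots> \<le> prob {\<omega> \<in> space M. t \<le> \<bar>\<Sum>i\<in>I. Y i \<omega>\<bar>}"
    by (rule finite_measure_mono) auto
  finally show ?thesis by simp
qed

text \<open>By independence the maximum reaches \<open>t\<close> with probability
  \<open>1 - (1 - p) ^ n\<close>, which is at least half of \<open>min (n * p) 1\<close>; Levy's
  inequality contributes the other factor 2.\<close>

lemma min_tail_le:
  "min (real (card I) * D.prob {y. t \<le> \<bar>y\<bar>}) 1 \<le> 4 * prob {\<omega> \<in> space M. t \<le> \<bar>\<Sum>i\<in>I. Y i \<omega>\<bar>}"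
proof -
  define p where "p = D.prob {y. t \<le> \<bar>y\<bar>}"
  define n where "n = card I"
  have p: "0 \<le> p" "p \<le> 1" by (auto simp: p_def)
  have m: "{y::real. \<bar>y\<bar> < t} \<in> sets borel" "{y::real. t \<le> \<bar>y\<bar>} \<in> sets borel" by measurable
  have "{y::real. \<bar>y\<bar> < t} = space D - {y. t \<le> \<bar>y\<bar>}" by auto
  then have c: "D.prob {y. \<bar>y\<bar> < t} = 1 - p" using D.prob_compl[of "{y. t \<le> \<bar>y\<bar>}"] m by (simp add: p_def)
  have "prob (\<Inter>i\<in>I. Y i -` {y. \<bar>y\<bar> < t} \<inter> space M) = (\<Prod>i\<in>I. prob (Y i -` {y. \<bar>y\<bar> < t} \<inter> space M))"
    by (rule indep_varsD[OF indep]) (use I_nonempty finite_I m in auto)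
  also have "\<dots> = (\<Prod>i\<in>I. 1 - p)"
    using prob_Y[OF _ m(1)] c by (intro prod.cong) (auto simp: vimage_def Int_def conj_commute)
  also have "\<dots> = (1 - p) ^ n" by (simp add: n_def)
  also have "(\<Inter>i\<in>I. Y i -` {y. \<bar>y\<bar> < t} \<inter> space M) = space M - {\<omega> \<in> space M. \<exists>i\<in>I. t \<le> \<bar>Y i \<omega>\<bar>}"
    using I_nonempty by (auto simp flip: not_less simp del: not_less)
  also have "prob \<dots> = 1 - prob {\<omega> \<in> space M. \<exists>i\<in>I. t \<le> \<bar>Y i \<omega>\<bar>}"
    by (rule prob_compl) (use finite_I in measurable)
  finally have mx: "prob {\<omega> \<in> space M. \<exists>i\<in>I. t \<le> \<bar>Y i \<omega>\<bar>} = 1 - (1 - p) ^ n" by simp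
  define z where "z = min (real n * p) 1"
  have z: "0 \<le> z" "z \<le> 1" "z \<le> real n * p" using p by (auto simp: z_def)
  have "(1 - p) ^ n \<le> exp (- p) ^ n" using p exp_ge_add_one_self[of "-p"] by (intro power_mono) auto
  also have "\<dots> = exp (- (real n * p))" by (simp flip: exp_of_nat_mult)
  also have "\<dots> \<le> exp (- z)" using z by simp
  \<comment> \<open>This needs \<open>z \<le> 1\<close>, where
    \<open>(1 + z) * (1 - z / 2) \<ge> 1\<close>; it is the reason for the minimum in
    \<open>z\<close>.\<close>
  also have "exp (- z) \<le> 1 - z / 2"
  proof -
    have "1 + z \<le> exp z" by (rule exp_ge_add_one_self)
    then have "exp (- z) \<le> 1 / (1 + z)" using z by (simp add: exp_minus divide_inverse le_imp_inverse_le)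
    also have "\<dots> \<le> 1 - z / 2" using z mult_left_mono[of z 1 z] by (simp add: field_simps)
    finally show ?thesis .
  qed
  finally have "z / 2 \<le> prob {\<omega> \<in> space M. \<exists>i\<in>I. t \<le> \<bar>Y i \<omega>\<bar>}" using mx by simp
  then show ?thesis using levy_max_inequality[of t] by (simp add: z_def n_def p_def)
qed

section \<open>Exponential moments of truncated sums and two-sided tail bounds\<close>

lemma
  fixes f :: "real \<Rightarrow> real"
  assumes f: "f \<in> borel_measurable borel" "\<And>y. \<bar>f y\<bar> \<le> b"
  shows exp_sum_integrable: "integrable M (\<lambda>\<omega>. exp (h * (\<Sum>i\<in>I. f (Y i \<omega>))))"
    and exp_sum_expectation: "expectation (\<lambda>\<omega>. exp (h * (\<Sum>i\<in>I. f (Y i \<omega>)))) = D.expectation (\<lambda>y. exp (h * f y)) ^ card I"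
proof -
  note f(1)[measurable]
  have g: "(\<lambda>y. exp (h * f y)) \<in> borel_measurable borel" by measurable
  have gb: "\<bar>exp (h * f y)\<bar> \<le> exp (\<bar>h\<bar> * b)" for y
    using mult_left_mono[OF f(2)[of y], of "\<bar>h\<bar>"] abs_ge_self[of "h * f y"] by (simp add: abs_mult)
  have ind: "indep_vars (\<lambda>_. borel) (\<lambda>i \<omega>. exp (h * f (Y i \<omega>))) I"
    by (rule indep_vars_compose2[OF indep]) measurable
  have int: "integrable M (\<lambda>\<omega>. exp (h * f (Y i \<omega>)))" if "i \<in> I" for i
    using that gb by (intro integrable_const_bound[where B = "exp (\<bar>h\<bar> * b)"]) auto
  have E: "expectation (\<lambda>\<omega>. exp (h * f (Y i \<omega>))) = D.expectation (\<lambda>y. exp (h * f y))" if "i \<in> I" for i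
    using integral_distr[OF rv_Y[OF that] g] law[OF that] by simp
  have eq: "exp (h * (\<Sum>i\<in>I. f (Y i \<omega>))) = (\<Prod>i\<in>I. exp (h * f (Y i \<omega>)))" for \<omega>
    using finite_I by (simp add: sum_distrib_left exp_sum)
  show "integrable M (\<lambda>\<omega>. exp (h * (\<Sum>i\<in>I. f (Y i \<omega>))))"
    unfolding eq by (rule indep_vars_integrable[OF finite_I ind int])
  show "expectation (\<lambda>\<omega>. exp (h * (\<Sum>i\<in>I. f (Y i \<omega>)))) = D.expectation (\<lambda>y. exp (h * f y)) ^ card I"
    unfolding eq using indep_vars_lebesgue_integral[OF finite_I ind int] E by simp
qed

text \<open>Integrability is not assumed: the integral of a non-integrable function is 0 by
  convention.\<close>

lemma integral_odd:
  fixes f :: "real \<Rightarrow> real"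
  assumes f: "f \<in> borel_measurable borel" "\<And>y. f (- y) = - f y"
  shows "D.expectation f = 0"
proof -
  have "D.expectation f = integral\<^sup>L (distr D borel uminus) f" by (simp add: symmetric)
  also have "\<dots> = D.expectation (\<lambda>y. f (- y))"
    using f(1) by (subst integral_distr) auto
  also have "\<dots> = - D.expectation f" by (simp add: f(2))
  finally show ?thesis by simp
qed

lemma trunc_mean: "D.expectation (trunc b) = 0"
  by (rule integral_odd) (auto simp: trunc_def)

lemma trunc_third_mean: "D.expectation (\<lambda>y. (trunc b y) ^ 3) = 0"
  by (rule integral_odd) (auto simp: trunc_def)

lemma trunc_moment_2: "D.expectation (\<lambda>y. (trunc b y)\<^sup>2) = trunc_moment 2 D b"
  by (simp add: trunc_moment_def)

text \<open>The linear Taylor term has mean zero. The third moment is kept explicit instead of being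
  bounded by \<open>b\<close> times the second, because its weighted series is the one that can be
  summed.\<close>

lemma exp_moment_upper:
  assumes b: "0 < b"
  shows "D.expectation (\<lambda>y. exp (h * trunc b y))
    \<le> exp (h\<^sup>2 * trunc_moment 2 D b / 2 + \<bar>h\<bar> ^ 3 * trunc_moment 3 D b * exp (\<bar>h\<bar> * b) / 6)"
proof -
  let ?g = "\<lambda>y. 1 + h * trunc b y + h\<^sup>2 / 2 * \<bar>trunc b y\<bar>\<^sup>2 + \<bar>h\<bar> ^ 3 * exp (\<bar>h\<bar> * b) / 6 * \<bar>trunc b y\<bar> ^ 3"
  have "D.expectation (\<lambda>y. exp (h * trunc b y)) \<le> D.expectation ?g"
  proof (rule integral_mono)
    show "integrable D ?g"
      using D.trunc_integrable[OF b] D.trunc_pow_integrable[OF b] D.trunc_pow_integrable[OF b, of 2, simplified]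
      by (intro Bochner_Integration.integrable_add integrable_mult_right) auto
    fix y
    have "exp (h * trunc b y) \<le> 1 + h * trunc b y + (h * trunc b y)\<^sup>2 / 2 + \<bar>h * trunc b y\<bar> ^ 3 * exp \<bar>h * trunc b y\<bar> / 6"
      by (rule exp_le_third_order)
    also have "\<bar>h * trunc b y\<bar> ^ 3 * exp \<bar>h * trunc b y\<bar> \<le> \<bar>h * trunc b y\<bar> ^ 3 * exp (\<bar>h\<bar> * b)"
      using abs_trunc_le[OF b, of y] by (intro mult_left_mono) (auto simp: abs_mult mult_left_mono)
    finally show "exp (h * trunc b y) \<le> ?g y"
      by (simp add: abs_mult power_mult_distrib mult_ac)
  qed (rule D.exp_trunc_integrable[OF b])
  also have "\<dots> = 1 + h * D.expectation (trunc b) + h\<^sup>2 / 2 * trunc_moment 2 D b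
      + \<bar>h\<bar> ^ 3 * exp (\<bar>h\<bar> * b) / 6 * trunc_moment 3 D b"
    using b D.trunc_integrable D.trunc_pow_integrable[of b 2] D.trunc_pow_integrable[of b 3]
    unfolding trunc_moment_def by (simp add: D.prob_space)
  also have "\<dots> = 1 + (h\<^sup>2 * trunc_moment 2 D b / 2 + \<bar>h\<bar> ^ 3 * trunc_moment 3 D b * exp (\<bar>h\<bar> * b) / 6)"
    by (simp add: trunc_mean mult_ac)
  also have "\<dots> \<le> exp (h\<^sup>2 * trunc_moment 2 D b / 2 + \<bar>h\<bar> ^ 3 * trunc_moment 3 D b * exp (\<bar>h\<bar> * b) / 6)"
    by (rule exp_ge_add_one_self)
  finally show ?thesis .
qed

text \<open>The sign \<open>\<sigma>\<close> lets one proof serve both tails. The cubic term is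
  grouped as \<open>h\<close> times a factor, to be compared with \<open>h * x\<close>.\<close>

lemma truncated_sum_chernoff:
  assumes b: "0 < b" and h: "0 < h" and \<sigma>: "\<bar>\<sigma>\<bar> = 1"
  shows "prob {\<omega> \<in> space M. x \<le> \<sigma> * (\<Sum>i\<in>I. trunc b (Y i \<omega>))}
    \<le> exp (- h * x + real (card I) * h\<^sup>2 * trunc_moment 2 D b / 2
        + h * (real (card I) * trunc_moment 3 D b * h\<^sup>2 * exp (h * b)) / 6)"
proof -
  let ?S = "\<lambda>\<omega>. \<Sum>i\<in>I. trunc b (Y i \<omega>)"
  let ?e = "h\<^sup>2 * trunc_moment 2 D b / 2 + h ^ 3 * trunc_moment 3 D b * exp (h * b) / 6"
  have int: "integrable M (\<lambda>\<omega>. exp ((h * \<sigma>) * ?S \<omega>))"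
    by (rule exp_sum_integrable[OF _ abs_trunc_le[OF b]]) simp
  have abs: "\<bar>h * \<sigma>\<bar> = h" using h \<sigma> by (simp add: abs_mult)
  have sq: "(h * \<sigma>)\<^sup>2 = h\<^sup>2" using \<sigma> by (simp add: power_mult_distrib flip: power2_abs[of \<sigma>])
  have "prob {\<omega> \<in> space M. x \<le> \<sigma> * ?S \<omega>} \<le> exp (- h * x) * (\<integral>\<omega>\<in>space M. exp (h * (\<sigma> * ?S \<omega>)) \<partial>M)"
    by (rule Chernoff_ineq_ge[OF h]) (use integrable_mult_indicator[OF sets.top int] in \<open>auto simp: set_integrable_def mult_ac\<close>)
  also have "(\<integral>\<omega>\<in>space M. exp (h * (\<sigma> * ?S \<omega>)) \<partial>M) = expectation (\<lambda>\<omega>. exp ((h * \<sigma>) * ?S \<omega>))"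
    by (subst set_integral_space) (use int in \<open>auto simp: mult_ac\<close>)
  also have "\<dots> = D.expectation (\<lambda>y. exp ((h * \<sigma>) * trunc b y)) ^ card I"
    by (rule exp_sum_expectation[OF _ abs_trunc_le[OF b]]) simp
  also have "\<dots> \<le> exp ?e ^ card I"
    using exp_moment_upper[OF b, of "h * \<sigma>", unfolded abs sq]
    by (intro power_mono) (auto intro!: Bochner_Integration.integral_nonneg)
  also have "\<dots> = exp (real (card I) * ?e)" by (simp add: exp_of_nat_mult)
  also have "exp (- h * x) * exp (real (card I) * ?e) = exp (- h * x + real (card I) * ?e)"
    by (simp only: exp_add)
  also have "- h * x + real (card I) * ?e = - h * x + real (card I) * h\<^sup>2 * trunc_moment 2 D b / 2
        + h * (real (card I) * trunc_moment 3 D b * h\<^sup>2 * exp (h * b)) / 6"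
    by (simp add: algebra_simps power3_eq_cube power2_eq_square)
  finally show ?thesis by simp
qed

text \<open>An inequality of Fuk--Nagaev type. The optimal parameter \<open>x / (n T)\<close> of the Gaussian regime is
  replaced by \<open>s / b\<close> when it exceeds that value.\<close>

lemma truncated_sum_upper_aux:
  assumes x: "0 < x" and b: "0 < b" and s: "0 < s" and \<sigma>: "\<bar>\<sigma>\<bar> = 1"
    and A: "real (card I) * trunc_moment 3 D b * s\<^sup>2 * exp s \<le> 3 / 2 * x * b\<^sup>2"
  shows "prob {\<omega> \<in> space M. x \<le> \<sigma> * (\<Sum>i\<in>I. trunc b (Y i \<omega>))}
    \<le> exp_neg_div (x\<^sup>2 / 4) (real (card I) * trunc_moment 2 D b) + exp (- (s * x / (4 * b)))"
proof -
  define T where "T = real (card I) * trunc_moment 2 D b"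
  let ?p = "prob {\<omega> \<in> space M. x \<le> \<sigma> * (\<Sum>i\<in>I. trunc b (Y i \<omega>))}"
  have T: "0 \<le> T" using trunc_moment_nonneg by (simp add: T_def)
  \<comment> \<open>Hypothesis \<open>A\<close> makes the cubic term at most
    \<open>h * x / 4\<close>, a quarter of the linear gain.\<close>
  have main: "?p \<le> exp (- (3/4) * h * x + h\<^sup>2 * T / 2)" if h: "0 < h" "h \<le> s / b" for h
  proof -
    have hb: "h * b \<le> s" using h b by (simp add: field_simps)
    have "real (card I) * trunc_moment 3 D b * h\<^sup>2 * exp (h * b)
      \<le> real (card I) * trunc_moment 3 D b * (s / b)\<^sup>2 * exp s"
      using hb h trunc_moment_nonneg by (intro mult_mono mult_left_mono power_mono) auto
    also have "\<dots> = (real (card I) * trunc_moment 3 D b * s\<^sup>2 * exp s) / b\<^sup>2"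
      by (simp add: power_divide)
    also have "\<dots> \<le> 3 / 2 * x" using A b by (simp add: divide_le_eq)
    finally have "h * (real (card I) * trunc_moment 3 D b * h\<^sup>2 * exp (h * b)) \<le> h * (3 / 2 * x)"
      using h by (intro mult_left_mono) auto
    then have "- h * x + real (card I) * h\<^sup>2 * trunc_moment 2 D b / 2
        + h * (real (card I) * trunc_moment 3 D b * h\<^sup>2 * exp (h * b)) / 6 \<le> - (3/4) * h * x + h\<^sup>2 * T / 2"
      by (simp add: T_def algebra_simps)
    with truncated_sum_chernoff[OF b h(1) \<sigma>, of x] show ?thesis
      by (meson exp_le_cancel_iff order_trans)
  qed
  show ?thesis
  \<comment> \<open>The choice is \<open>h = min (s / b) (x / T)\<close>; stating the test as a
    product puts \<open>T = 0\<close> into the first case.\<close>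
  proof (cases "T * (s / b) \<le> x")
    case True
    have "(s / b)\<^sup>2 * T / 2 \<le> (s / b) * x / 2"
      using mult_left_mono[OF True, of "s / b"] s b by (simp add: power2_eq_square mult_ac)
    then have "- (3/4) * (s / b) * x + (s / b)\<^sup>2 * T / 2 \<le> - (s * x / (4 * b))"
      using s b x by (simp add: field_simps)
    then have "?p \<le> exp (- (s * x / (4 * b)))"
      using main[of "s / b"] s b by (meson divide_pos_pos exp_le_cancel_iff order_refl order_trans)
    then show ?thesis using exp_neg_div_nonneg[of "x\<^sup>2 / 4" "real (card I) * trunc_moment 2 D b"] by linarith
  next
    case False
    then have T0: "T > 0" using T x by (cases "T = 0") auto
    then have "x / T \<le> s / b" using False b by (simp add: field_simps)
    then have "?p \<le> exp (- (3/4) * (x / T) * x + (x / T)\<^sup>2 * T / 2)"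
      using main[of "x / T"] x T0 by simp
    also have "- (3/4) * (x / T) * x + (x / T)\<^sup>2 * T / 2 = - (x\<^sup>2 / 4) / T"
      using T0 by (simp add: field_simps power2_eq_square)
    also have "exp \<dots> = exp_neg_div (x\<^sup>2 / 4) T" using T0 by (simp add: exp_neg_div_def)
    finally have "?p \<le> exp_neg_div (x\<^sup>2 / 4) (real (card I) * trunc_moment 2 D b)" unfolding T_def .
    then show ?thesis using exp_ge_zero[of "- (s * x / (4 * b))"] by linarith
  qed
qed

lemma truncated_sum_upper:
  assumes x: "0 < x" and b: "0 < b" and s: "0 < s"
    and A: "real (card I) * trunc_moment 3 D b * s\<^sup>2 * exp s \<le> 3 / 2 * x * b\<^sup>2"
  shows "prob {\<omega> \<in> space M. x \<le> \<bar>\<Sum>i\<in>I. trunc b (Y i \<omega>)\<bar>}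
    \<le> 2 * (exp_neg_div (x\<^sup>2 / 4) (real (card I) * trunc_moment 2 D b) + exp (- (s * x / (4 * b))))"
proof -
  have "prob {\<omega> \<in> space M. x \<le> \<bar>\<Sum>i\<in>I. trunc b (Y i \<omega>)\<bar>}
    \<le> prob ({\<omega> \<in> space M. x \<le> 1 * (\<Sum>i\<in>I. trunc b (Y i \<omega>))} \<union> {\<omega> \<in> space M. x \<le> (- 1) * (\<Sum>i\<in>I. trunc b (Y i \<omega>))})"
    by (rule finite_measure_mono) auto
  also have "\<dots> \<le> prob {\<omega> \<in> space M. x \<le> 1 * (\<Sum>i\<in>I. trunc b (Y i \<omega>))} + prob {\<omega> \<in> space M. x \<le> (- 1) * (\<Sum>i\<in>I. trunc b (Y i \<omega>))}"
    by (rule measure_Un_le) measurable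
  also have "\<dots> \<le> 2 * (exp_neg_div (x\<^sup>2 / 4) (real (card I) * trunc_moment 2 D b) + exp (- (s * x / (4 * b))))"
    using truncated_sum_upper_aux[OF x b s _ A, of 1] truncated_sum_upper_aux[OF x b s _ A, of "- 1"] by simp
  finally show ?thesis .
qed

text \<open>Truncating at \<open>x / (8 * \<theta>)\<close> turns the second error term of
  \<open>truncated_sum_upper\<close> into \<open>exp (- 2 * \<theta> * s)\<close>, and
  \<open>s\<close> equal to half of \<open>- ln \<rho>\<close> makes it
  \<open>\<rho> powr \<theta>\<close>. This is where the exponent \<open>\<theta>\<close> comes
  from. The part beyond the truncation is a union bound.\<close>

lemma tail_sum_upper:
  assumes x: "0 < x" and \<theta>: "1 \<le> \<theta>"
  defines "b \<equiv> x / (8 * \<theta>)"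
  shows "prob {\<omega> \<in> space M. x \<le> \<bar>\<Sum>i\<in>I. Y i \<omega>\<bar>}
    \<le> real (card I) * tail_prob D b + 2 * exp_neg_div (x\<^sup>2 / 4) (real (card I) * trunc_moment 2 D b)
      + 2 * (256 / 3 * \<theta>\<^sup>2 * (real (card I) * trunc_moment 3 D b) / x ^ 3) powr \<theta>"
proof -
  define n where "n = real (card I)"
  define A where "A = n * trunc_moment 3 D b"
  define E where "E = exp_neg_div (x\<^sup>2 / 4) (n * trunc_moment 2 D b)"
  have b: "b > 0" using x \<theta> by (simp add: b_def)
  let ?p = "prob {\<omega> \<in> space M. x \<le> \<bar>\<Sum>i\<in>I. trunc b (Y i \<omega>)\<bar>}"
  have A0: "0 \<le> A" using trunc_moment_nonneg by (simp add: A_def n_def)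
  have upper: "?p \<le> 2 * (E + exp (- 2 * \<theta> * s))" if s: "0 < s" "A * s\<^sup>2 * exp s \<le> 3 / 2 * x * b\<^sup>2" for s
  proof -
    have "s * x / (4 * b) = 2 * \<theta> * s" using x \<theta> by (simp add: b_def)
    then show ?thesis using truncated_sum_upper[OF x b s(1)] s(2) by (simp add: A_def E_def n_def)
  qed
  have trunc: "?p \<le> 2 * E + 2 * (256 / 3 * \<theta>\<^sup>2 * A / x ^ 3) powr \<theta>"
  proof (cases "A = 0")
    \<comment> \<open>Without third moment every \<open>s\<close> is admissible, and the extra
      exponential is made arbitrarily small.\<close>
    case True
    have "?p \<le> 2 * E + e" if e: "e > 0" for e
    proof -
      define s where "s = max 1 (- ln (e / 2))"
      have "s > 0" by (auto simp: s_def)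
      have "exp (- 2 * \<theta> * s) \<le> exp (- s)" using \<theta> \<open>s > 0\<close> by simp
      also have "\<dots> \<le> exp (ln (e / 2))" by (simp add: s_def)
      also have "\<dots> = e / 2" using e by simp
      finally show ?thesis using upper[of s] \<open>s > 0\<close> True x b by simp
    qed
    then have "?p \<le> 2 * E" by (rule field_le_epsilon)
    then show ?thesis by (simp add: add_increasing2)
  next
    case False
    then have A1: "A > 0" using A0 by simp
    define \<rho> where "\<rho> = 256 / 3 * \<theta>\<^sup>2 * A / x ^ 3"
    have \<rho>: "\<rho> > 0" using A1 x \<theta> by (auto simp: \<rho>_def)
    show ?thesis
    proof (cases "\<rho> < 1")
      case True
      define s where "s = - ln \<rho> / 2"
      have s: "s > 0" using True \<rho> by (simp add: s_def)
      \<comment> \<open>This replaces the condition on \<open>s\<^sup>2 * exp s\<close> by one on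
        \<open>2 * exp (2 * s) = 2 / \<rho>\<close>; the constant \<open>256 / 3\<close> in
        \<open>\<rho>\<close> gives equality with \<open>3 / 2 * x * b\<^sup>2\<close>.\<close>
      have "s\<^sup>2 \<le> 2 * exp s" using exp_lower_Taylor_quadratic[of s] s by simp
      then have "A * s\<^sup>2 * exp s \<le> A * (2 * exp s) * exp s"
        using A0 by (intro mult_left_mono mult_right_mono) auto
      also have "\<dots> = A * 2 * exp (2 * s)" by (simp add: exp_double power2_eq_square)
      also have "exp (2 * s) = 1 / \<rho>" using \<rho> by (simp add: s_def exp_minus inverse_eq_divide)
      also have "A * 2 * (1 / \<rho>) = 3 / 2 * x * b\<^sup>2"
        using A1 x \<theta> by (simp add: \<rho>_def b_def field_simps power2_eq_square power3_eq_cube)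
      finally have "?p \<le> 2 * (E + exp (- 2 * \<theta> * s))" using upper s by auto
      also have "exp (- 2 * \<theta> * s) = \<rho> powr \<theta>" using \<rho> by (simp add: s_def powr_def)
      finally show ?thesis by (simp add: \<rho>_def)
    next
      case False
      then have "1 \<le> \<rho> powr \<theta>" using \<theta> by (intro ge_one_powr_ge_zero) auto
      moreover have "?p \<le> 1" by simp
      moreover have "0 \<le> E" by (simp add: E_def exp_neg_div_nonneg)
      ultimately show ?thesis unfolding \<rho>_def[symmetric] by linarith
    qed
  qed
  have m: "{y::real. b \<le> \<bar>y\<bar>} \<in> sets borel" by measurable
  have "prob {\<omega> \<in> space M. x \<le> \<bar>\<Sum>i\<in>I. Y i \<omega>\<bar>}
     \<le> prob ((\<Union>i\<in>I. {\<omega> \<in> space M. Y i \<omega> \<in> {y. b \<le> \<bar>y\<bar>}}) \<union> {\<omega> \<in> space M. x \<le> \<bar>\<Sum>i\<in>I. trunc b (Y i \<omega>)\<bar>})"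
  proof (rule finite_measure_mono)
    show "{\<omega> \<in> space M. x \<le> \<bar>\<Sum>i\<in>I. Y i \<omega>\<bar>}
     \<subseteq> (\<Union>i\<in>I. {\<omega> \<in> space M. Y i \<omega> \<in> {y. b \<le> \<bar>y\<bar>}}) \<union> {\<omega> \<in> space M. x \<le> \<bar>\<Sum>i\<in>I. trunc b (Y i \<omega>)\<bar>}"
    proof
      fix \<omega> assume *: "\<omega> \<in> {\<omega> \<in> space M. x \<le> \<bar>\<Sum>i\<in>I. Y i \<omega>\<bar>}"
      show "\<omega> \<in> (\<Union>i\<in>I. {\<omega> \<in> space M. Y i \<omega> \<in> {y. b \<le> \<bar>y\<bar>}}) \<union> {\<omega> \<in> space M. x \<le> \<bar>\<Sum>i\<in>I. trunc b (Y i \<omega>)\<bar>}"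
      proof (cases "\<exists>i\<in>I. b \<le> \<bar>Y i \<omega>\<bar>")
        case False
        then have "(\<Sum>i\<in>I. trunc b (Y i \<omega>)) = (\<Sum>i\<in>I. Y i \<omega>)"
          by (intro sum.cong) (auto simp: trunc_def)
        then show ?thesis using * by auto
      qed (use * in auto)
    qed
  qed (use m finite_I in measurable)
  also have "\<dots> \<le> prob (\<Union>i\<in>I. {\<omega> \<in> space M. Y i \<omega> \<in> {y. b \<le> \<bar>y\<bar>}}) + ?p"
    by (rule measure_Un_le) (use m finite_I in measurable)
  also have "prob (\<Union>i\<in>I. {\<omega> \<in> space M. Y i \<omega> \<in> {y. b \<le> \<bar>y\<bar>}})
      \<le> (\<Sum>i\<in>I. prob {\<omega> \<in> space M. Y i \<omega> \<in> {y. b \<le> \<bar>y\<bar>}})"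
    by (rule finite_measure_subadditive_finite[OF finite_I]) auto
  also have "\<dots> = n * tail_prob D b"
    using prob_Y[OF _ m] by (simp add: n_def tail_prob_def)
  finally show ?thesis using trunc by (simp add: n_def A_def E_def mult.assoc)
qed

text \<open>Paley-Zygmund for \<open>Z = exp (h * S)\<close>: the mean is at least
  \<open>exp (h\<^sup>2 * V / 4)\<close> and the second moment at most
  \<open>exp (4 * h\<^sup>2 * V)\<close>. Taking logarithms of
  \<open>Z \<ge> expectation Z / 2\<close> produces the threshold.\<close>

lemma truncated_sum_lower:
  assumes b: "0 < b" and h: "0 < h" "h * b \<le> 1 / 2"
  defines "V \<equiv> real (card I) * trunc_moment 2 D b"
  shows "exp (- 4 * h\<^sup>2 * V) / 4
    \<le> prob {\<omega> \<in> space M. h * V / 4 - ln 2 / h \<le> (\<Sum>i\<in>I. trunc b (Y i \<omega>))}"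
proof -
  define s where "s = trunc_moment 2 D b"
  define \<phi> where "\<phi> t = D.expectation (\<lambda>y. exp (t * trunc b y))" for t
  let ?S = "\<lambda>\<omega>. \<Sum>i\<in>I. trunc b (Y i \<omega>)"
  let ?Z = "\<lambda>\<omega>. exp (h * ?S \<omega>)"
  note int1 = D.trunc_integrable[OF b]
  have int2: "integrable D (\<lambda>y. (trunc b y)\<^sup>2)" using D.trunc_pow_integrable[OF b, of 2] by simp
  have int3: "integrable D (\<lambda>y. (trunc b y) ^ 3)"
    by (rule D.integrable_law[where b = "b ^ 3"]) (auto simp: power_abs intro!: power_mono abs_trunc_le b)
  have s0: "0 \<le> s" by (simp add: s_def trunc_moment_nonneg)
  have "s \<le> D.expectation (\<lambda>y. b\<^sup>2)"
    unfolding s_def trunc_moment_2[symmetric]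
  proof (rule integral_mono[OF int2])
    fix y show "(trunc b y)\<^sup>2 \<le> b\<^sup>2" using abs_trunc_le[OF b, of y] b by (simp add: abs_le_square_iff[symmetric])
  qed simp
  then have "s \<le> b\<^sup>2" by (simp add: D.prob_space)
  then have "h\<^sup>2 * s \<le> (h * b)\<^sup>2" by (simp add: power_mult_distrib mult_left_mono)
  also have "\<dots> \<le> (1 / 2)\<^sup>2" using h b by (intro power_mono) auto
  finally have hs: "h\<^sup>2 * s \<le> 1 / 4" by (simp add: power2_eq_square)
  have lower: "exp (h\<^sup>2 * s / 4) \<le> \<phi> h"
  proof -
    have "exp (h\<^sup>2 * s / 4) \<le> 1 + h\<^sup>2 * s / 4 + (h\<^sup>2 * s / 4)\<^sup>2"
      using hs s0 by (intro exp_le_quadratic) auto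
    \<comment> \<open>With \<open>u = h\<^sup>2 * s / 4 \<le> 1\<close>, the bound
      \<open>1 + u + u\<^sup>2\<close> fits below the Taylor bound \<open>1 + 2 * u\<close>, whose
      odd terms have mean zero.\<close>
    also have "(h\<^sup>2 * s / 4)\<^sup>2 \<le> (h\<^sup>2 * s / 4) * 1"
      unfolding power2_eq_square[of "h\<^sup>2 * s / 4"] using hs s0 by (intro mult_left_mono) auto
    also have "1 + h\<^sup>2 * s / 4 + (h\<^sup>2 * s / 4) * 1
      = D.expectation (\<lambda>y. 1 + h * trunc b y + h\<^sup>2 / 2 * (trunc b y)\<^sup>2 + h ^ 3 / 6 * (trunc b y) ^ 3)"
      using int1 int2 int3 by (simp add: D.prob_space trunc_mean trunc_third_mean s_def trunc_moment_2)
    also have "\<dots> \<le> \<phi> h"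
      unfolding \<phi>_def
    proof (rule integral_mono)
      fix y
      show "1 + h * trunc b y + h\<^sup>2 / 2 * (trunc b y)\<^sup>2 + h ^ 3 / 6 * (trunc b y) ^ 3 \<le> exp (h * trunc b y)"
        using exp_ge_third_order[of "h * trunc b y"] by (simp add: power_mult_distrib)
    qed (use int1 int2 int3 D.exp_trunc_integrable[OF b] in auto)
    finally show ?thesis by simp
  qed
  have upper: "\<phi> (2 * h) \<le> exp (4 * h\<^sup>2 * s)"
  proof -
    have "\<phi> (2 * h) \<le> D.expectation (\<lambda>y. 1 + 2 * h * trunc b y + 4 * h\<^sup>2 * (trunc b y)\<^sup>2)"
      unfolding \<phi>_def
    proof (rule integral_mono)
      fix y
      \<comment> \<open>The condition \<open>h * b \<le> 1 / 2\<close> is tuned to this place: the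
        second moment of \<open>Z\<close> involves \<open>2 * h\<close>, and the quadratic bound
        needs an argument of size at most 1.\<close>
      have "h * \<bar>trunc b y\<bar> \<le> h * b" using abs_trunc_le[OF b, of y] h by (intro mult_left_mono) auto
      moreover have "\<bar>2 * h * trunc b y\<bar> = 2 * (h * \<bar>trunc b y\<bar>)" using h by (simp add: abs_mult)
      ultimately have "\<bar>2 * h * trunc b y\<bar> \<le> 1" using h by linarith
      from exp_le_quadratic[OF this]
      show "exp (2 * h * trunc b y) \<le> 1 + 2 * h * trunc b y + 4 * h\<^sup>2 * (trunc b y)\<^sup>2"
        by (simp add: power_mult_distrib)
    qed (use int1 int2 D.exp_trunc_integrable[OF b] in auto)
    also have "\<dots> = 1 + 4 * h\<^sup>2 * s"
      using int1 int2 by (simp add: D.prob_space trunc_mean s_def trunc_moment_2)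
    also have "\<dots> \<le> exp (4 * h\<^sup>2 * s)" by (rule exp_ge_add_one_self)
    finally show ?thesis .
  qed
  have EZ: "expectation ?Z = \<phi> h ^ card I"
    unfolding \<phi>_def by (rule exp_sum_expectation[OF _ abs_trunc_le[OF b]]) simp
  have sq: "(?Z \<omega>)\<^sup>2 = exp ((2 * h) * ?S \<omega>)" for \<omega>
    using exp_double[of "h * ?S \<omega>"] by (simp add: mult.assoc)
  have EZ2: "expectation (\<lambda>\<omega>. (?Z \<omega>)\<^sup>2) = \<phi> (2 * h) ^ card I"
    unfolding \<phi>_def sq by (rule exp_sum_expectation[OF _ abs_trunc_le[OF b]]) simp
  have "exp (h\<^sup>2 * s / 4) ^ card I \<le> \<phi> h ^ card I" using lower by (intro power_mono) auto
  then have EZl: "exp (h\<^sup>2 * V / 4) \<le> expectation ?Z"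
    unfolding EZ by (simp add: V_def s_def mult_ac flip: exp_of_nat_mult)
  have "\<phi> (2 * h) ^ card I \<le> exp (4 * h\<^sup>2 * s) ^ card I"
    using upper by (intro power_mono) (auto simp: \<phi>_def intro!: Bochner_Integration.integral_nonneg)
  then have EZ2u: "expectation (\<lambda>\<omega>. (?Z \<omega>)\<^sup>2) \<le> exp (4 * h\<^sup>2 * V)"
    unfolding EZ2 by (simp add: V_def s_def mult_ac flip: exp_of_nat_mult)
  have V0: "0 \<le> V" using s0 by (simp add: V_def s_def)
  have EZ1: "1 \<le> expectation ?Z" using EZl V0 by (intro order_trans[OF _ EZl]) auto
  have EZ2p: "0 < expectation (\<lambda>\<omega>. (?Z \<omega>)\<^sup>2)"
  proof -
    have "0 < \<phi> (2 * h)"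
    proof -
      have "D.expectation (\<lambda>y. 1 + 2 * h * trunc b y) \<le> \<phi> (2 * h)"
        unfolding \<phi>_def by (rule integral_mono) (use int1 D.exp_trunc_integrable[OF b] exp_ge_add_one_self in auto)
      then show ?thesis using int1 by (simp add: D.prob_space trunc_mean)
    qed
    then show ?thesis unfolding EZ2 by simp
  qed
  have "exp (- 4 * h\<^sup>2 * V) / 4 = 1 / (4 * exp (4 * h\<^sup>2 * V))" by (simp add: exp_minus field_simps)
  \<comment> \<open>In the numerator the mean enters only through being at least 1; its exponential
    lower bound is kept for the threshold.\<close>
  also have "\<dots> \<le> (expectation ?Z)\<^sup>2 / (4 * expectation (\<lambda>\<omega>. (?Z \<omega>)\<^sup>2))"
    using EZ1 EZ2p EZ2u by (intro frac_le) auto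
  also have "\<dots> \<le> prob {\<omega> \<in> space M. expectation ?Z / 2 \<le> ?Z \<omega>}"
  proof (rule paley_zygmund)
    show "integrable M ?Z" by (rule exp_sum_integrable[OF _ abs_trunc_le[OF b]]) simp
    show "integrable M (\<lambda>\<omega>. (?Z \<omega>)\<^sup>2)" unfolding sq by (rule exp_sum_integrable[OF _ abs_trunc_le[OF b]]) simp
  qed (use EZ1 in auto)
  also have "\<dots> \<le> prob {\<omega> \<in> space M. h * V / 4 - ln 2 / h \<le> ?S \<omega>}"
  proof (rule finite_measure_mono)
    show "{\<omega> \<in> space M. expectation ?Z / 2 \<le> ?Z \<omega>} \<subseteq> {\<omega> \<in> space M. h * V / 4 - ln 2 / h \<le> ?S \<omega>}"
    proof safe
      fix \<omega> assume "expectation ?Z / 2 \<le> ?Z \<omega>"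
      then have "exp (h\<^sup>2 * V / 4) / exp (ln 2) \<le> exp (h * ?S \<omega>)" using EZl by simp
      then have "h\<^sup>2 * V / 4 - ln 2 \<le> h * ?S \<omega>" by (simp only: exp_le_cancel_iff flip: exp_diff)
      then have "(h\<^sup>2 * V / 4 - ln 2) / h \<le> ?S \<omega>" using h by (simp add: divide_le_eq mult.commute)
      then show "h * V / 4 - ln 2 / h \<le> ?S \<omega>" using h by (simp add: diff_divide_distrib power2_eq_square)
    qed
  qed measurable
  finally show ?thesis .
qed

text \<open>Truncating at \<open>1 / (2 h)\<close> makes the previous lemma applicable; if this destroys more than half
  of the variance, the third moment has to be large.\<close>

lemma tail_sum_lower:
  assumes x: "0 < x" and b: "0 < b"
  defines "V \<equiv> real (card I) * trunc_moment 2 D b"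
  assumes V: "0 < V" "V \<le> x\<^sup>2"
  shows "exp (- 1024 * x\<^sup>2 / V) / 8 \<le> prob {\<omega> \<in> space M. x \<le> \<bar>\<Sum>i\<in>I. Y i \<omega>\<bar>}
     \<or> (V / x\<^sup>2)\<^sup>2 / 64 \<le> real (card I) * trunc_moment 3 D b / x ^ 3"
proof -
  \<comment> \<open>If half of \<open>V\<close> survives truncation, then
    \<open>h * W / 4 \<ge> 2 * x\<close>; one \<open>x\<close> pays for \<open>ln 2 / h\<close>,
    which is where \<open>V \<le> x\<^sup>2\<close> enters. The cost
    \<open>4 * h\<^sup>2 * V\<close> equals \<open>1024 * x\<^sup>2 / V\<close>.\<close>
  define h where "h = 16 * x / V"
  define c where "c = min b (1 / (2 * h))"
  have h: "h > 0" using x V by (simp add: h_def)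
  have c: "c > 0" "h * c \<le> 1 / 2" "c \<le> b" using h b by (auto simp: c_def min_def field_simps)
  define W where "W = real (card I) * trunc_moment 2 D c"
  have n: "real (card I) > 0" using V by (simp add: V_def zero_less_mult_iff)
  show ?thesis
  proof (cases "V / 2 \<le> W")
    case True
    have tle: "(trunc c y)\<^sup>2 \<le> (trunc b y)\<^sup>2" for y using c by (auto simp: trunc_def)
    have "trunc_moment 2 D c \<le> trunc_moment 2 D b"
      unfolding trunc_moment_2[symmetric]
      by (rule integral_mono) (use D.trunc_pow_integrable[of _ 2] c b tle in auto)
    then have WV: "W \<le> V" unfolding W_def V_def by (simp add: mult_left_mono)
    have "2 * x \<le> h * W / 4" using True x V by (simp add: h_def field_simps)
    moreover have "ln 2 / h \<le> x"
    proof -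
      have "ln 2 / h \<le> 1 / h" using h ln_2_less_1 by (simp add: divide_right_mono)
      also have "\<dots> \<le> x" using x V by (simp add: h_def field_simps power2_eq_square)
      finally show ?thesis .
    qed
    ultimately have hx: "x \<le> h * W / 4 - ln 2 / h" by linarith
    have "exp (- 1024 * x\<^sup>2 / V) / 4 \<le> exp (- 4 * h\<^sup>2 * W) / 4"
    proof -
      have "4 * h\<^sup>2 * W \<le> 4 * h\<^sup>2 * V" using WV by (intro mult_left_mono) auto
      also have "\<dots> = 1024 * x\<^sup>2 / V" using V by (simp add: h_def power2_eq_square field_simps)
      finally show ?thesis by simp
    qed
    also have "\<dots> \<le> prob {\<omega> \<in> space M. h * W / 4 - ln 2 / h \<le> (\<Sum>i\<in>I. trunc c (Y i \<omega>))}"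
      unfolding W_def by (rule truncated_sum_lower[OF c(1) h c(2)])
    also have "\<dots> \<le> prob {\<omega> \<in> space M. x \<le> \<bar>\<Sum>i\<in>I. if Y i \<omega> \<in> {y. \<bar>y\<bar> < c} then Y i \<omega> else 0\<bar>}"
    proof (rule finite_measure_mono)
      show "{\<omega> \<in> space M. h * W / 4 - ln 2 / h \<le> (\<Sum>i\<in>I. trunc c (Y i \<omega>))}
        \<subseteq> {\<omega> \<in> space M. x \<le> \<bar>\<Sum>i\<in>I. if Y i \<omega> \<in> {y. \<bar>y\<bar> < c} then Y i \<omega> else 0\<bar>}"
        using hx by (auto simp: trunc_def)
    qed measurable
    also have "\<dots> \<le> 2 * prob {\<omega> \<in> space M. x \<le> \<bar>\<Sum>i\<in>I. Y i \<omega>\<bar>}"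
    proof (rule prob_truncated_sum_le)
      show "{y::real. \<bar>y\<bar> < c} \<in> sets borel" by measurable
    qed simp
    finally show ?thesis by simp
  next
    case False
    then have "c \<noteq> b" using V unfolding V_def W_def by auto
    then have ch: "c = 1 / (2 * h)" by (auto simp: c_def min_def)
    \<comment> \<open>The lost part of the second moment lives on \<open>c \<le> |y| < b\<close>,
      where \<open>c * y\<^sup>2 \<le> |y| ^ 3\<close>.\<close>
    have "c * (trunc_moment 2 D b - trunc_moment 2 D c)
      = D.expectation (\<lambda>y. c * ((trunc b y)\<^sup>2 - (trunc c y)\<^sup>2))"
      using D.trunc_pow_integrable[of _ 2] c b by (simp flip: trunc_moment_2)
    also have "\<dots> \<le> trunc_moment 3 D b"
      unfolding trunc_moment_def
    proof (rule integral_mono)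
      fix y
      show "c * ((trunc b y)\<^sup>2 - (trunc c y)\<^sup>2) \<le> \<bar>trunc b y\<bar> ^ 3"
      proof (cases "c \<le> \<bar>y\<bar> \<and> \<bar>y\<bar> < b")
        case True
        then have "c * y\<^sup>2 \<le> \<bar>y\<bar> * \<bar>y\<bar>\<^sup>2" by (simp add: mult_right_mono)
        then show ?thesis using True by (simp add: trunc_def power3_eq_cube power2_eq_square)
      qed (use c in \<open>auto simp: trunc_def\<close>)
    qed (use D.trunc_pow_integrable[of _ 2] D.trunc_pow_integrable[of _ 3] c b in auto)
    finally have "real (card I) * (c * (trunc_moment 2 D b - trunc_moment 2 D c)) \<le> real (card I) * trunc_moment 3 D b"
      using n by (intro mult_left_mono) auto
    then have "c * (V - W) \<le> real (card I) * trunc_moment 3 D b"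
      by (simp add: V_def W_def algebra_simps)
    moreover have "c * (V / 2) \<le> c * (V - W)" using c False by (intro mult_left_mono) auto
    ultimately have "c * (V / 2) \<le> real (card I) * trunc_moment 3 D b" by linarith
    \<comment> \<open>Here \<open>c = 1 / (2 * h) = V / (32 * x)\<close>, the origin of the 64 in
      the conclusion.\<close>
    moreover have "c * (V / 2) = V\<^sup>2 / (64 * x)" using V x by (simp add: ch h_def power2_eq_square)
    ultimately have "V\<^sup>2 / (64 * x) / x ^ 3 \<le> real (card I) * trunc_moment 3 D b / x ^ 3"
      using x by (intro divide_right_mono) auto
    moreover have "V\<^sup>2 / (64 * x) / x ^ 3 = (V / x\<^sup>2)\<^sup>2 / 64"
      using x by (simp add: field_simps power2_eq_square power3_eq_cube)
    ultimately have "(V / x\<^sup>2)\<^sup>2 / 64 \<le> real (card I) * trunc_moment 3 D b / x ^ 3" by (simp only:)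
    then show ?thesis ..
  qed
qed

end

subsection \<open>Symmetrization\<close>

lemma (in prob_space) median_exists:
  fixes U :: "'a \<Rightarrow> real"
  assumes U[measurable]: "random_variable borel U"
  shows "\<exists>m. is_median M U m"
proof -
  define F where "F = cdf (distr M borel U)"
  interpret U: real_distribution "distr M borel U" by (rule real_distribution_distr) simp
  have F_eq: "F x = prob {\<omega> \<in> space M. U \<omega> \<le> x}" for x
    unfolding F_def cdf_def by (subst measure_distr) (auto intro!: arg_cong[where f=prob])
  define A where "A = {x. 1 / 2 \<le> F x}"
  have "eventually (\<lambda>x. 1 / 2 < F x) at_top"
    unfolding F_def by (rule order_tendstoD[OF U.cdf_lim_at_top_prob]) simp
  then obtain x1 where "1 / 2 < F x1" by (auto simp: eventually_at_top_linorder)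
  then have A_ne: "A \<noteq> {}" by (auto simp: A_def intro: less_imp_le)
  have "eventually (\<lambda>x. F x < 1 / 2) at_bot"
    unfolding F_def by (rule order_tendstoD[OF U.cdf_lim_at_bot]) simp
  then obtain x0 where x0: "F x0 < 1 / 2" by (auto simp: eventually_at_bot_linorder)
  have lb: "x0 \<le> x" if "x \<in> A" for x
    using that x0 U.cdf_nondecreasing[of x x0] unfolding A_def F_def by (cases "x0 \<le> x") auto
  then have bdd: "bdd_below A" by (auto simp: bdd_below_def)
  \<comment> \<open>The lower quantile at level one half: right continuity of \<open>F\<close>
    bounds the mass of \<open>{..m}\<close> from below, the left limit bounds that of
    \<open>{..<m}\<close> from above.\<close>
  define m where "m = Inf A"
  have gt: "1 / 2 \<le> F x" if x: "m < x" for x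
  proof -
    from cInf_lessD[OF A_ne] x obtain y where "y \<in> A" "y < x" unfolding m_def by blast
    then show ?thesis using U.cdf_nondecreasing[of y x] unfolding A_def F_def by auto
  qed
  have lt: "F x \<le> 1 / 2" if x: "x < m" for x
    using cInf_lower[OF _ bdd, of x] x unfolding m_def A_def by (cases "1 / 2 \<le> F x") auto
  have "1 / 2 \<le> F m"
  proof (rule tendsto_lowerbound)
    show "(F \<longlongrightarrow> F m) (at_right m)"
      using U.cdf_is_right_cont[of m] by (simp add: F_def continuous_within)
    show "eventually (\<lambda>x. 1 / 2 \<le> F x) (at_right m)"
      unfolding eventually_at_right_field using gt by (intro exI[of _ "m + 1"]) auto
  qed simp
  then have le: "1 / 2 \<le> prob {\<omega> \<in> space M. U \<omega> \<le> m}" by (simp add: F_eq)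
  have "measure (distr M borel U) {..<m} \<le> 1 / 2"
  proof (rule tendsto_upperbound)
    show "(F \<longlongrightarrow> measure (distr M borel U) {..<m}) (at_left m)"
      using U.cdf_at_left[of m] by (simp add: F_def)
    show "eventually (\<lambda>x. F x \<le> 1 / 2) (at_left m)"
      unfolding eventually_at_left_field using lt by (intro exI[of _ "m - 1"]) auto
  qed simp
  moreover have "measure (distr M borel U) {..<m} = prob {\<omega> \<in> space M. U \<omega> < m}"
    by (subst measure_distr) (auto intro!: arg_cong[where f=prob])
  moreover have "prob {\<omega> \<in> space M. m \<le> U \<omega>} = 1 - prob {\<omega> \<in> space M. U \<omega> < m}"
  proof -
    have "{\<omega> \<in> space M. m \<le> U \<omega>} = space M - {\<omega> \<in> space M. U \<omega> < m}" by auto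
    then show ?thesis by (simp only:) (rule prob_compl, measurable)
  qed
  ultimately have "1 / 2 \<le> prob {\<omega> \<in> space M. m \<le> U \<omega>}" by linarith
  then show ?thesis using le unfolding is_median_def by blast
qed

text \<open>On \<open>{m \<le> U} \<inter> {V \<le> m}\<close> and on \<open>{U < m} \<inter> {m \<le> V}\<close> the distance from \<open>U\<close> to \<open>V\<close> is at
  least the distance from \<open>U\<close> to \<open>m\<close>; in both cases the constraint on \<open>V\<close> costs a factor 2.\<close>

lemma (in prob_space) expectation_median_deviation_le:
  fixes U V :: "'a \<Rightarrow> real" and g :: "real \<Rightarrow> real"
  assumes ind: "indep_var borel U borel V" and m: "is_median M V m"
    and g[measurable]: "g \<in> borel_measurable borel" and g_bound: "\<And>y. 0 \<le> g y \<and> g y \<le> K"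
    and g_mono: "\<And>y z. 0 \<le> y \<Longrightarrow> y \<le> z \<Longrightarrow> g y \<le> g z"
  shows "expectation (\<lambda>\<omega>. g \<bar>U \<omega> - m\<bar>) \<le> 2 * expectation (\<lambda>\<omega>. g \<bar>U \<omega> - V \<omega>\<bar>)"
proof -
  have [measurable]: "random_variable borel U" "random_variable borel V"
    using indep_var_rv1[OF ind] indep_var_rv2[OF ind] by auto
  have K: "0 \<le> K" using g_bound[of 0] by linarith
  define u1 where "u1 x = (if m \<le> x then g \<bar>x - m\<bar> else 0)" for x
  define u2 where "u2 x = (if x < m then g \<bar>x - m\<bar> else 0)" for x
  have [measurable]: "u1 \<in> borel_measurable borel" "u2 \<in> borel_measurable borel"
    unfolding u1_def[abs_def] u2_def[abs_def] by measurable
  have bnd: "\<bar>u1 x\<bar> \<le> K" "\<bar>u2 x\<bar> \<le> K" for x using g_bound K by (auto simp: u1_def u2_def)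
  have int: "integrable M (\<lambda>\<omega>. u1 (U \<omega>))" "integrable M (\<lambda>\<omega>. u2 (U \<omega>))"
    by (rule integrable_const_bound[where B = K]; use bnd in simp)+
  have nn: "0 \<le> expectation (\<lambda>\<omega>. u1 (U \<omega>))" "0 \<le> expectation (\<lambda>\<omega>. u2 (U \<omega>))"
    using g_bound by (auto intro!: Bochner_Integration.integral_nonneg simp: u1_def u2_def)
  let ?L = "\<lambda>x. indicator {..m} x :: real" and ?R = "\<lambda>x. indicator {m..} x :: real"
  have indic: "integrable M (\<lambda>\<omega>. ?L (V \<omega>))" "integrable M (\<lambda>\<omega>. ?R (V \<omega>))"
    by (rule integrable_const_bound[where B = 1]; simp)+
  have PL: "1 / 2 \<le> expectation (\<lambda>\<omega>. ?L (V \<omega>))"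
  proof -
    have "expectation (\<lambda>\<omega>. ?L (V \<omega>)) = expectation (indicator {\<omega> \<in> space M. V \<omega> \<le> m})"
      by (intro Bochner_Integration.integral_cong) (auto simp: indicator_def)
    also have "\<dots> = prob {\<omega> \<in> space M. V \<omega> \<le> m}" by simp
    finally show ?thesis using m by (simp add: is_median_def)
  qed
  have PR: "1 / 2 \<le> expectation (\<lambda>\<omega>. ?R (V \<omega>))"
  proof -
    have "expectation (\<lambda>\<omega>. ?R (V \<omega>)) = expectation (indicator {\<omega> \<in> space M. V \<omega> \<ge> m})"
      by (intro Bochner_Integration.integral_cong) (auto simp: indicator_def)
    also have "\<dots> = prob {\<omega> \<in> space M. V \<omega> \<ge> m}" by simp
    finally show ?thesis using m by (simp add: is_median_def)
  qed
  have i1: "indep_var borel (\<lambda>\<omega>. u1 (U \<omega>)) borel (\<lambda>\<omega>. ?L (V \<omega>))"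
    using indep_var_compose[OF ind, of u1 borel ?L borel] by (simp add: comp_def)
  have i2: "indep_var borel (\<lambda>\<omega>. u2 (U \<omega>)) borel (\<lambda>\<omega>. ?R (V \<omega>))"
    using indep_var_compose[OF ind, of u2 borel ?R borel] by (simp add: comp_def)
  have "expectation (\<lambda>\<omega>. g \<bar>U \<omega> - m\<bar>) = expectation (\<lambda>\<omega>. u1 (U \<omega>) + u2 (U \<omega>))"
    by (intro Bochner_Integration.integral_cong) (auto simp: u1_def u2_def)
  also have "\<dots> = expectation (\<lambda>\<omega>. u1 (U \<omega>)) + expectation (\<lambda>\<omega>. u2 (U \<omega>))"
    using int by simp
  also have "\<dots> \<le> 2 * (expectation (\<lambda>\<omega>. u1 (U \<omega>)) * expectation (\<lambda>\<omega>. ?L (V \<omega>)) +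
      expectation (\<lambda>\<omega>. u2 (U \<omega>)) * expectation (\<lambda>\<omega>. ?R (V \<omega>)))"
    using mult_left_mono[OF PL nn(1)] mult_left_mono[OF PR nn(2)] by simp
  also have "\<dots> = 2 * (expectation (\<lambda>\<omega>. u1 (U \<omega>) * ?L (V \<omega>)) + expectation (\<lambda>\<omega>. u2 (U \<omega>) * ?R (V \<omega>)))"
    using indep_var_lebesgue_integral[OF i1 int(1) indic(1)] indep_var_lebesgue_integral[OF i2 int(2) indic(2)]
    by simp
  also have "\<dots> = 2 * expectation (\<lambda>\<omega>. u1 (U \<omega>) * ?L (V \<omega>) + u2 (U \<omega>) * ?R (V \<omega>))"
    using indep_var_integrable[OF i1 int(1) indic(1)] indep_var_integrable[OF i2 int(2) indic(2)]
    by simp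
  also have "expectation (\<lambda>\<omega>. u1 (U \<omega>) * ?L (V \<omega>) + u2 (U \<omega>) * ?R (V \<omega>))
      \<le> expectation (\<lambda>\<omega>. g \<bar>U \<omega> - V \<omega>\<bar>)"
  proof (rule integral_mono)
    show "integrable M (\<lambda>\<omega>. u1 (U \<omega>) * ?L (V \<omega>) + u2 (U \<omega>) * ?R (V \<omega>))"
      using indep_var_integrable[OF i1 int(1) indic(1)] indep_var_integrable[OF i2 int(2) indic(2)]
      by simp
    show "integrable M (\<lambda>\<omega>. g \<bar>U \<omega> - V \<omega>\<bar>)"
      by (rule integrable_const_bound[where B = K]) (use g_bound in auto)
    fix \<omega>
    show "u1 (U \<omega>) * ?L (V \<omega>) + u2 (U \<omega>) * ?R (V \<omega>) \<le> g \<bar>U \<omega> - V \<omega>\<bar>"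
      using g_mono[of "\<bar>U \<omega> - m\<bar>" "\<bar>U \<omega> - V \<omega>\<bar>"] g_bound[of "\<bar>U \<omega> - V \<omega>\<bar>"]
      by (auto simp: u1_def u2_def indicator_def)
  qed
  finally show ?thesis by simp
qed

text \<open>The weak symmetrization inequality, obtained with \<open>g\<close> the indicator of
  \<open>{t..}\<close>.\<close>

lemma (in prob_space) prob_median_deviation_le:
  fixes U V :: "'a \<Rightarrow> real"
  assumes ind: "indep_var borel U borel V" and m: "is_median M V m" and t: "0 < t"
  shows "prob {\<omega> \<in> space M. t \<le> \<bar>U \<omega> - m\<bar>} \<le> 2 * prob {\<omega> \<in> space M. t \<le> \<bar>U \<omega> - V \<omega>\<bar>}"
proof -
  have [measurable]: "random_variable borel U" "random_variable borel V"
    using indep_var_rv1[OF ind] indep_var_rv2[OF ind] by auto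
  have eq: "prob {\<omega> \<in> space M. t \<le> W \<omega>} = expectation (\<lambda>\<omega>. indicator {t..} (W \<omega>) :: real)"
    if [measurable]: "random_variable borel W" for W :: "'a \<Rightarrow> real"
  proof -
    have "expectation (\<lambda>\<omega>. indicator {t..} (W \<omega>) :: real) = expectation (indicator {\<omega> \<in> space M. t \<le> W \<omega>})"
      by (intro Bochner_Integration.integral_cong) (auto simp: indicator_def)
    then show ?thesis by simp
  qed
  show ?thesis
    unfolding eq[of "\<lambda>\<omega>. \<bar>U \<omega> - m\<bar>", simplified] eq[of "\<lambda>\<omega>. \<bar>U \<omega> - V \<omega>\<bar>", simplified]
    by (rule expectation_median_deviation_le[OF ind m, where K = 1]) (auto simp: indicator_def)
qed

lemma min_square_add: "min ((u + v)\<^sup>2) 1 \<le> 2 * min (u\<^sup>2) 1 + 2 * min (v\<^sup>2) 1" for u v :: real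
proof -
  have "(u + v)\<^sup>2 \<le> 2 * u\<^sup>2 + 2 * v\<^sup>2" using zero_le_power2[of "u - v"] by (simp add: power2_eq_square algebra_simps)
  then show ?thesis using zero_le_power2[of u] zero_le_power2[of v] unfolding min_def by (smt (verit))
qed

locale iid_sequence = prob_space M for M :: "'a measure" +
  fixes X :: "nat \<Rightarrow> 'a \<Rightarrow> real"
  assumes rv [measurable]: "\<And>i. i \<ge> 1 \<Longrightarrow> X i \<in> borel_measurable M"
    and indep: "indep_vars (\<lambda>_. borel) X {1..}"
    and ident: "\<And>i. i \<ge> 1 \<Longrightarrow> distr M borel (X i) = distr M borel (X 1)"
begin

definition S :: "nat \<Rightarrow> 'a \<Rightarrow> real" where "S n \<omega> = (\<Sum>i=1..n. X i \<omega>)"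
text \<open>The next block of the same sequence acts as the independent copy of \<open>S n\<close>,
  so the probability space need not be enlarged.\<close>

definition S' :: "nat \<Rightarrow> 'a \<Rightarrow> real" where "S' n \<omega> = (\<Sum>i=1..n. X (n + i) \<omega>)"
definition L :: "real measure" where "L = distr M borel (X 1)"
definition D :: "real measure" where "D = distr M borel (\<lambda>\<omega>. X 1 \<omega> - X 2 \<omega>)"

lemma S_measurable [measurable]: "S n \<in> borel_measurable M" "S' n \<in> borel_measurable M"
  unfolding S_def[abs_def] S'_def[abs_def] by measurable

lemma indep_pair:
  assumes "1 \<le> i" "1 \<le> j" "i \<noteq> j"
  shows "indep_var borel (X i) borel (X j)"
proof -
  have "indep_var borel ((\<lambda>f. f i) \<circ> (\<lambda>\<omega>. restrict (\<lambda>k. X k \<omega>) {i})) borel ((\<lambda>f. f j) \<circ> (\<lambda>\<omega>. restrict (\<lambda>k. X k \<omega>) {j}))"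
    using assms by (intro indep_var_compose[OF indep_var_restrict[OF indep]]) auto
  then show ?thesis by (simp add: comp_def)
qed

lemma difference_law:
  assumes "1 \<le> i" "1 \<le> j" "i \<noteq> j"
  shows "distr M borel (\<lambda>\<omega>. X i \<omega> - X j \<omega>) = D"
proof -
  have *: "distr M borel (\<lambda>\<omega>. X i \<omega> - X j \<omega>) = distr (L \<Otimes>\<^sub>M L) borel (\<lambda>(x, y). x - y)"
    if ij: "1 \<le> i" "1 \<le> j" "i \<noteq> j" for i j
  proof -
    have "L \<Otimes>\<^sub>M L = distr M (borel \<Otimes>\<^sub>M borel) (\<lambda>\<omega>. (X i \<omega>, X j \<omega>))"
      using indep_pair[OF ij] ident[OF ij(1)] ident[OF ij(2)]
      unfolding indep_var_distribution_eq by (simp add: L_def)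
    then have "distr (L \<Otimes>\<^sub>M L) borel (\<lambda>(x, y). x - y)
      = distr (distr M (borel \<Otimes>\<^sub>M borel) (\<lambda>\<omega>. (X i \<omega>, X j \<omega>))) borel (\<lambda>(x, y). x - y)" by simp
    also have "\<dots> = distr M borel ((\<lambda>(x, y). x - y) \<circ> (\<lambda>\<omega>. (X i \<omega>, X j \<omega>)))"
      by (rule distr_distr) (use ij in measurable)
    finally show ?thesis by (simp add: comp_def)
  qed
  show ?thesis using *[OF assms] *[of 1 2] by (simp add: D_def)
qed

lemma symmetrized:
  assumes n: "1 \<le> n"
  shows "iid_symmetric M (\<lambda>i \<omega>. X i \<omega> - X (n + i) \<omega>) {1..n} D"
proof
  show "{1..n} \<noteq> {}" using n by auto
  \<comment> \<open>The pairs \<open>{j, n + j}\<close> with \<open>j\<close> in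
    \<open>{1..n}\<close> are disjoint, so functions of different pairs are independent.\<close>
  have "indep_vars (\<lambda>j. PiM {j, n + j} (\<lambda>_. borel)) (\<lambda>j \<omega>. restrict (\<lambda>i. X i \<omega>) {j, n + j}) {1..n}"
    by (rule indep_vars_restrict[OF indep]) (auto simp: disjoint_family_on_def)
  then have "indep_vars (\<lambda>_. borel) (\<lambda>j \<omega>. (\<lambda>f. f j - f (n + j)) (restrict (\<lambda>i. X i \<omega>) {j, n + j})) {1..n}"
    by (rule indep_vars_compose2) measurable
  then show "indep_vars (\<lambda>_. borel) (\<lambda>i \<omega>. X i \<omega> - X (n + i) \<omega>) {1..n}" by simp
  show "distr M borel (\<lambda>\<omega>. X i \<omega> - X (n + i) \<omega>) = D" if "i \<in> {1..n}" for i
    using that by (intro difference_law) auto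
  have "distr D borel uminus = distr M borel (uminus \<circ> (\<lambda>\<omega>. X 1 \<omega> - X 2 \<omega>))"
    unfolding D_def by (rule distr_distr) measurable
  also have "\<dots> = distr M borel (\<lambda>\<omega>. X 2 \<omega> - X 1 \<omega>)" by (simp add: comp_def)
  finally show "distr D borel uminus = D" using difference_law[of 2 1] by simp
qed auto

lemma sum_difference: "(\<Sum>i=1..n. X i \<omega> - X (n + i) \<omega>) = S n \<omega> - S' n \<omega>"
  by (simp add: S_def S'_def sum_subtractf)

lemma indep_S: "indep_var borel (S n) borel (S' n)"
proof -
  have "indep_var borel ((\<lambda>f. \<Sum>i\<in>{1..n}. f i) \<circ> (\<lambda>\<omega>. restrict (\<lambda>k. X k \<omega>) {1..n}))
     borel ((\<lambda>f. \<Sum>i\<in>{1..n}. f (n + i)) \<circ> (\<lambda>\<omega>. restrict (\<lambda>k. X k \<omega>) {n + 1..n + n}))"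
    by (intro indep_var_compose[OF indep_var_restrict[OF indep]]) auto
  moreover have "(\<lambda>f. \<Sum>i\<in>{1..n}. f i) \<circ> (\<lambda>\<omega>. restrict (\<lambda>k. X k \<omega>) {1..n}) = S n"
    by (auto simp: S_def fun_eq_iff)
  moreover have "(\<lambda>f. \<Sum>i\<in>{1..n}. f (n + i)) \<circ> (\<lambda>\<omega>. restrict (\<lambda>k. X k \<omega>) {n + 1..n + n}) = S' n"
    by (auto simp: S'_def fun_eq_iff)
  ultimately show ?thesis by simp
qed

lemma S'_law: "distr M borel (S' n) = distr M borel (S n)"
proof (cases "n = 0")
  case True
  then show ?thesis by (simp add: S_def[abs_def] S'_def[abs_def])
next
  case False
  let ?P = "PiM {1..n} (\<lambda>_. borel :: real measure)"
  have ne: "{1..n} \<noteq> {}" using False by auto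
  have ind1: "indep_vars (\<lambda>_. borel) X {1..n}" by (rule indep_vars_subset[OF indep]) auto
  have "indep_vars (\<lambda>j. PiM {n + j} (\<lambda>_. borel)) (\<lambda>j \<omega>. restrict (\<lambda>i. X i \<omega>) {n + j}) {1..n}"
    by (rule indep_vars_restrict[OF indep]) (auto simp: disjoint_family_on_def)
  then have "indep_vars (\<lambda>_. borel) (\<lambda>j \<omega>. (\<lambda>f. f (n + j)) (restrict (\<lambda>i. X i \<omega>) {n + j})) {1..n}"
    by (rule indep_vars_compose2) measurable
  then have ind2: "indep_vars (\<lambda>_. borel) (\<lambda>i. X (n + i)) {1..n}" by simp
  have "distr M ?P (\<lambda>\<omega>. \<lambda>i\<in>{1..n}. X (n + i) \<omega>) = PiM {1..n} (\<lambda>i. distr M borel (X (n + i)))"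
    using ind2 by (subst (asm) indep_vars_iff_distr_eq_PiM'[OF ne]) auto
  also have "\<dots> = PiM {1..n} (\<lambda>i. distr M borel (X i))"
  proof (intro PiM_cong refl)
    fix i assume "i \<in> {1..n}"
    then show "distr M borel (X (n + i)) = distr M borel (X i)"
      using ident[of "n + i"] ident[of i] by simp
  qed
  also have "\<dots> = distr M ?P (\<lambda>\<omega>. \<lambda>i\<in>{1..n}. X i \<omega>)"
    using ind1 by (subst (asm) indep_vars_iff_distr_eq_PiM'[OF ne]) auto
  finally have eq: "distr M ?P (\<lambda>\<omega>. \<lambda>i\<in>{1..n}. X (n + i) \<omega>) = distr M ?P (\<lambda>\<omega>. \<lambda>i\<in>{1..n}. X i \<omega>)" .
  have "distr M borel (S' n) = distr (distr M ?P (\<lambda>\<omega>. \<lambda>i\<in>{1..n}. X (n + i) \<omega>)) borel (\<lambda>f. \<Sum>i\<in>{1..n}. f i)"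
    by (subst distr_distr) (auto simp: comp_def S'_def[abs_def] intro!: measurable_restrict)
  also have "\<dots> = distr M borel (S n)"
    unfolding eq by (subst distr_distr) (auto simp: comp_def S_def[abs_def] intro!: measurable_restrict)
  finally show ?thesis .
qed

lemma prob_S':
  assumes A[measurable]: "A \<in> sets borel"
  shows "prob {\<omega> \<in> space M. S' n \<omega> \<in> A} = prob {\<omega> \<in> space M. S n \<omega> \<in> A}"
  using measure_distr[OF S_measurable(1) A, of n] measure_distr[OF S_measurable(2) A, of n] S'_law[of n]
  by (simp add: vimage_def Int_def conj_commute)

lemma median_S': "is_median M (S n) m \<Longrightarrow> is_median M (S' n) m"
  using prob_S'[of "{m..}" n] prob_S'[of "{..m}" n] by (simp add: is_median_def)

lemma prob_X:
  assumes "i \<ge> 1" and A[measurable]: "A \<in> sets borel"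
  shows "prob {\<omega> \<in> space M. X i \<omega> \<in> A} = measure L A"
  using measure_distr[OF rv[OF assms(1)] A] ident[OF assms(1)]
  by (simp add: L_def vimage_def Int_def conj_commute)

lemma median_X: "i \<ge> 1 \<Longrightarrow> is_median M (X 1) m \<Longrightarrow> is_median M (X i) m"
  using prob_X[of i "{m..}"] prob_X[of i "{..m}"] prob_X[of 1 "{m..}"] prob_X[of 1 "{..m}"] by (simp add: is_median_def)

sublocale L: real_law L
  by (rule real_law.intro) (auto simp: L_def real_law_axioms_def intro!: prob_space_distr)

sublocale D: real_law D
  by (rule real_law.intro) (auto simp: D_def real_law_axioms_def intro!: prob_space_distr)

lemma tail_prob_L: "tail_prob L t = prob {\<omega> \<in> space M. t \<le> \<bar>X 1 \<omega>\<bar>}"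
  using prob_X[of 1 "{y. t \<le> \<bar>y\<bar>}"] by (simp add: tail_prob_def)

lemma tail_prob_D: "tail_prob D t = prob {\<omega> \<in> space M. t \<le> \<bar>X 1 \<omega> - X 2 \<omega>\<bar>}"
  unfolding tail_prob_def D_def by (subst measure_distr) (auto intro!: arg_cong[where f=prob])

lemma tail_prob_D_le: "tail_prob D (2 * t) \<le> 2 * tail_prob L t"
proof -
  have "tail_prob D (2 * t) \<le> prob ({\<omega> \<in> space M. X 1 \<omega> \<in> {y. t \<le> \<bar>y\<bar>}} \<union> {\<omega> \<in> space M. X 2 \<omega> \<in> {y. t \<le> \<bar>y\<bar>}})"
    unfolding tail_prob_D by (rule finite_measure_mono) auto
  also have "\<dots> \<le> prob {\<omega> \<in> space M. X 1 \<omega> \<in> {y. t \<le> \<bar>y\<bar>}} + prob {\<omega> \<in> space M. X 2 \<omega> \<in> {y. t \<le> \<bar>y\<bar>}}"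
    by (rule measure_Un_le) measurable
  also have "\<dots> = 2 * tail_prob L t"
    using prob_X[of 1 "{y. t \<le> \<bar>y\<bar>}"] prob_X[of 2 "{y. t \<le> \<bar>y\<bar>}"] by (simp add: tail_prob_def)
  finally show ?thesis .
qed

lemma quad_L: "i \<ge> 1 \<Longrightarrow> quad L t = expectation (\<lambda>\<omega>. min ((X i \<omega> / t)\<^sup>2) 1)"
  unfolding quad_def L_def using ident[of i, symmetric] by (simp add: integral_distr)

lemma quad_D: "quad D t = expectation (\<lambda>\<omega>. min (((X 1 \<omega> - X 2 \<omega>) / t)\<^sup>2) 1)"
  unfolding quad_def D_def by (simp add: integral_distr)

lemma quad_X_integrable: "i \<ge> 1 \<Longrightarrow> integrable M (\<lambda>\<omega>. min (((X i \<omega> - m) / t)\<^sup>2) 1)"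
  by (rule integrable_const_bound[where B = 1]) auto

lemma quad_D_le: "quad D t \<le> 4 * quad L t"
proof -
  have "quad D t \<le> expectation (\<lambda>\<omega>. 2 * min ((X 1 \<omega> / t)\<^sup>2) 1 + 2 * min ((X 2 \<omega> / t)\<^sup>2) 1)"
    unfolding quad_D
  proof (rule integral_mono)
    show "integrable M (\<lambda>\<omega>. min (((X 1 \<omega> - X 2 \<omega>) / t)\<^sup>2) 1)"
      by (rule integrable_const_bound[where B = 1]) auto
    fix \<omega> show "min (((X 1 \<omega> - X 2 \<omega>) / t)\<^sup>2) 1 \<le> 2 * min ((X 1 \<omega> / t)\<^sup>2) 1 + 2 * min ((X 2 \<omega> / t)\<^sup>2) 1"
      using min_square_add[of "X 1 \<omega> / t" "- (X 2 \<omega> / t)"] by (simp add: diff_divide_distrib)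
  qed (use quad_X_integrable[of 1 0 t] quad_X_integrable[of 2 0 t] in auto)
  also have "\<dots> = 4 * quad L t"
    using quad_X_integrable[of 1 0 t] quad_X_integrable[of 2 0 t] quad_L[of 1 t] quad_L[of 2 t] by simp
  finally show ?thesis .
qed

text \<open>Write \<open>X 1 = (X 1 - m) + m\<close> and apply the median inequality to the capped
  square, which is monotone on the nonnegative reals. The remaining square of \<open>m / t\<close>
  is treated in \<open>tau_summable_median_term\<close>.\<close>

lemma quad_L_le:
  assumes m: "is_median M (X 1) m" and t: "0 < t"
  shows "quad L t \<le> 4 * quad D t + 2 * (m / t)\<^sup>2"
proof -
  have "quad L t \<le> expectation (\<lambda>\<omega>. 2 * min (((X 1 \<omega> - m) / t)\<^sup>2) 1 + 2 * (m / t)\<^sup>2)"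
    unfolding quad_L[OF order_refl]
  proof (rule integral_mono)
    fix \<omega> show "min ((X 1 \<omega> / t)\<^sup>2) 1 \<le> 2 * min (((X 1 \<omega> - m) / t)\<^sup>2) 1 + 2 * (m / t)\<^sup>2"
      using min_square_add[of "(X 1 \<omega> - m) / t" "m / t"] by (simp add: diff_divide_distrib)
  qed (use quad_X_integrable[of 1 0 t] quad_X_integrable[of 1 m t] in auto)
  also have "\<dots> = 2 * expectation (\<lambda>\<omega>. min (((X 1 \<omega> - m) / t)\<^sup>2) 1) + 2 * (m / t)\<^sup>2"
    using quad_X_integrable[of 1 m t] prob_space by simp
  also have "expectation (\<lambda>\<omega>. min (((X 1 \<omega> - m) / t)\<^sup>2) 1) = expectation (\<lambda>\<omega>. min ((\<bar>X 1 \<omega> - m\<bar> / t)\<^sup>2) 1)"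
    by (simp add: power_divide)
  also have "\<dots> \<le> 2 * expectation (\<lambda>\<omega>. min ((\<bar>X 1 \<omega> - X 2 \<omega>\<bar> / t)\<^sup>2) 1)"
  proof (rule expectation_median_deviation_le[where K = 1 and V = "X 2"])
    show "indep_var borel (X 1) borel (X 2)" by (rule indep_pair) auto
    show "is_median M (X 2) m" by (rule median_X[OF _ m]) simp
    fix y z :: real assume "0 \<le> y" "y \<le> z"
    then have "(y / t)\<^sup>2 \<le> (z / t)\<^sup>2" using t by (intro power_mono divide_right_mono) auto
    then show "min ((y / t)\<^sup>2) 1 \<le> min ((z / t)\<^sup>2) 1" by auto
  qed auto
  also have "expectation (\<lambda>\<omega>. min ((\<bar>X 1 \<omega> - X 2 \<omega>\<bar> / t)\<^sup>2) 1) = quad D t"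
    unfolding quad_D by (simp add: power_divide)
  finally show ?thesis by simp
qed

lemma prob_X_median_le:
  assumes m: "is_median M (X 1) m" and t: "0 < t"
  shows "prob {\<omega> \<in> space M. t \<le> \<bar>X 1 \<omega> - m\<bar>} \<le> 2 * tail_prob D t"
  unfolding tail_prob_D by (rule prob_median_deviation_le[OF indep_pair median_X[OF _ m] t]) auto

lemma prob_S_median_le:
  assumes m: "is_median M (S n) m" and t: "0 < t"
  shows "prob {\<omega> \<in> space M. t \<le> \<bar>S n \<omega> - m\<bar>} \<le> 2 * prob {\<omega> \<in> space M. t \<le> \<bar>S n \<omega> - S' n \<omega>\<bar>}"
  by (rule prob_median_deviation_le[OF indep_S median_S'[OF m] t])

lemma prob_S_diff_le:
  "prob {\<omega> \<in> space M. 2 * t \<le> \<bar>S n \<omega> - S' n \<omega>\<bar>} \<le> 2 * prob {\<omega> \<in> space M. t \<le> \<bar>S n \<omega>\<bar>}"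
proof -
  have "prob {\<omega> \<in> space M. 2 * t \<le> \<bar>S n \<omega> - S' n \<omega>\<bar>}
     \<le> prob ({\<omega> \<in> space M. S n \<omega> \<in> {y. t \<le> \<bar>y\<bar>}} \<union> {\<omega> \<in> space M. S' n \<omega> \<in> {y. t \<le> \<bar>y\<bar>}})"
    by (rule finite_measure_mono) auto
  also have "\<dots> \<le> prob {\<omega> \<in> space M. S n \<omega> \<in> {y. t \<le> \<bar>y\<bar>}} + prob {\<omega> \<in> space M. S' n \<omega> \<in> {y. t \<le> \<bar>y\<bar>}}"
    by (rule measure_Un_le) measurable
  also have "\<dots> = 2 * prob {\<omega> \<in> space M. t \<le> \<bar>S n \<omega>\<bar>}"
    using prob_S'[of "{y. t \<le> \<bar>y\<bar>}" n] by simp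
  finally show ?thesis .
qed

end

subsection \<open>The series\<close>

text \<open>The convention assigns the least possible value 0 at \<open>z = 0\<close>, so
  monotonicity extends to that point.\<close>

lemma exp_neg_div_mono:
  assumes "0 \<le> c'" "c' \<le> c" "0 \<le> z" "z \<le> w"
  shows "exp_neg_div c z \<le> exp_neg_div c' w"
proof (cases "z = 0")
  case False
  then have "c' / w \<le> c / z" using assms by (intro frac_le) auto
  then show ?thesis using False assms by (auto simp: exp_neg_div_def)
qed (simp add: exp_neg_div_nonneg, simp add: exp_neg_div_def)

lemma exp_neg_div_scale: "k > 0 \<Longrightarrow> exp_neg_div (k * c) (k * z) = exp_neg_div c z"
  by (simp add: exp_neg_div_def)

text \<open>Since \<open>z + w \<le> 2 * max z w\<close>, the larger summand alone suffices after
  halving \<open>c\<close>.\<close>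

lemma exp_neg_div_add:
  assumes "0 \<le> c" "0 \<le> z" "0 \<le> w"
  shows "exp_neg_div c (z + w) \<le> exp_neg_div (c / 2) z + exp_neg_div (c / 2) w"
proof -
  have *: "exp_neg_div c (z + w) \<le> exp_neg_div (c / 2) (max z w)"
  proof -
    have "exp_neg_div c (z + w) \<le> exp_neg_div (2 * (c / 2)) (2 * max z w)"
      using assms by (intro exp_neg_div_mono) auto
    then show ?thesis by (simp only: exp_neg_div_scale zero_less_numeral)
  qed
  then show ?thesis using exp_neg_div_nonneg[of "c / 2" z] exp_neg_div_nonneg[of "c / 2" w]
    by (auto simp: max_def split: if_splits)
qed

text \<open>From \<open>u \<le> exp u\<close> with \<open>u = c / z\<close>. It turns a Gaussian
  term in \<open>n * tail_prob\<close> into a term controlled by condition (ii).\<close>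

lemma exp_neg_div_le:
  assumes "0 < c" "0 \<le> z"
  shows "exp_neg_div c z \<le> z / c"
proof (cases "z = 0")
  case False
  then have z: "z > 0" using assms by simp
  have "c / z \<le> exp (c / z)" using exp_ge_add_one_self[of "c / z"] by linarith
  then have "inverse (exp (c / z)) \<le> inverse (c / z)" using assms z by (intro le_imp_inverse_le) auto
  then show ?thesis using z by (simp add: exp_neg_div_def exp_minus)
qed (simp add: exp_neg_div_def)

text \<open>Tangent bound \<open>ln v \<le> v - 1\<close> at \<open>v = u / p\<close>; used whenever
  an exponential has to be dominated by a negative power.\<close>

lemma powr_le_exp:
  fixes u p :: real
  assumes "0 < u" "0 < p"
  shows "u powr p \<le> p powr p * exp u"
proof -
  have "ln (u / p) \<le> u / p - 1" using assms by (intro ln_le_minus_one) auto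
  then have "p * ln (u / p) \<le> p * (u / p - 1)" using assms by (intro mult_left_mono) auto
  then have "p * ln u \<le> p * ln p + u" using assms by (simp add: ln_div algebra_simps)
  then have "exp (p * ln u) \<le> exp (p * ln p + u)" by simp
  then show ?thesis using assms by (simp add: powr_def exp_add)
qed

section \<open>Conditions (ii) and (iii) in scale-stable form, and the third-moment series\<close>

context weighted_scale
begin

definition tail_cond :: "real measure \<Rightarrow> bool" where
  "tail_cond Q \<longleftrightarrow> (\<forall>\<epsilon>>0. tau_summable (\<lambda>n. real n * tail_prob Q (\<epsilon> * a n)))"

text \<open>A form of condition (iii) that is stable under changes of scale and under symmetrization:
  the truncated second moment is replaced by the expectation of \<open>min (X\<^sup>2 / a\<^sub>n\<^sup>2) 1\<close>.\<close>

definition gauss_cond :: "real measure \<Rightarrow> bool" where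
  "gauss_cond Q \<longleftrightarrow> (\<forall>c>0. tau_summable (\<lambda>n. exp_neg_div c (real n * quad Q (a n))))"

lemma tau_summable_le:
  assumes "tau_summable g" "\<And>n. n \<ge> 1 \<Longrightarrow> 0 \<le> f n" "\<And>n. n \<ge> 1 \<Longrightarrow> f n \<le> g n"
  shows "tau_summable f"
  by (rule tau_summable_mono[OF assms(1,2)]) (use assms(3) in \<open>auto simp: eventually_sequentially\<close>)

lemma gauss_condI:
  assumes Q: "real_law Q" and tail: "tail_cond Q"
    and G: "\<And>\<epsilon>. \<epsilon> > 0 \<Longrightarrow> tau_summable (\<lambda>n. exp_neg_div (\<epsilon>\<^sup>2 * (a n)\<^sup>2) (real n * trunc_moment 2 Q (\<epsilon> * a n)))"
  shows "gauss_cond Q"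
  unfolding gauss_cond_def
proof (intro allI impI)
  interpret real_law Q by (rule Q)
  fix c :: real assume c: "c > 0"
  \<comment> \<open>Splitting off the tail probability halves the constant in the exponent, so (iii)
    is used at the level with \<open>\<delta>\<^sup>2 = c / 2\<close>.\<close>
  define \<delta> where "\<delta> = sqrt (c / 2)"
  have \<delta>: "\<delta> > 0" "\<delta>\<^sup>2 = c / 2" using c by (auto simp: \<delta>_def)
  show "tau_summable (\<lambda>n. exp_neg_div c (real n * quad Q (a n)))"
  proof (rule tau_summable_le[OF tau_summable_add])
    show "tau_summable (\<lambda>n. exp_neg_div (\<delta>\<^sup>2 * (a n)\<^sup>2) (real n * trunc_moment 2 Q (\<delta> * a n)))"
      by (rule G[OF \<delta>(1)])
    show "tau_summable (\<lambda>n. (2 / c) * (real n * tail_prob Q (\<delta> * a n)))"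
      using tail \<delta>(1) unfolding tail_cond_def by (intro tau_summable_cmult) auto
    fix n :: nat assume n: "n \<ge> 1"
    let ?T = "trunc_moment 2 Q (\<delta> * a n)" and ?p = "tail_prob Q (\<delta> * a n)"
    have an: "a n > 0" using a_pos n by auto
    have "quad Q (a n) \<le> ?T / (a n)\<^sup>2 + ?p" using an \<delta> by (intro quad_le_trunc_moment) auto
    then have "real n * quad Q (a n) \<le> real n * (?T / (a n)\<^sup>2 + ?p)" by (intro mult_left_mono) auto
    then have "exp_neg_div c (real n * quad Q (a n)) \<le> exp_neg_div c (real n * ?T / (a n)\<^sup>2 + real n * ?p)"
      using c quad_nonneg by (intro exp_neg_div_mono) (auto simp: algebra_simps)
    also have "\<dots> \<le> exp_neg_div (c / 2) (real n * ?T / (a n)\<^sup>2) + exp_neg_div (c / 2) (real n * ?p)"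
      using c trunc_moment_nonneg tail_prob_bounds by (intro exp_neg_div_add) auto
    also have "exp_neg_div (c / 2) (real n * ?T / (a n)\<^sup>2) = exp_neg_div ((a n)\<^sup>2 * (c / 2)) ((a n)\<^sup>2 * (real n * ?T / (a n)\<^sup>2))"
      using an by (subst exp_neg_div_scale) auto
    also have "\<dots> = exp_neg_div (\<delta>\<^sup>2 * (a n)\<^sup>2) (real n * ?T)"
      unfolding \<delta>(2) using an by (simp add: mult_ac)
    also have "exp_neg_div (c / 2) (real n * ?p) \<le> real n * ?p / (c / 2)"
      using c tail_prob_bounds by (intro exp_neg_div_le) auto
    finally show "exp_neg_div c (real n * quad Q (a n)) \<le> exp_neg_div (\<delta>\<^sup>2 * (a n)\<^sup>2) (real n * ?T) + (2 / c) * (real n * ?p)"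
      by (simp add: mult_ac)
  qed (rule exp_neg_div_nonneg)
qed

text \<open>Changing the truncation level from \<open>a n\<close> to \<open>\<epsilon> * a n\<close>
  costs the factor \<open>K\<close>, absorbed because \<open>gauss_cond\<close> quantifies over all
  constants \<open>c\<close>.\<close>

lemma gauss_condD:
  assumes Q: "real_law Q" and G: "gauss_cond Q" and \<epsilon>: "\<epsilon> > 0"
  shows "tau_summable (\<lambda>n. exp_neg_div (\<epsilon>\<^sup>2 * (a n)\<^sup>2) (real n * trunc_moment 2 Q (\<epsilon> * a n)))"
proof -
  interpret real_law Q by (rule Q)
  define K where "K = max 1 (\<epsilon>\<^sup>2)"
  have K: "K > 0" by (simp add: K_def)
  show ?thesis
  proof (rule tau_summable_le)
    show "tau_summable (\<lambda>n. exp_neg_div (\<epsilon>\<^sup>2 / K) (real n * quad Q (a n)))"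
      using G K \<epsilon> unfolding gauss_cond_def by auto
    fix n :: nat assume n: "n \<ge> 1"
    have an: "a n > 0" using a_pos n by auto
    have "trunc_moment 2 Q (\<epsilon> * a n) / (a n)\<^sup>2 \<le> K * quad Q (a n)"
      using trunc_moment_le_quad[of "a n" "\<epsilon> * a n"] an \<epsilon> by (simp add: K_def)
    then have "trunc_moment 2 Q (\<epsilon> * a n) \<le> (a n)\<^sup>2 * K * quad Q (a n)"
      using an by (simp add: field_simps)
    then have "real n * trunc_moment 2 Q (\<epsilon> * a n) \<le> real n * ((a n)\<^sup>2 * K * quad Q (a n))"
      by (intro mult_left_mono) auto
    then have "exp_neg_div (\<epsilon>\<^sup>2 * (a n)\<^sup>2) (real n * trunc_moment 2 Q (\<epsilon> * a n))
      \<le> exp_neg_div (((a n)\<^sup>2 * K) * (\<epsilon>\<^sup>2 / K)) (((a n)\<^sup>2 * K) * (real n * quad Q (a n)))"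
      using K trunc_moment_nonneg by (intro exp_neg_div_mono) (auto simp: mult_ac)
    also have "\<dots> = exp_neg_div (\<epsilon>\<^sup>2 / K) (real n * quad Q (a n))"
      using an K by (intro exp_neg_div_scale) auto
    finally show "exp_neg_div (\<epsilon>\<^sup>2 * (a n)\<^sup>2) (real n * trunc_moment 2 Q (\<epsilon> * a n)) \<le> exp_neg_div (\<epsilon>\<^sup>2 / K) (real n * quad Q (a n))" .
  qed (rule exp_neg_div_nonneg)
qed

lemma tail_cond_third_moment:
  assumes Q: "real_law Q" and tail: "tail_cond Q"
  shows "tau_summable (\<lambda>n. (real n * trunc_moment 3 Q (a n) / a n ^ 3) powr \<theta>)"
proof -
  interpret real_law Q by (rule Q)
  \<comment> \<open>The value 1 stands for the tail at level 0, so that \<open>F 0 - F 1\<close> is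
    the mass of \<open>|y| < a 1\<close>; \<open>a 0\<close> is unconstrained.\<close>
  define F where "F n = (if n = 0 then 1 else tail_prob Q (a n))" for n
  define G where "G n = (\<Sum>j=1..n. a j ^ 3 * (F (j - 1) - F j))" for n
  have "tau_summable (\<lambda>n. real n * tail_prob Q (1 * a n))"
    using tail unfolding tail_cond_def by (auto dest: spec[of _ 1])
  then have "tau_summable (\<lambda>n. real n * F n)" by (simp add: F_def tau_summable_def)
  moreover have "F (Suc n) \<le> F n" for n
    using a_mono[of n] tail_prob_bounds tail_prob_antimono by (auto simp: F_def)
  moreover have "0 \<le> F n" for n using tail_prob_bounds by (simp add: F_def)
  ultimately have sum: "tau_summable (\<lambda>n. (real n * G n / a n ^ 3) powr \<theta>)"
    by (intro tau_summable_third_moment[of F]) (auto simp: G_def)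
  have le: "trunc_moment 3 Q (a n) \<le> G n" if "n \<ge> 1" for n
    using that
  proof (induction n rule: dec_induct)
    case base
    show ?case using trunc_moment_3_le[of "a 1"] a_pos[of 1] by (simp add: G_def F_def)
  next
    case (step n)
    have "trunc_moment 3 Q (a (Suc n)) \<le> trunc_moment 3 Q (a n) + a (Suc n) ^ 3 * (tail_prob Q (a n) - tail_prob Q (a (Suc n)))"
      using step a_pos[of n] a_mono[of n] by (intro trunc_moment_3_diff) auto
    then show ?case using step by (simp add: G_def F_def)
  qed
  show ?thesis
  proof (rule tau_summable_le[OF sum])
    fix n :: nat assume n: "n \<ge> 1"
    have an: "a n > 0" using a_pos n by auto
    have "real n * trunc_moment 3 Q (a n) / a n ^ 3 \<le> real n * G n / a n ^ 3"
      using le[OF n] an by (intro divide_right_mono mult_left_mono) auto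
    then show "(real n * trunc_moment 3 Q (a n) / a n ^ 3) powr \<theta> \<le> (real n * G n / a n ^ 3) powr \<theta>"
      using theta an trunc_moment_nonneg by (intro powr_mono2) (auto intro!: divide_nonneg_nonneg)
  qed simp
qed

end

context iid_sequence
begin

lemma symmetrized_upper:
  assumes n: "1 \<le> n" and x: "0 < x" and \<theta>: "1 \<le> \<theta>"
  shows "prob {\<omega> \<in> space M. x \<le> \<bar>S n \<omega> - S' n \<omega>\<bar>}
    \<le> real n * tail_prob D (x / (8 * \<theta>)) + 2 * exp_neg_div (x\<^sup>2 / 4) (real n * trunc_moment 2 D (x / (8 * \<theta>)))
      + 2 * (256 / 3 * \<theta>\<^sup>2 * (real n * trunc_moment 3 D (x / (8 * \<theta>))) / x ^ 3) powr \<theta>"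
  using iid_symmetric.tail_sum_upper[OF symmetrized[OF n] x \<theta>] by (simp add: sum_difference[unfolded One_nat_def])

lemma symmetrized_lower:
  assumes n: "1 \<le> n" and x: "0 < x" and b: "0 < b"
    and V: "0 < real n * trunc_moment 2 D b" "real n * trunc_moment 2 D b \<le> x\<^sup>2"
  shows "exp (- 1024 * x\<^sup>2 / (real n * trunc_moment 2 D b)) / 8 \<le> prob {\<omega> \<in> space M. x \<le> \<bar>S n \<omega> - S' n \<omega>\<bar>}
     \<or> (real n * trunc_moment 2 D b / x\<^sup>2)\<^sup>2 / 64 \<le> real n * trunc_moment 3 D b / x ^ 3"
  using iid_symmetric.tail_sum_lower[OF symmetrized[OF n] x b] V by (simp add: sum_difference[unfolded One_nat_def])

lemma symmetrized_min_tail: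
  assumes n: "1 \<le> n"
  shows "min (real n * tail_prob D t) 1 \<le> 4 * prob {\<omega> \<in> space M. t \<le> \<bar>S n \<omega> - S' n \<omega>\<bar>}"
  using iid_symmetric.min_tail_le[OF symmetrized[OF n], of t]
  by (simp add: sum_difference[unfolded One_nat_def] tail_prob_def)

end

section \<open>The series for the symmetrized sums\<close>

locale tail_series = weighted_scale \<tau> a \<theta> C N + iid_sequence M X
  for \<tau> a :: "nat \<Rightarrow> real" and \<theta> C N :: real and M :: "'a measure" and X :: "nat \<Rightarrow> 'a \<Rightarrow> real"
begin

lemma symmetrized_series:
  assumes tail: "tail_cond D" and G: "gauss_cond D" and \<epsilon>: "0 < \<epsilon>"
  shows "tau_summable (\<lambda>n. prob {\<omega> \<in> space M. \<epsilon> * a n \<le> \<bar>S n \<omega> - S' n \<omega>\<bar>})"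
proof -
  \<comment> \<open>With \<open>e \<le> 1\<close> the truncation level
    \<open>e * a n / (8 * \<theta>)\<close> stays below \<open>a n\<close>, so its moments are
    bounded by quantities at \<open>a n\<close> that do not depend on \<open>e\<close>.\<close>
  define e where "e = min \<epsilon> 1"
  have e: "0 < e" "e \<le> \<epsilon>" "e \<le> 1" using \<epsilon> by (auto simp: e_def)
  define K where "K = (256 / 3 * \<theta>\<^sup>2 / e ^ 3) powr \<theta>"
  have t3: "tau_summable (\<lambda>n. 2 * K * (real n * trunc_moment 3 D (a n) / a n ^ 3) powr \<theta>)"
    by (rule tau_summable_cmult[OF tail_cond_third_moment[OF D.real_law_axioms tail]])
  have t2: "tau_summable (\<lambda>n. 2 * exp_neg_div (e\<^sup>2 / 4) (real n * quad D (a n)))"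
    using G e unfolding gauss_cond_def by (intro tau_summable_cmult) auto
  have t1: "tau_summable (\<lambda>n. real n * tail_prob D (e / (8 * \<theta>) * a n))"
    using tail[unfolded tail_cond_def, rule_format, of "e / (8 * \<theta>)"] e theta by simp
  show ?thesis
  proof (rule tau_summable_le[OF tau_summable_add[OF tau_summable_add[OF t1 t2] t3]])
    fix n :: nat assume n: "n \<ge> 1"
    have an: "a n > 0" using a_pos n by auto
    define b where "b = e * a n / (8 * \<theta>)"
    have b: "0 < b" "b \<le> a n"
    proof -
      show "0 < b" using e an theta by (simp add: b_def)
      have "e * a n \<le> 1 * a n" using e an by (intro mult_right_mono) auto
      also have "\<dots> \<le> 8 * \<theta> * a n" using theta an by (intro mult_right_mono) auto
      finally show "b \<le> a n" using theta by (simp add: b_def field_simps)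
    qed
    have "prob {\<omega> \<in> space M. \<epsilon> * a n \<le> \<bar>S n \<omega> - S' n \<omega>\<bar>} \<le> prob {\<omega> \<in> space M. e * a n \<le> \<bar>S n \<omega> - S' n \<omega>\<bar>}"
    proof (rule finite_measure_mono)
      have "e * a n \<le> \<epsilon> * a n" using e an by (intro mult_right_mono) auto
      then show "{\<omega> \<in> space M. \<epsilon> * a n \<le> \<bar>S n \<omega> - S' n \<omega>\<bar>} \<subseteq> {\<omega> \<in> space M. e * a n \<le> \<bar>S n \<omega> - S' n \<omega>\<bar>}"
        by auto
    qed measurable
    also have "\<dots> \<le> real n * tail_prob D b + 2 * exp_neg_div ((e * a n)\<^sup>2 / 4) (real n * trunc_moment 2 D b)
      + 2 * (256 / 3 * \<theta>\<^sup>2 * (real n * trunc_moment 3 D b) / (e * a n) ^ 3) powr \<theta>"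
      unfolding b_def using e an theta by (intro symmetrized_upper n) auto
    also have "exp_neg_div ((e * a n)\<^sup>2 / 4) (real n * trunc_moment 2 D b) \<le> exp_neg_div (e\<^sup>2 / 4) (real n * quad D (a n))"
    proof -
      have "max 1 ((b / a n)\<^sup>2) = 1" using b an by (intro max_absorb1) (simp add: power_le_one)
      then have "trunc_moment 2 D b / (a n)\<^sup>2 \<le> quad D (a n)"
        using D.trunc_moment_le_quad[of "a n" b] b an by simp
      then have "trunc_moment 2 D b \<le> (a n)\<^sup>2 * quad D (a n)" using an by (simp add: field_simps)
      then have "real n * trunc_moment 2 D b \<le> real n * ((a n)\<^sup>2 * quad D (a n))" by (intro mult_left_mono) auto
      then have "exp_neg_div ((e * a n)\<^sup>2 / 4) (real n * trunc_moment 2 D b)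
        \<le> exp_neg_div ((a n)\<^sup>2 * (e\<^sup>2 / 4)) ((a n)\<^sup>2 * (real n * quad D (a n)))"
        using trunc_moment_nonneg by (intro exp_neg_div_mono) (auto simp: power_mult_distrib mult_ac)
      also have "\<dots> = exp_neg_div (e\<^sup>2 / 4) (real n * quad D (a n))"
        using an by (intro exp_neg_div_scale) auto
      finally show ?thesis .
    qed
    also have "(256 / 3 * \<theta>\<^sup>2 * (real n * trunc_moment 3 D b) / (e * a n) ^ 3) powr \<theta>
       \<le> K * (real n * trunc_moment 3 D (a n) / a n ^ 3) powr \<theta>"
    proof -
      have "256 / 3 * \<theta>\<^sup>2 * (real n * trunc_moment 3 D b) / (e * a n) ^ 3
         \<le> 256 / 3 * \<theta>\<^sup>2 * (real n * trunc_moment 3 D (a n)) / (e * a n) ^ 3"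
        using D.trunc_moment_mono[OF b, of 3] e an by (intro divide_right_mono mult_left_mono) auto
      also have "\<dots> = (256 / 3 * \<theta>\<^sup>2 / e ^ 3) * (real n * trunc_moment 3 D (a n) / a n ^ 3)"
        by (simp add: power_mult_distrib)
      finally have "(256 / 3 * \<theta>\<^sup>2 * (real n * trunc_moment 3 D b) / (e * a n) ^ 3) powr \<theta>
         \<le> ((256 / 3 * \<theta>\<^sup>2 / e ^ 3) * (real n * trunc_moment 3 D (a n) / a n ^ 3)) powr \<theta>"
        using theta e an trunc_moment_nonneg[of 3 D b] by (intro powr_mono2) (auto intro!: divide_nonneg_nonneg mult_nonneg_nonneg)
      also have "\<dots> = K * (real n * trunc_moment 3 D (a n) / a n ^ 3) powr \<theta>"
        unfolding K_def by (rule powr_mult)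
      finally show ?thesis .
    qed
    finally show "prob {\<omega> \<in> space M. \<epsilon> * a n \<le> \<bar>S n \<omega> - S' n \<omega>\<bar>}
      \<le> real n * tail_prob D (e / (8 * \<theta>) * a n) + 2 * exp_neg_div (e\<^sup>2 / 4) (real n * quad D (a n)) +
        2 * K * (real n * trunc_moment 3 D (a n) / a n ^ 3) powr \<theta>"
      by (simp add: b_def)
  qed simp
qed

text \<open>The two alternatives of \<open>symmetrized_lower\<close> are summed separately: the
  first against the assumed series, the second against the third-moment series. Passing from the
  truncated second moment to \<open>quad\<close> adds a tail term.\<close>

lemma gauss_cond_D:
  assumes tail: "tail_cond D"
    and P: "\<And>\<epsilon>. 0 < \<epsilon> \<Longrightarrow> tau_summable (\<lambda>n. prob {\<omega> \<in> space M. \<epsilon> * a n \<le> \<bar>S n \<omega> - S' n \<omega>\<bar>})"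
  shows "gauss_cond D"
  unfolding gauss_cond_def
proof (intro allI impI)
  fix c :: real assume c: "c > 0"
  define \<epsilon> where "\<epsilon> = sqrt (c / 2048)"
  have \<epsilon>: "\<epsilon> > 0" "c / 2 = 1024 * \<epsilon>\<^sup>2" using c by (auto simp: \<epsilon>_def)
  define K1 where "K1 = 8 * exp (1024 :: real)"
  define K0 where "K0 = exp 1 * (2 * \<theta>) powr (2 * \<theta>)"
  define K2 where "K2 = K0 * (64 / \<epsilon> ^ 3) powr \<theta>"
  let ?P = "\<lambda>n x. prob {\<omega> \<in> space M. x \<le> \<bar>S n \<omega> - S' n \<omega>\<bar>}"
  let ?R = "\<lambda>n. (real n * trunc_moment 3 D (a n) / a n ^ 3) powr \<theta>"
  have K0: "K0 \<ge> 0" by (simp add: K0_def)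
  have K2: "K2 \<ge> 0" using K0 by (simp add: K2_def)
  show "tau_summable (\<lambda>n. exp_neg_div c (real n * quad D (a n)))"
  proof (rule tau_summable_le[OF tau_summable_add[OF tau_summable_add]])
    show "tau_summable (\<lambda>n. K1 * ?P n (\<epsilon> * a n))" by (rule tau_summable_cmult[OF P[OF \<epsilon>(1)]])
    show "tau_summable (\<lambda>n. K2 * ?R n)"
      by (rule tau_summable_cmult[OF tail_cond_third_moment[OF D.real_law_axioms tail]])
    show "tau_summable (\<lambda>n. (2 / c) * (real n * tail_prob D (1 * a n)))"
      using tail unfolding tail_cond_def by (intro tau_summable_cmult) (metis zero_less_one)
    fix n :: nat assume n: "n \<ge> 1"
    have an: "a n > 0" using a_pos n by auto
    define V where "V = real n * trunc_moment 2 D (a n)"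
    have V0: "0 \<le> V" using trunc_moment_nonneg by (simp add: V_def)
    have main: "exp_neg_div (c / 2) (V / (a n)\<^sup>2) \<le> K1 * ?P n (\<epsilon> * a n) + K2 * ?R n"
    proof (cases "V = 0")
      case True
      then show ?thesis using K2 by (simp add: exp_neg_div_def K1_def)
    next
      case False
      then have V: "V > 0" using V0 by simp
      \<comment> \<open>The lower bound requires \<open>V \<le> x\<^sup>2\<close>, so the level is
        raised to \<open>sqrt V\<close> when the variance is too large.\<close>
      define x where "x = max (\<epsilon> * a n) (sqrt V)"
      have x: "x > 0" "\<epsilon> * a n \<le> x" using \<epsilon> an by (auto simp: x_def less_max_iff_disj)
      have Vx: "V \<le> x\<^sup>2"
      proof -
        have "(sqrt V)\<^sup>2 \<le> x\<^sup>2" using V by (intro power_mono) (auto simp: x_def)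
        then show ?thesis using V by simp
      qed
      define u where "u = x\<^sup>2 / V"
      have u: "u \<ge> 1" using Vx V by (simp add: u_def)
      \<comment> \<open>Where \<open>x\<close> was raised, \<open>u = 1\<close> and the right side
        is 1; the factor \<open>exp 1024\<close> is what makes both cases fit one formula.\<close>
      have eu: "exp_neg_div (c / 2) (V / (a n)\<^sup>2) \<le> exp (1024 - 1024 * u)"
      proof (cases "sqrt V \<le> \<epsilon> * a n")
        case True
        then have "x = \<epsilon> * a n" by (simp add: x_def)
        then have "exp_neg_div (c / 2) (V / (a n)\<^sup>2) = exp (- 1024 * u)"
          unfolding exp_neg_div_def \<epsilon>(2) u_def using V an by (simp add: power_mult_distrib)
        then show ?thesis by simp
      next
        case False
        then have "u = 1" using V by (simp add: u_def x_def)
        moreover have "exp_neg_div (c / 2) (V / (a n)\<^sup>2) \<le> 1"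
          using c V by (auto simp: exp_neg_div_def)
        ultimately show ?thesis by simp
      qed
      have "exp (- 1024 * u) / 8 \<le> ?P n x \<or> (1 / u)\<^sup>2 / 64 \<le> real n * trunc_moment 3 D (a n) / x ^ 3"
        using symmetrized_lower[OF n x(1) an] V Vx by (simp add: V_def u_def)
      then show ?thesis
      proof
        assume *: "exp (- 1024 * u) / 8 \<le> ?P n x"
        have "?P n x \<le> ?P n (\<epsilon> * a n)"
          by (rule finite_measure_mono) (use x in auto)
        then have "exp (- 1024 * u) \<le> 8 * ?P n (\<epsilon> * a n)" using * by linarith
        then have "exp 1024 * exp (- 1024 * u) \<le> exp 1024 * (8 * ?P n (\<epsilon> * a n))"
          by (intro mult_left_mono) auto
        then have "exp (1024 - 1024 * u) \<le> K1 * ?P n (\<epsilon> * a n)"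
          by (simp add: K1_def exp_diff exp_minus field_simps)
        moreover have "0 \<le> K2 * ?R n" using K2 by simp
        ultimately show ?thesis using eu by linarith
      next
        assume *: "(1 / u)\<^sup>2 / 64 \<le> real n * trunc_moment 3 D (a n) / x ^ 3"
        have "real n * trunc_moment 3 D (a n) / x ^ 3 \<le> real n * trunc_moment 3 D (a n) / (\<epsilon> * a n) ^ 3"
          using x \<epsilon> an trunc_moment_nonneg by (intro divide_left_mono power_mono) auto
        with * have "(1 / u)\<^sup>2 \<le> 64 * (real n * trunc_moment 3 D (a n) / (\<epsilon> * a n) ^ 3)" by linarith
        then have "(1 / u)\<^sup>2 \<le> (64 / \<epsilon> ^ 3) * (real n * trunc_moment 3 D (a n) / a n ^ 3)"
          by (simp add: power_mult_distrib)
        then have "((1 / u)\<^sup>2) powr \<theta> \<le> ((64 / \<epsilon> ^ 3) * (real n * trunc_moment 3 D (a n) / a n ^ 3)) powr \<theta>"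
          using theta by (intro powr_mono2) auto
        then have le: "((1 / u)\<^sup>2) powr \<theta> \<le> (64 / \<epsilon> ^ 3) powr \<theta> * ?R n" by (simp only: powr_mult)
        have eq: "((1 / u)\<^sup>2) powr \<theta> = 1 / u powr (2 * \<theta>)"
          using u by (simp add: powr_powr powr_divide flip: powr_numeral)
        \<comment> \<open>The third-moment alternative controls only the power
          \<open>u powr (- 2 * \<theta>)\<close>, and the exponential is smaller than that up to
          \<open>K0\<close>.\<close>
        have "u powr (2 * \<theta>) * exp 1 \<le> K0 * exp u"
          using powr_le_exp[of u "2 * \<theta>"] u theta by (simp add: K0_def)
        then have "exp (1 - u) \<le> K0 * (1 / u powr (2 * \<theta>))"
          using u by (simp add: exp_diff field_simps)
        then have "exp (1 - u) \<le> K0 * ((1 / u)\<^sup>2) powr \<theta>" by (simp only: eq)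
        then have "exp (1 - u) \<le> K2 * ?R n"
          using mult_left_mono[OF le K0] by (simp add: K2_def mult.assoc)
        moreover have "exp (1024 - 1024 * u) \<le> exp (1 - u)" using u by simp
        moreover have "0 \<le> K1 * ?P n (\<epsilon> * a n)" by (simp add: K1_def)
        ultimately show ?thesis using eu by linarith
      qed
    qed
    have "quad D (a n) \<le> trunc_moment 2 D (a n) / (a n)\<^sup>2 + tail_prob D (a n)"
      using an by (intro D.quad_le_trunc_moment) auto
    then have "real n * quad D (a n) \<le> V / (a n)\<^sup>2 + real n * tail_prob D (a n)"
      using mult_left_mono[of "quad D (a n)" _ "real n"] by (fastforce simp: V_def algebra_simps)
    then have "exp_neg_div c (real n * quad D (a n)) \<le> exp_neg_div c (V / (a n)\<^sup>2 + real n * tail_prob D (a n))"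
      using c quad_nonneg by (intro exp_neg_div_mono) auto
    also have "\<dots> \<le> exp_neg_div (c / 2) (V / (a n)\<^sup>2) + exp_neg_div (c / 2) (real n * tail_prob D (a n))"
      using c V0 D.tail_prob_bounds by (intro exp_neg_div_add) auto
    also have "exp_neg_div (c / 2) (real n * tail_prob D (a n)) \<le> real n * tail_prob D (a n) / (c / 2)"
      using c D.tail_prob_bounds by (intro exp_neg_div_le) auto
    finally show "exp_neg_div c (real n * quad D (a n)) \<le> K1 * ?P n (\<epsilon> * a n) + K2 * ?R n + (2 / c) * (real n * tail_prob D (1 * a n))"
      using main by (simp add: mult_ac)
  qed (rule exp_neg_div_nonneg)
qed

end

section \<open>Passing between \<open>X 1\<close>, its symmetrization and the sums\<close>

context tail_series
begin

lemma tail_cond_symmetrize: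
  assumes "tail_cond L"
  shows "tail_cond D"
  unfolding tail_cond_def
proof (intro allI impI)
  fix \<epsilon> :: real assume \<epsilon>: "\<epsilon> > 0"
  show "tau_summable (\<lambda>n. real n * tail_prob D (\<epsilon> * a n))"
  proof (rule tau_summable_le)
    show "tau_summable (\<lambda>n. 2 * (real n * tail_prob L (\<epsilon> / 2 * a n)))"
      using assms[unfolded tail_cond_def, rule_format, of "\<epsilon> / 2"] \<epsilon> by (intro tau_summable_cmult) simp
    show "real n * tail_prob D (\<epsilon> * a n) \<le> 2 * (real n * tail_prob L (\<epsilon> / 2 * a n))" for n
      using mult_left_mono[OF tail_prob_D_le[of "\<epsilon> / 2 * a n"], of "real n"] by (simp add: mult_ac)
  qed (use D.tail_prob_bounds in auto)
qed

text \<open>Since \<open>a\<close> tends to infinity, the fixed median is eventually at most half of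
  \<open>\<epsilon> * a n\<close>; centering then costs half of the level.\<close>

lemma tail_cond_desymmetrize:
  assumes tail: "tail_cond D"
  shows "tail_cond L"
  unfolding tail_cond_def
proof (intro allI impI)
  fix \<epsilon> :: real assume \<epsilon>: "\<epsilon> > 0"
  obtain m where m: "is_median M (X 1) m" using median_exists[of "X 1"] by auto
  show "tau_summable (\<lambda>n. real n * tail_prob L (\<epsilon> * a n))"
  proof (rule tau_summable_mono)
    show "tau_summable (\<lambda>n. 2 * (real n * tail_prob D (\<epsilon> / 2 * a n)))"
      using tail[unfolded tail_cond_def, rule_format, of "\<epsilon> / 2"] \<epsilon> by (intro tau_summable_cmult) simp
    have "eventually (\<lambda>n. 2 * \<bar>m\<bar> / \<epsilon> \<le> a n) sequentially"
      using a_lim unfolding filterlim_at_top by blast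
    then show "\<forall>\<^sub>F n in sequentially. real n * tail_prob L (\<epsilon> * a n) \<le> 2 * (real n * tail_prob D (\<epsilon> / 2 * a n))"
      using eventually_ge_at_top[of 1]
    proof eventually_elim
      case (elim n)
      then have an: "a n > 0" and le: "\<bar>m\<bar> \<le> \<epsilon> / 2 * a n" using a_pos \<epsilon> by (auto simp: field_simps)
      have "tail_prob L (\<epsilon> * a n) \<le> prob {\<omega> \<in> space M. \<epsilon> / 2 * a n \<le> \<bar>X 1 \<omega> - m\<bar>}"
        unfolding tail_prob_L
      proof (rule finite_measure_mono)
        have "\<epsilon> / 2 * a n \<le> \<bar>x - m\<bar>" if "\<epsilon> * a n \<le> \<bar>x\<bar>" for x :: real
          using le that by (simp add: abs_if split: if_splits)
        then show "{\<omega> \<in> space M. \<epsilon> * a n \<le> \<bar>X 1 \<omega>\<bar>} \<subseteq> {\<omega> \<in> space M. \<epsilon> / 2 * a n \<le> \<bar>X 1 \<omega> - m\<bar>}"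
          by auto
      qed measurable
      also have "\<dots> \<le> 2 * tail_prob D (\<epsilon> / 2 * a n)"
        using an \<epsilon> by (intro prob_X_median_le[OF m]) auto
      finally have "real n * tail_prob L (\<epsilon> * a n) \<le> real n * (2 * tail_prob D (\<epsilon> / 2 * a n))"
        by (intro mult_left_mono) auto
      then show ?case by simp
    qed
  qed (use L.tail_prob_bounds in auto)
qed

lemma gauss_cond_symmetrize:
  assumes "gauss_cond L"
  shows "gauss_cond D"
  unfolding gauss_cond_def
proof (intro allI impI)
  fix c :: real assume c: "c > 0"
  show "tau_summable (\<lambda>n. exp_neg_div c (real n * quad D (a n)))"
  proof (rule tau_summable_le)
    show "tau_summable (\<lambda>n. exp_neg_div (c / 4) (real n * quad L (a n)))"
      using assms c unfolding gauss_cond_def by simp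
    fix n
    have "exp_neg_div c (real n * quad D (a n)) \<le> exp_neg_div (4 * (c / 4)) (4 * (real n * quad L (a n)))"
      using c quad_nonneg mult_left_mono[OF quad_D_le[of "a n"], of "real n"]
      by (intro exp_neg_div_mono) (auto simp: mult_ac)
    then show "exp_neg_div c (real n * quad D (a n)) \<le> exp_neg_div (c / 4) (real n * quad L (a n))"
      by (simp only: exp_neg_div_scale zero_less_numeral)
  qed (rule exp_neg_div_nonneg)
qed

text \<open>The contribution of the median \<open>m\<close> of \<open>X\<^sub>1\<close> to condition (iii): it is dominated by the
  variance unless \<open>X\<^sub>1 = m\<close> almost surely, and then \<open>S\<^sub>n = n m\<close>.\<close>

lemma tau_summable_median_term:
  assumes m: "is_median M (X 1) m" and G: "gauss_cond D"
    and star: "\<And>\<epsilon>. 0 < \<epsilon> \<Longrightarrow> tau_summable (\<lambda>n. prob {\<omega> \<in> space M. \<epsilon> * a n \<le> \<bar>S n \<omega>\<bar>})"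
    and c: "0 < c"
  shows "tau_summable (\<lambda>n. exp_neg_div c (real n * (m / a n)\<^sup>2))"
proof (cases "\<exists>t>0. tail_prob D t > 0")
  case True
  then obtain t where t: "t > 0" "tail_prob D t > 0" by blast
  \<comment> \<open>Chosen so that \<open>K\<close> times the lower bound of
    \<open>quad_ge_tail_prob\<close> is \<open>(m\<^sup>2 + 1) / (a n)\<^sup>2\<close>; the added 1
    keeps \<open>K\<close> positive when \<open>m = 0\<close>.\<close>
  define K where "K = (m\<^sup>2 + 1) / (t\<^sup>2 * tail_prob D t)"
  have K: "K > 0" using t by (auto simp: K_def intro!: divide_pos_pos add_nonneg_pos)
  show ?thesis
  proof (rule tau_summable_mono)
    show "tau_summable (\<lambda>n. exp_neg_div (c / K) (real n * quad D (a n)))"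
      using G K c unfolding gauss_cond_def by simp
    have "eventually (\<lambda>n. t \<le> a n) sequentially"
      using a_lim unfolding filterlim_at_top by blast
    then show "\<forall>\<^sub>F n in sequentially. exp_neg_div c (real n * (m / a n)\<^sup>2) \<le> exp_neg_div (c / K) (real n * quad D (a n))"
      using eventually_ge_at_top[of 1]
    proof eventually_elim
      case (elim n)
      have an: "a n > 0" using elim t by simp
      have "(m / a n)\<^sup>2 \<le> (m\<^sup>2 + 1) / (a n)\<^sup>2" by (simp add: power_divide divide_right_mono)
      also have "\<dots> = K * ((t / a n)\<^sup>2 * tail_prob D t)" using t by (simp add: K_def power_divide)
      also have "\<dots> \<le> K * quad D (a n)"
        using K t elim by (intro mult_left_mono D.quad_ge_tail_prob) auto
      finally have "real n * (m / a n)\<^sup>2 \<le> real n * (K * quad D (a n))" by (intro mult_left_mono) auto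
      then have "exp_neg_div c (real n * (m / a n)\<^sup>2) \<le> exp_neg_div (K * (c / K)) (K * (real n * quad D (a n)))"
        using c K by (intro exp_neg_div_mono) (auto simp: mult_ac)
      then show ?case using K by (simp only: exp_neg_div_scale)
    qed
  qed (rule exp_neg_div_nonneg)
next
  case False
  show ?thesis
  proof (cases "m = 0")
    case True
    then show ?thesis by (simp add: tau_summable_def exp_neg_div_def)
  next
    case m0: False
    \<comment> \<open>All tails of \<open>D\<close> at positive levels vanish, hence so do those of
      \<open>X 1 - m\<close>; the levels \<open>1 / Suc k\<close> exhaust the event
      \<open>X 1 \<noteq> m\<close>.\<close>
    have X1: "AE \<omega> in M. X 1 \<omega> = m"
    proof -
      have "AE \<omega> in M. \<not> 1 / real (Suc k) \<le> \<bar>X 1 \<omega> - m\<bar>" for k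
      proof -
        have "prob {\<omega> \<in> space M. 1 / real (Suc k) \<le> \<bar>X 1 \<omega> - m\<bar>} \<le> 2 * tail_prob D (1 / real (Suc k))"
          by (rule prob_X_median_le[OF m]) simp
        also have "tail_prob D (1 / real (Suc k)) = 0"
          using False D.tail_prob_bounds(1)[of "1 / real (Suc k)"] by (metis of_nat_0_less_iff zero_less_Suc zero_less_divide_1_iff order_le_less)
        finally have "prob {\<omega> \<in> space M. 1 / real (Suc k) \<le> \<bar>X 1 \<omega> - m\<bar>} = 0"
          by (simp add: measure_le_0_iff)
        then show ?thesis by (subst (asm) prob_Collect_eq_0) measurable
      qed
      then have "AE \<omega> in M. \<forall>k. \<not> 1 / real (Suc k) \<le> \<bar>X 1 \<omega> - m\<bar>" by (simp add: AE_all_countable)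
      then show ?thesis
      proof eventually_elim
        case (elim \<omega>)
        show ?case
        proof (rule ccontr)
          assume "X 1 \<omega> \<noteq> m"
          then obtain k where "inverse (real (Suc k)) < \<bar>X 1 \<omega> - m\<bar>"
            using reals_Archimedean[of "\<bar>X 1 \<omega> - m\<bar>"] by auto
          then show False using elim[rule_format, of k] by (simp add: inverse_eq_divide)
        qed
      qed
    qed
    have Xi: "AE \<omega> in M. X i \<omega> = m" if i: "i \<ge> 1" for i
    proof -
      have "prob {\<omega> \<in> space M. X i \<omega> \<in> {m}} = prob {\<omega> \<in> space M. X 1 \<omega> \<in> {m}}"
        using prob_X[OF i, of "{m}"] prob_X[of 1 "{m}"] by simp
      also have "\<dots> = 1" using X1 by (subst prob_Collect_eq_1) (simp_all)
      finally show ?thesis using i by (subst (asm) prob_Collect_eq_1) simp_all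
    qed
    have Sn: "AE \<omega> in M. S n \<omega> = real n * m" for n
    proof -
      have "AE \<omega> in M. \<forall>i\<in>{1..n}. X i \<omega> = m" by (rule AE_finite_allI) (use Xi in auto)
      then show ?thesis by eventually_elim (simp add: S_def)
    qed
    define \<kappa> where "\<kappa> = c / m\<^sup>2"
    have \<kappa>: "\<kappa> > 0" using c m0 by (simp add: \<kappa>_def)
    define K where "K = (3 * \<theta>) powr (3 * \<theta>) / \<kappa> powr (3 * \<theta>)"
    show ?thesis
    proof (rule tau_summable_le[OF tau_summable_add])
      show "tau_summable (\<lambda>n. prob {\<omega> \<in> space M. \<bar>m\<bar> * a n \<le> \<bar>S n \<omega>\<bar>})"
        using m0 by (intro star) auto
      show "tau_summable (\<lambda>n. K * (real n powr \<theta> / a n powr (3 * \<theta>)))"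
        by (rule tau_summable_cmult[OF tau_summable_w])
      fix n :: nat assume n: "n \<ge> 1"
      have an: "a n > 0" using a_pos n by auto
      have K0: "0 \<le> K * (real n powr \<theta> / a n powr (3 * \<theta>))" by (simp add: K_def)
      show "exp_neg_div c (real n * (m / a n)\<^sup>2) \<le> prob {\<omega> \<in> space M. \<bar>m\<bar> * a n \<le> \<bar>S n \<omega>\<bar>}
          + K * (real n powr \<theta> / a n powr (3 * \<theta>))"
      \<comment> \<open>If \<open>a n \<le> n\<close>, then \<open>|S n| = n * |m|\<close> reaches
        \<open>|m| * a n\<close> almost surely and the probability is 1. Otherwise the exponent is
        at least \<open>\<kappa> * a n\<close>, and the exponential falls below a multiple of
        \<open>a n powr (- 3 * \<theta>)\<close>.\<close>
      proof (cases "a n \<le> real n")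
        case True
        have "prob {\<omega> \<in> space M. \<bar>m\<bar> * a n \<le> \<bar>S n \<omega>\<bar>} = 1"
        proof (subst prob_Collect_eq_1)
          show "AE \<omega> in M. \<bar>m\<bar> * a n \<le> \<bar>S n \<omega>\<bar>"
            using Sn[of n] by eventually_elim (use True in \<open>simp add: abs_mult mult.commute mult_left_mono\<close>)
        qed measurable
        moreover have "exp_neg_div c (real n * (m / a n)\<^sup>2) \<le> 1"
          using c n by (auto simp: exp_neg_div_def)
        ultimately show ?thesis using K0 by linarith
      next
        case False
        have "\<kappa> * a n \<le> c / (real n * (m / a n)\<^sup>2)"
        proof -
          have "\<kappa> * a n * real n \<le> \<kappa> * a n * a n"
            using False \<kappa> an by (intro mult_left_mono) auto
          then have "\<kappa> * a n \<le> \<kappa> * a n * a n / real n" using n by (simp add: pos_le_divide_eq)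
          also have "\<dots> = c / (real n * (m / a n)\<^sup>2)" by (simp add: \<kappa>_def power2_eq_square mult_ac)
          finally show ?thesis .
        qed
        then have "exp_neg_div c (real n * (m / a n)\<^sup>2) \<le> exp (- (\<kappa> * a n))"
          using n m0 an by (simp add: exp_neg_div_def)
        also have "\<dots> \<le> (3 * \<theta>) powr (3 * \<theta>) / (\<kappa> * a n) powr (3 * \<theta>)"
          using powr_le_exp[of "\<kappa> * a n" "3 * \<theta>"] \<kappa> an theta by (simp add: exp_minus field_simps)
        also have "\<dots> = K * (1 / a n powr (3 * \<theta>))" using \<kappa> an by (simp add: K_def powr_mult)
        also have "\<dots> \<le> K * (real n powr \<theta> / a n powr (3 * \<theta>))"
          using n theta by (intro mult_left_mono divide_right_mono ge_one_powr_ge_zero) (auto simp: K_def)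
        finally show ?thesis using measure_nonneg[of M] by (smt (verit))
      qed
    qed (rule exp_neg_div_nonneg)
  qed
qed

text \<open>The hypothesis \<open>star\<close> enters through the median term: a constant
  \<open>X 1\<close> gives a \<open>D\<close> concentrated at 0, for which
  \<open>gauss_cond D\<close> carries no information.\<close>

lemma gauss_cond_desymmetrize:
  assumes G: "gauss_cond D"
    and star: "\<And>\<epsilon>. 0 < \<epsilon> \<Longrightarrow> tau_summable (\<lambda>n. prob {\<omega> \<in> space M. \<epsilon> * a n \<le> \<bar>S n \<omega>\<bar>})"
  shows "gauss_cond L"
  unfolding gauss_cond_def
proof (intro allI impI)
  fix c :: real assume c: "c > 0"
  obtain m where m: "is_median M (X 1) m" using median_exists[of "X 1"] by auto
  show "tau_summable (\<lambda>n. exp_neg_div c (real n * quad L (a n)))"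
  proof (rule tau_summable_le[OF tau_summable_add])
    show "tau_summable (\<lambda>n. exp_neg_div (c / 8) (real n * quad D (a n)))"
      using G c unfolding gauss_cond_def by simp
    show "tau_summable (\<lambda>n. exp_neg_div (c / 4) (real n * (m / a n)\<^sup>2))"
      using c by (intro tau_summable_median_term[OF m G star]) auto
    fix n :: nat assume n: "n \<ge> 1"
    have "real n * quad L (a n) \<le> real n * (4 * quad D (a n) + 2 * (m / a n)\<^sup>2)"
      using a_pos n by (intro mult_left_mono quad_L_le[OF m]) auto
    then have "exp_neg_div c (real n * quad L (a n)) \<le> exp_neg_div c (4 * (real n * quad D (a n)) + 2 * (real n * (m / a n)\<^sup>2))"
      using c quad_nonneg by (intro exp_neg_div_mono) (auto simp: algebra_simps)
    also have "\<dots> \<le> exp_neg_div (c / 2) (4 * (real n * quad D (a n))) + exp_neg_div (c / 2) (2 * (real n * (m / a n)\<^sup>2))"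
      using c quad_nonneg by (intro exp_neg_div_add) auto
    also have "exp_neg_div (c / 2) (4 * (real n * quad D (a n))) = exp_neg_div (c / 8) (real n * quad D (a n))"
      using exp_neg_div_scale[of 4 "c / 8"] by simp
    also have "exp_neg_div (c / 2) (2 * (real n * (m / a n)\<^sup>2)) = exp_neg_div (c / 4) (real n * (m / a n)\<^sup>2)"
      using exp_neg_div_scale[of 2 "c / 4"] by simp
    finally show "exp_neg_div c (real n * quad L (a n))
      \<le> exp_neg_div (c / 8) (real n * quad D (a n)) + exp_neg_div (c / 4) (real n * (m / a n)\<^sup>2)" .
  qed (rule exp_neg_div_nonneg)
qed

lemma symmetrized_series_of_star:
  assumes star: "\<And>\<epsilon>. 0 < \<epsilon> \<Longrightarrow> tau_summable (\<lambda>n. prob {\<omega> \<in> space M. \<epsilon> * a n \<le> \<bar>S n \<omega>\<bar>})" and "0 < \<epsilon>"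
  shows "tau_summable (\<lambda>n. prob {\<omega> \<in> space M. \<epsilon> * a n \<le> \<bar>S n \<omega> - S' n \<omega>\<bar>})"
proof (rule tau_summable_le)
  show "tau_summable (\<lambda>n. 2 * prob {\<omega> \<in> space M. \<epsilon> / 2 * a n \<le> \<bar>S n \<omega>\<bar>})"
    using assms(2) by (intro tau_summable_cmult star) simp
  show "prob {\<omega> \<in> space M. \<epsilon> * a n \<le> \<bar>S n \<omega> - S' n \<omega>\<bar>} \<le> 2 * prob {\<omega> \<in> space M. \<epsilon> / 2 * a n \<le> \<bar>S n \<omega>\<bar>}" for n
    using prob_S_diff_le[of "\<epsilon> / 2 * a n" n] by simp
qed simp

text \<open>As \<open>a\<close> is nondecreasing, the tail probabilities along
  \<open>\<epsilon> * a n\<close> form an admissible sequence for Condition A, which upgrades the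
  series with the minimum supplied by Levy's inequality.\<close>

lemma tail_cond_of_star:
  assumes A: "condition_A \<tau>"
    and star: "\<And>\<epsilon>. 0 < \<epsilon> \<Longrightarrow> tau_summable (\<lambda>n. prob {\<omega> \<in> space M. \<epsilon> * a n \<le> \<bar>S n \<omega>\<bar>})"
  shows "tail_cond D"
  unfolding tail_cond_def
proof (intro allI impI)
  fix \<epsilon> :: real assume \<epsilon>: "\<epsilon> > 0"
  define c where "c n = tail_prob D (\<epsilon> * a n)" for n
  have "tau_summable (\<lambda>n. min (real n * c n) 1)"
  proof (rule tau_summable_le)
    show "tau_summable (\<lambda>n. 4 * prob {\<omega> \<in> space M. \<epsilon> * a n \<le> \<bar>S n \<omega> - S' n \<omega>\<bar>})"
      by (intro tau_summable_cmult symmetrized_series_of_star star \<epsilon>)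
  qed (use symmetrized_min_tail D.tail_prob_bounds in \<open>auto simp: c_def\<close>)
  moreover have "0 \<le> c n" for n using D.tail_prob_bounds by (simp add: c_def)
  moreover have "c (Suc n) \<le> c n" if "n \<ge> 1" for n
    unfolding c_def using a_mono[OF that] \<epsilon> by (intro D.tail_prob_antimono mult_left_mono) auto
  ultimately have "summable (\<lambda>n. \<tau> (Suc n) * (real (Suc n) * c (Suc n)))"
    using A unfolding condition_A_def tau_summable_def by blast
  then show "tau_summable (\<lambda>n. real n * tail_prob D (\<epsilon> * a n))"
    by (simp add: tau_summable_def c_def)
qed

text \<open>Outside the exceptional set of (i) at level \<open>\<epsilon> / 2\<close>, a large
  \<open>S n\<close> forces a deviation from the median of at least
  \<open>\<epsilon> / 2 * a n\<close>; on that set the probability is bounded by 1.\<close>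

lemma star_sufficient:
  assumes \<mu>: "\<And>n. n \<ge> 1 \<Longrightarrow> is_median M (S n) (\<mu> n)"
    and i: "\<And>\<epsilon>. 0 < \<epsilon> \<Longrightarrow> tau_summable (\<lambda>n. of_bool (\<epsilon> * a n < \<bar>\<mu> n\<bar>))"
    and ii: "tail_cond L" and iii: "gauss_cond L" and \<epsilon>: "0 < \<epsilon>"
  shows "tau_summable (\<lambda>n. prob {\<omega> \<in> space M. \<epsilon> * a n \<le> \<bar>S n \<omega>\<bar>})"
proof (rule tau_summable_le[OF tau_summable_add])
  show "tau_summable (\<lambda>n. of_bool (\<epsilon> / 2 * a n < \<bar>\<mu> n\<bar>))" by (rule i) (use \<epsilon> in simp)
  show "tau_summable (\<lambda>n. 2 * prob {\<omega> \<in> space M. \<epsilon> / 2 * a n \<le> \<bar>S n \<omega> - S' n \<omega>\<bar>})"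
    using \<epsilon> by (intro tau_summable_cmult symmetrized_series tail_cond_symmetrize gauss_cond_symmetrize ii iii) simp
  fix n :: nat assume n: "n \<ge> 1"
  have an: "a n > 0" using a_pos n by auto
  show "prob {\<omega> \<in> space M. \<epsilon> * a n \<le> \<bar>S n \<omega>\<bar>} \<le> of_bool (\<epsilon> / 2 * a n < \<bar>\<mu> n\<bar>)
    + 2 * prob {\<omega> \<in> space M. \<epsilon> / 2 * a n \<le> \<bar>S n \<omega> - S' n \<omega>\<bar>}"
  proof (cases "\<epsilon> / 2 * a n < \<bar>\<mu> n\<bar>")
    case True
    then show ?thesis using measure_nonneg[of M] prob_le_1 by (simp add: add_increasing2)
  next
    case False
    have "\<epsilon> / 2 * a n \<le> \<bar>x - \<mu> n\<bar>" if "\<epsilon> * a n \<le> \<bar>x\<bar>" for x :: real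
      using False that by (simp add: abs_if split: if_splits)
    then have "prob {\<omega> \<in> space M. \<epsilon> * a n \<le> \<bar>S n \<omega>\<bar>} \<le> prob {\<omega> \<in> space M. \<epsilon> / 2 * a n \<le> \<bar>S n \<omega> - \<mu> n\<bar>}"
      by (intro finite_measure_mono) auto
    also have "\<dots> \<le> 2 * prob {\<omega> \<in> space M. \<epsilon> / 2 * a n \<le> \<bar>S n \<omega> - S' n \<omega>\<bar>}"
      using an \<epsilon> by (intro prob_S_median_le \<mu> n) auto
    finally show ?thesis using False by simp
  qed
qed simp

text \<open>If \<open>|\<mu> n| > \<epsilon> * a n\<close>, the half-line beyond
  \<open>\<mu> n\<close> has probability at least one half and lies in
  \<open>|S n| \<ge> \<epsilon> * a n\<close>. Hence any choice of medians works.\<close>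

lemma median_cond_of_star:
  assumes star: "\<And>\<epsilon>. 0 < \<epsilon> \<Longrightarrow> tau_summable (\<lambda>n. prob {\<omega> \<in> space M. \<epsilon> * a n \<le> \<bar>S n \<omega>\<bar>})"
  shows "\<exists>\<mu>. (\<forall>n. is_median M (S n) (\<mu> n)) \<and> (\<forall>\<epsilon>>0. tau_summable (\<lambda>n. of_bool (\<epsilon> * a n < \<bar>\<mu> n\<bar>)))"
proof -
  have "\<forall>n. \<exists>m. is_median M (S n) m" using median_exists by auto
  then obtain \<mu> where \<mu>: "\<And>n. is_median M (S n) (\<mu> n)" by metis
  have "tau_summable (\<lambda>n. of_bool (\<epsilon> * a n < \<bar>\<mu> n\<bar>))" if \<epsilon>: "\<epsilon> > 0" for \<epsilon>
  proof (rule tau_summable_le)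
    show "tau_summable (\<lambda>n. 2 * prob {\<omega> \<in> space M. \<epsilon> * a n \<le> \<bar>S n \<omega>\<bar>})"
      by (intro tau_summable_cmult star \<epsilon>)
    fix n :: nat assume n: "n \<ge> 1"
    show "of_bool (\<epsilon> * a n < \<bar>\<mu> n\<bar>) \<le> 2 * prob {\<omega> \<in> space M. \<epsilon> * a n \<le> \<bar>S n \<omega>\<bar>}"
    proof (cases "\<epsilon> * a n < \<bar>\<mu> n\<bar>")
      case True
      have "1 / 2 \<le> prob {\<omega> \<in> space M. \<epsilon> * a n \<le> \<bar>S n \<omega>\<bar>}"
      proof (cases "\<mu> n \<ge> 0")
        case pos: True
        have "prob {\<omega> \<in> space M. S n \<omega> \<ge> \<mu> n} \<le> prob {\<omega> \<in> space M. \<epsilon> * a n \<le> \<bar>S n \<omega>\<bar>}"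
          by (rule finite_measure_mono) (use pos True in auto)
        then show ?thesis using \<mu>[of n] unfolding is_median_def by linarith
      next
        case neg: False
        have "prob {\<omega> \<in> space M. S n \<omega> \<le> \<mu> n} \<le> prob {\<omega> \<in> space M. \<epsilon> * a n \<le> \<bar>S n \<omega>\<bar>}"
          by (rule finite_measure_mono) (use neg True in auto)
        then show ?thesis using \<mu>[of n] unfolding is_median_def by linarith
      qed
      then show ?thesis by simp
    qed simp
  qed simp
  with \<mu> show ?thesis by blast
qed

end

theorem theorem1:
  fixes M :: "'a measure" and X :: "nat \<Rightarrow> 'a \<Rightarrow> real"
    and \<tau> a :: "nat \<Rightarrow> real" and \<theta> C N :: real
  assumes P: "prob_space M"
    and rv: "\<And>i. i \<ge> 1 \<Longrightarrow> X i \<in> borel_measurable M"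
    and indep: "prob_space.indep_vars M (\<lambda>_. borel) X {1..}"
    and ident: "\<And>i. i \<ge> 1 \<Longrightarrow> distr M borel (X i) = distr M borel (X 1)"
    and tau_nonneg: "\<And>n. n \<ge> 1 \<Longrightarrow> \<tau> n \<ge> 0"
    and a_pos: "\<And>n. n \<ge> 1 \<Longrightarrow> a n > 0"
    and a_mono: "\<And>n. n \<ge> 1 \<Longrightarrow> a n \<le> a (Suc n)"
    and a_lim: "filterlim a at_top sequentially"
    and theta: "\<theta> \<ge> 1" and Cpos: "C > 0" and N: "N \<ge> 2"
    and key: "\<And>n::nat. real n \<ge> N \<Longrightarrow>
       summable (\<lambda>j. real (n + j) powr \<theta> * \<tau> (n + j) / a (n + j) powr (3 * \<theta>)) \<and>
       a n powr (3 * \<theta>) / real n powr (\<theta> - 1) *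
         (\<Sum>j. real (n + j) powr \<theta> * \<tau> (n + j) / a (n + j) powr (3 * \<theta>))
       \<le> C * (\<Sum>k=1..n-1. real k * \<tau> k)"
    and extra: "\<theta> > 1 \<Longrightarrow>
       Liminf sequentially (\<lambda>n. INF k\<in>{n..}.
          ereal (a k ^ 3 / (real k * a n ^ 3) * (\<Sum>j=1..n-1. real j * \<tau> j))) > 0"
  defines "cond_i \<equiv> (\<exists>\<mu> :: nat \<Rightarrow> real. (\<forall>n\<ge>1. is_median M (\<lambda>x. \<Sum>i=1..n. X i x) (\<mu> n)) \<and>
           (\<forall>\<epsilon>>0. summable (\<lambda>n. if \<bar>\<mu> (Suc n)\<bar> > \<epsilon> * a (Suc n) then \<tau> (Suc n) else 0)))"
    and "cond_ii \<equiv> (\<forall>\<epsilon>>0. summable (\<lambda>n. real (Suc n) * \<tau> (Suc n) *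
           measure M {x \<in> space M. \<bar>X 1 x\<bar> \<ge> \<epsilon> * a (Suc n)}))"
    and "cond_iii \<equiv> (\<forall>\<epsilon>>0. summable (\<lambda>n. \<tau> (Suc n) *
           exp_neg_div (\<epsilon>\<^sup>2 * (a (Suc n))\<^sup>2)
             (real (Suc n) * integral\<^sup>L M (\<lambda>x. (X 1 x)\<^sup>2 *
                indicator {y. \<bar>X 1 y\<bar> < \<epsilon> * a (Suc n)} x))))"
    and "star \<equiv> (\<forall>\<epsilon>>0. summable (\<lambda>n. \<tau> (Suc n) *
           measure M {x \<in> space M. \<bar>\<Sum>i=1..Suc n. X i x\<bar> \<ge> \<epsilon> * a (Suc n)}))"
  shows "(cond_i \<and> cond_ii \<and> cond_iii \<longrightarrow> star) \<and>
         (condition_A \<tau> \<and> star \<longrightarrow> cond_i \<and> cond_ii \<and> cond_iii)"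
proof -
  interpret weighted_scale \<tau> a \<theta> C N
    by (rule weighted_scale.intro) (fact tau_nonneg a_pos a_mono a_lim theta Cpos N key extra)+
  interpret iid_sequence M X
    by (rule iid_sequence.intro[OF P iid_sequence_axioms.intro]) (fact rv indep ident)+
  interpret tail_series \<tau> a \<theta> C N M X ..
  have trunc: "(\<integral>x. (X 1 x)\<^sup>2 * indicator {y. \<bar>X 1 y\<bar> < b} x \<partial>M) = trunc_moment 2 L b" for b
  proof -
    have "trunc_moment 2 L b = (\<integral>x. \<bar>trunc b (X 1 x)\<bar> ^ 2 \<partial>M)"
      unfolding trunc_moment_def L_def by (rule integral_distr) (use rv in auto)
    also have "\<dots> = (\<integral>x. (X 1 x)\<^sup>2 * indicator {y. \<bar>X 1 y\<bar> < b} x \<partial>M)"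
      by (intro Bochner_Integration.integral_cong) (auto simp: trunc_def)
    finally show ?thesis by simp
  qed
  have S: "(\<lambda>x. \<Sum>i=1..n. X i x) = S n" for n by (simp add: S_def fun_eq_iff)
  have i: "cond_i \<longleftrightarrow> (\<exists>\<mu>. (\<forall>n\<ge>1. is_median M (S n) (\<mu> n)) \<and>
      (\<forall>\<epsilon>>0. tau_summable (\<lambda>n. of_bool (\<epsilon> * a n < \<bar>\<mu> n\<bar>))))"
  proof -
    have "(if \<bar>\<mu> (Suc n)\<bar> > \<epsilon> * a (Suc n) then \<tau> (Suc n) else 0) = \<tau> (Suc n) * of_bool (\<epsilon> * a (Suc n) < \<bar>\<mu> (Suc n)\<bar>)"
      for \<mu> :: "nat \<Rightarrow> real" and \<epsilon> n by simp
    then show ?thesis unfolding cond_i_def S tau_summable_def by (simp only:)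
  qed
  have ii: "cond_ii \<longleftrightarrow> tail_cond L"
    unfolding cond_ii_def tail_cond_def tau_summable_def tail_prob_L by (simp only: mult_ac)
  have iii: "cond_iii \<longleftrightarrow> (\<forall>\<epsilon>>0. tau_summable (\<lambda>n. exp_neg_div (\<epsilon>\<^sup>2 * (a n)\<^sup>2) (real n * trunc_moment 2 L (\<epsilon> * a n))))"
    unfolding cond_iii_def tau_summable_def trunc ..
  have star: "star \<longleftrightarrow> (\<forall>\<epsilon>>0. tau_summable (\<lambda>n. prob {\<omega> \<in> space M. \<epsilon> * a n \<le> \<bar>S n \<omega>\<bar>}))"
    unfolding star_def tau_summable_def S_def ..
  have law: "real_law L" by (rule L.real_law_axioms)
  show ?thesis
  proof (intro conjI impI; (elim conjE)?)
    assume *: "cond_i" "cond_ii" "cond_iii"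
    obtain \<mu> where \<mu>: "\<And>n. n \<ge> 1 \<Longrightarrow> is_median M (S n) (\<mu> n)"
      "\<And>\<epsilon>. \<epsilon> > 0 \<Longrightarrow> tau_summable (\<lambda>n. of_bool (\<epsilon> * a n < \<bar>\<mu> n\<bar>))"
      using *(1) unfolding i by blast
    have tail: "tail_cond L" using *(2) ii by simp
    have gauss: "gauss_cond L" using *(3) unfolding iii by (intro gauss_condI[OF law tail]) blast
    show star unfolding star using star_sufficient[OF \<mu> tail gauss] by blast
  next
    assume A: "condition_A \<tau>" and "star"
    then have st: "\<And>\<epsilon>. 0 < \<epsilon> \<Longrightarrow> tau_summable (\<lambda>n. prob {\<omega> \<in> space M. \<epsilon> * a n \<le> \<bar>S n \<omega>\<bar>})"
      unfolding star by blast
    \<comment> \<open>This has to come first: the Gaussian condition is derived through the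
      third-moment series, which rests on \<open>tail_cond D\<close>.\<close>
    have tail: "tail_cond D" by (rule tail_cond_of_star[OF A st])
    have gauss: "gauss_cond D" by (rule gauss_cond_D[OF tail symmetrized_series_of_star[OF st]])
    show cond_i unfolding i using median_cond_of_star[OF st] by blast
    show cond_ii unfolding ii by (rule tail_cond_desymmetrize[OF tail])
    show cond_iii unfolding iii
      using gauss_condD[OF law gauss_cond_desymmetrize[OF gauss st]] by blast
  qed
qed

end
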